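(* Let $A$ be a unital regular semi-simple commutative Banach algebra. Assume there is $C>0$ such that for every $p \in \mathbb{N}$ and all $f_1,\ldots,f_p \in A$, $\|f_1 \cdots f_p\|_A \leq C \sum_{j=1}^p \|f_j\|_A \,\big\| \prod_{k \neq j}\check{f_k}\big\|_{\check{A}}$, and assume that every point of $\partial A$ is a peak point for the algebra $\check{A}$. Let $U$ be an automorphism of $A$ with induced homeomorphism $\varphi$ such that the set of all $\varphi$-periodic points is of first category in $\partial A$ and $\sigma(U) = \mathbb{T}$. Let $w \in A^{-1}$ and $T = wU$. Then $\sigma(T) = \sigma(\check{T})$.
   Context: $A$ is a unital commutative semi-simple Banach algebra with maximal ideal space $\mathfrak{M}_A$ and Shilov boundary $\partial A$; regular means the Gelfand transforms separate points from closed sets in $\mathfrak{M}_A$. For $f\in A$, $\check f$ is the restriction of the Gelfand transform $\hat f$ to $\partial A$; $\check A$ is the closure of $\{\check f: f\in A\}$ in $C(\partial A)$ with the sup norm $\|\cdot\|_{\check A}$. The automorphism $U$ induces a homeomorphism $\varphi$ of $\mathfrak{M}_A$ by $\widehat{Uf}(m)=\hat f(\varphi(m))$, with $\varphi(\partial A)=\partial A$. $T=wU$ means $Tf=w\cdot Uf$; $\check T$ is the operator on $\check A$ given by $(\check Tg)(t)=\check w(t)g(\varphi(t))$. A point is $\varphi$-periodic if $\varphi^n(t)=t$ for some $n\in\mathbb{N}$. A point $t\in\partial A$ is a peak point for $\check A$ if there is $g\in\check A$ with $g(t)=1$ and $|g(s)|<1$ for all $s\in\partial A\setminus\{t\}$.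 $\mathbb{T}$ is the unit circle. *)

theory Defs
  imports "HOL-Analysis.Analysis"
begin

text \<open>
  Model: a unital commutative semi-simple Banach algebra is represented through its
  Gelfand transform as an algebra A of continuous complex functions on its maximal
  ideal space, which is the (compact Hausdorff) type 'm.  Elements of A are identified
  with their Gelfand transforms; nrm is the Banach algebra norm.
\<close>

definition character :: "('m \<Rightarrow> complex) set \<Rightarrow> (('m \<Rightarrow> complex) \<Rightarrow> complex) \<Rightarrow> bool" where
  "character A chi \<longleftrightarrow>
     (\<forall>f\<in>A. \<forall>g\<in>A. chi (\<lambda>x. f x + g x) = chi f + chi g) \<and>
     (\<forall>c. \<forall>f\<in>A. chi (\<lambda>x. c * f x) = c * chi f) \<and>
     (\<forall>f\<in>A. \<forall>g\<in>A. chi (\<lambda>x. f x * g x) = chi f * chi g) \<and>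
     chi (\<lambda>x. 1) = 1"

text \<open>A is (the Gelfand image of) a unital commutative semi-simple Banach algebra with
  norm nrm, whose maximal ideal space is UNIV :: 'm set with its topology: A consists of
  continuous functions, is a unital subalgebra, complete for a submultiplicative
  algebra norm, separates points, and every character is evaluation at a point.\<close>
definition semisimple_banach_alg ::
  "('m::t2_space \<Rightarrow> complex) set \<Rightarrow> (('m \<Rightarrow> complex) \<Rightarrow> real) \<Rightarrow> bool" where
  "semisimple_banach_alg A nrm \<longleftrightarrow>
     compact (UNIV :: 'm set) \<and>
     (\<forall>f\<in>A. continuous_on UNIV f) \<and>
     (\<forall>c. (\<lambda>x. c) \<in> A) \<and>
     (\<forall>f\<in>A. \<forall>g\<in>A. (\<lambda>x. f x + g x) \<in> A \<and> (\<lambda>x. f x * g x) \<in> A) \<and>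
     (\<forall>c. \<forall>f\<in>A. (\<lambda>x. c * f x) \<in> A) \<and>
     (\<forall>f\<in>A. 0 \<le> nrm f \<and> (nrm f = 0 \<longleftrightarrow> f = (\<lambda>x. 0))) \<and>
     (\<forall>f\<in>A. \<forall>g\<in>A. nrm (\<lambda>x. f x + g x) \<le> nrm f + nrm g) \<and>
     (\<forall>f\<in>A. \<forall>g\<in>A. nrm (\<lambda>x. f x * g x) \<le> nrm f * nrm g) \<and>
     (\<forall>c. \<forall>f\<in>A. nrm (\<lambda>x. c * f x) = cmod c * nrm f) \<and>
     nrm (\<lambda>x. 1) = 1 \<and>
     (\<forall>fs. (\<forall>n. fs n \<in> A) \<and>
           (\<forall>e>0. \<exists>N. \<forall>m\<ge>N. \<forall>n\<ge>N. nrm (\<lambda>x. fs m x - fs n x) < e)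
           \<longrightarrow> (\<exists>f\<in>A. (\<lambda>n. nrm (\<lambda>x. fs n x - f x)) \<longlonglongrightarrow> 0)) \<and>
     (\<forall>x y. x \<noteq> y \<longrightarrow> (\<exists>f\<in>A. f x \<noteq> f y)) \<and>
     (\<forall>chi. character A chi \<longrightarrow> (\<exists>x. \<forall>f\<in>A. chi f = f x))"

definition regular_alg :: "('m::topological_space \<Rightarrow> complex) set \<Rightarrow> bool" where
  "regular_alg A \<longleftrightarrow>
     (\<forall>F x. closed F \<and> x \<notin> F \<longrightarrow> (\<exists>f\<in>A. f x \<noteq> 0 \<and> (\<forall>y\<in>F. f y = 0)))"

definition is_boundary :: "('m \<Rightarrow> complex) set \<Rightarrow> 'm set \<Rightarrow> bool" where
  "is_boundary A S \<longleftrightarrow> (\<forall>f\<in>A. \<exists>s\<in>S. \<forall>x. cmod (f x) \<le> cmod (f s))"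

definition shilov_boundary :: "('m::topological_space \<Rightarrow> complex) set \<Rightarrow> 'm set" where
  "shilov_boundary A = \<Inter> {S. closed S \<and> is_boundary A S}"

text \<open>Restriction to the Shilov boundary (set to 0 outside, an immaterial normalisation).\<close>
definition check :: "('m::topological_space \<Rightarrow> complex) set \<Rightarrow> ('m \<Rightarrow> complex) \<Rightarrow> ('m \<Rightarrow> complex)" where
  "check A f = (\<lambda>x. if x \<in> shilov_boundary A then f x else 0)"

definition check_alg :: "('m::topological_space \<Rightarrow> complex) set \<Rightarrow> ('m \<Rightarrow> complex) set" where
  "check_alg A = {g. (\<forall>x. x \<notin> shilov_boundary A \<longrightarrow> g x = 0) \<and>
       (\<forall>e>0. \<exists>f\<in>A. \<forall>x\<in>shilov_boundary A. cmod (g x - f x) < e)}"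

definition check_norm :: "('m::topological_space \<Rightarrow> complex) set \<Rightarrow> ('m \<Rightarrow> complex) \<Rightarrow> real" where
  "check_norm A g = (SUP x\<in>shilov_boundary A. cmod (g x))"

definition peak_point :: "('m \<Rightarrow> complex) set \<Rightarrow> 'm set \<Rightarrow> 'm \<Rightarrow> bool" where
  "peak_point B S t \<longleftrightarrow> t \<in> S \<and> (\<exists>g\<in>B. g t = 1 \<and> (\<forall>s\<in>S - {t}. cmod (g s) < 1))"

definition alg_automorphism ::
  "('m \<Rightarrow> complex) set \<Rightarrow> (('m \<Rightarrow> complex) \<Rightarrow> ('m \<Rightarrow> complex)) \<Rightarrow> bool" where
  "alg_automorphism A U \<longleftrightarrow> bij_betw U A A \<and>
     (\<forall>f\<in>A. \<forall>g\<in>A. U (\<lambda>x. f x + g x) = (\<lambda>x. U f x + U g x)) \<and>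
     (\<forall>c. \<forall>f\<in>A. U (\<lambda>x. c * f x) = (\<lambda>x. c * U f x)) \<and>
     (\<forall>f\<in>A. \<forall>g\<in>A. U (\<lambda>x. f x * g x) = (\<lambda>x. U f x * U g x)) \<and>
     U (\<lambda>x. 1) = (\<lambda>x. 1)"

definition op_spectrum ::
  "('m \<Rightarrow> complex) set \<Rightarrow> (('m \<Rightarrow> complex) \<Rightarrow> real) \<Rightarrow>
   (('m \<Rightarrow> complex) \<Rightarrow> ('m \<Rightarrow> complex)) \<Rightarrow> complex set" where
  "op_spectrum X nX L = {lam. \<not> (\<exists>S.
      (\<forall>f\<in>X. S f \<in> X) \<and>
      (\<forall>f\<in>X. \<forall>g\<in>X. S (\<lambda>x. f x + g x) = (\<lambda>x. S f x + S g x)) \<and>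
      (\<forall>c. \<forall>f\<in>X. S (\<lambda>x. c * f x) = (\<lambda>x. c * S f x)) \<and>
      (\<exists>K. \<forall>f\<in>X. nX (S f) \<le> K * nX f) \<and>
      (\<forall>f\<in>X. S (\<lambda>x. L f x - lam * f x) = f) \<and>
      (\<forall>f\<in>X. (\<lambda>x. L (S f) x - lam * S f x) = f))}"

definition nowhere_dense_in :: "'a::topological_space set \<Rightarrow> 'a set \<Rightarrow> bool" where
  "nowhere_dense_in S N \<longleftrightarrow> N \<subseteq> S \<and>
     (top_of_set S) interior_of ((top_of_set S) closure_of N) = {}"

definition first_category_in :: "'a::topological_space set \<Rightarrow> 'a set \<Rightarrow> bool" where
  "first_category_in S P \<longleftrightarrow> P \<subseteq> S \<and>
     (\<exists>F. countable F \<and> (\<forall>N\<in>F. nowhere_dense_in S N) \<and> P \<subseteq> \<Union>F)"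

end

theory Submission
  imports Defs "HOL-Computational_Algebra.Polynomial" "HOL-Real_Asymp.Real_Asymp"
begin

text \<open>
  Regularity makes the Shilov boundary the whole space, so \<^term>\<open>check_alg A\<close> is the uniform
  closure \<open>B\<close> of \<open>A\<close>; by scaling it suffices to compare the invertibility of \<open>T - 1\<close> on \<open>A\<close> and on \<open>B\<close>.
  On either algebra invertibility is equivalent to a dichotomy: a clopen \<open>\<phi>\<close>-invariant set \<open>F\<close> on which
  the powers of \<open>T\<close> contract uniformly, while they expand uniformly off \<open>F\<close>, whose
  indicator lies in the algebra.

  If \<open>T - 1\<close> is bounded below, then at every point the cocycle of \<open>\<bar>w\<bar>\<close> grows backwards or decays
  forwards at a uniform scale: otherwise functions peaking at an aperiodic point could be averaged
  along the orbit against a slightly rotated copy of \<open>T\<close>, and the Leibniz inequality would give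
  peaking functions of half the norm, again and again. If \<open>T - 1\<close> is onto, no orbit does both,
  because it would carry a measure annihilating the range. This splits the space into
  \<open>F\<close> and its complement.

  The indicator of \<open>F\<close> is a uniform limit of solutions of \<open>u - T\<^sup>N u = 1\<close>, and the Leibniz inequality
  makes uniformly approximable idempotents elements of \<open>A\<close>. Conversely, the dichotomy inverts \<open>T - 1\<close>
  by Neumann series on the two halves; they converge in \<open>A\<close> since, again by the Leibniz
  inequality and because \<open>U\<close> has spectral radius 1, the norms of the powers on each half
  decay like their sup norms.
\<close>

section \<open>Function algebras and composition operators\<close>

text \<open>The obstacle in \<open>A\<close>: the norm of a function peaking near a point has no
  bound in terms of its sup norm, so approximate eigenfunctions built from it cannot be tested
  against the lower bound of T - 1. Norms of peaking functions are therefore only compared with each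
  other; an improvement by a fixed factor contradicts their positive infimum. Such a comparison
  tolerates every loss that is subexponential in the number N = qn of iterates, and the losses are
  of this kind: those of the Leibniz inequality are polynomial, those of the powers of U are, up to
  constants, below every \<theta>^N with \<theta> > 1. The exponential gain comes from (X - 1)(1 + X
  + ... + X^(n-1)) = X^n - 1: applying the lower bound q times costs (4M)^q and leaves only the
  iterates T^(nl), while the q-th power of the geometric sum has coefficient mass n^q. With n a
  large multiple of M, some T^(nl) must therefore outweigh exponentially the iterate with the
  largest coefficient. The rotated copy of T singles out one iterate in this sum. The axioms used
  hold for \<open>A\<close>, for its uniform closure and for the inverse operator, so each argument
  is given only once.\<close>

locale function_algebra =
  fixes A :: "('m::t2_space \<Rightarrow> complex) set"
    and nrm :: "('m \<Rightarrow> complex) \<Rightarrow> real"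
  assumes compact_space: "compact (UNIV :: 'm set)"
    and continuous: "f \<in> A \<Longrightarrow> continuous_on UNIV f"
    and const [simp]: "(\<lambda>x. c) \<in> A"
    and add: "f \<in> A \<Longrightarrow> g \<in> A \<Longrightarrow> (\<lambda>x. f x + g x) \<in> A"
    and mult: "f \<in> A \<Longrightarrow> g \<in> A \<Longrightarrow> (\<lambda>x. f x * g x) \<in> A"
    and nrm_add: "f \<in> A \<Longrightarrow> g \<in> A \<Longrightarrow> nrm (\<lambda>x. f x + g x) \<le> nrm f + nrm g"
    and nrm_cmult: "f \<in> A \<Longrightarrow> nrm (\<lambda>x. c * f x) = cmod c * nrm f"
    and cmod_le_nrm: "f \<in> A \<Longrightarrow> cmod (f x) \<le> nrm f"
    and complete: "(\<And>n. fs n \<in> A) \<Longrightarrow>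
        (\<And>e. e > 0 \<Longrightarrow> \<exists>N. \<forall>m\<ge>N. \<forall>n\<ge>N. nrm (\<lambda>x. fs m x - fs n x) < e) \<Longrightarrow>
        \<exists>f\<in>A. (\<lambda>n. nrm (\<lambda>x. fs n x - f x)) \<longlonglongrightarrow> 0"
begin

lemma cmult: "f \<in> A \<Longrightarrow> (\<lambda>x. c * f x) \<in> A"
  using mult[of "\<lambda>x. c" f] by simp

lemma uminus: "f \<in> A \<Longrightarrow> (\<lambda>x. - f x) \<in> A"
  using cmult[of f "-1"] by simp

lemma diff: "f \<in> A \<Longrightarrow> g \<in> A \<Longrightarrow> (\<lambda>x. f x - g x) \<in> A"
  using add[of f "\<lambda>x. - g x"] uminus[of g] by simp

lemma sum_closed: "(\<And>i. i \<in> I \<Longrightarrow> f i \<in> A) \<Longrightarrow> (\<lambda>x. \<Sum>i\<in>I. f i x) \<in> A"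
proof (induction I rule: infinite_finite_induct)
  case (insert i I)
  then show ?case using add[of "f i" "\<lambda>x. \<Sum>i\<in>I. f i x"] by simp
qed auto

lemma prod_closed: "(\<And>i. i \<in> I \<Longrightarrow> f i \<in> A) \<Longrightarrow> (\<lambda>x. \<Prod>i\<in>I. f i x) \<in> A"
proof (induction I rule: infinite_finite_induct)
  case (insert i I)
  then show ?case using mult[of "f i" "\<lambda>x. \<Prod>i\<in>I. f i x"] by simp
qed auto

lemma power_closed: "f \<in> A \<Longrightarrow> (\<lambda>x. f x ^ n) \<in> A"
  using prod_closed[of "{..<n}" "\<lambda>_. f"] by simp

lemma nrm_nonneg [simp]: "f \<in> A \<Longrightarrow> 0 \<le> nrm f"
  using cmod_le_nrm[of f undefined] norm_ge_zero order_trans by blast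

lemma nrm_zero [simp]: "nrm (\<lambda>x. 0) = 0"
  using nrm_cmult[of "\<lambda>x. 0" 0] by simp

lemma nrm_uminus: "f \<in> A \<Longrightarrow> nrm (\<lambda>x. - f x) = nrm f"
  using nrm_cmult[of f "-1"] by simp

lemma nrm_diff: "f \<in> A \<Longrightarrow> g \<in> A \<Longrightarrow> nrm (\<lambda>x. f x - g x) \<le> nrm f + nrm g"
  using nrm_add[of f "\<lambda>x. - g x"] uminus[of g] nrm_uminus[of g] by simp

lemma nrm_diff_commute: "f \<in> A \<Longrightarrow> g \<in> A \<Longrightarrow> nrm (\<lambda>x. f x - g x) = nrm (\<lambda>x. g x - f x)"
  using nrm_uminus[OF diff, of f g] by simp

lemma nrm_triangle:
  assumes "f \<in> A" "g \<in> A" "h \<in> A"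
  shows "nrm (\<lambda>x. f x - h x) \<le> nrm (\<lambda>x. f x - g x) + nrm (\<lambda>x. g x - h x)"
  using nrm_add[OF diff[OF assms(1,2)] diff[OF assms(2,3)]] by simp

lemma nrm_sum: "(\<And>i. i \<in> I \<Longrightarrow> f i \<in> A) \<Longrightarrow> nrm (\<lambda>x. \<Sum>i\<in>I. f i x) \<le> (\<Sum>i\<in>I. nrm (f i))"
proof (induction I rule: infinite_finite_induct)
  case (insert i I)
  then show ?case
    using nrm_add[of "f i" "\<lambda>x. \<Sum>i\<in>I. f i x"] sum_closed[of I f] by fastforce
qed auto

lemma nrm_eq_0: "f \<in> A \<Longrightarrow> nrm f = 0 \<Longrightarrow> f = (\<lambda>x. 0)"
  using cmod_le_nrm[of f] by auto

text \<open>Norm limits are pointwise limits, since evaluations are dominated by \<open>nrm\<close>.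
  Both are delivered, so that an equation solved approximately passes to the limit point by point,
  with no appeal to continuity of the operator in \<open>nrm\<close>.\<close>

lemma geometric_limit:
  assumes fs: "\<And>n. fs n \<in> A"
    and step: "\<And>n. nrm (\<lambda>x. fs (Suc n) x - fs n x) \<le> K * r ^ n" and r: "0 \<le> r" "r < 1"
  obtains f where "f \<in> A" "\<And>x. (\<lambda>n. fs n x) \<longlonglongrightarrow> f x"
    "(\<lambda>n. nrm (\<lambda>x. fs n x - f x)) \<longlonglongrightarrow> 0" "nrm (\<lambda>x. f x - fs 0 x) \<le> K / (1 - r)"
proof -
  have K: "K \<ge> 0"
    using step[of 0] nrm_nonneg[OF diff[OF fs fs], of "Suc 0" 0] by simp
  have far: "nrm (\<lambda>x. fs (n + k) x - fs n x) \<le> K * r ^ n / (1 - r)" for n k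
  proof -
    have "nrm (\<lambda>x. fs (n + k) x - fs n x) \<le> (\<Sum>j<k. K * r ^ (n + j))"
    proof (induction k)
      case (Suc k)
      have "nrm (\<lambda>x. fs (n + Suc k) x - fs n x)
          \<le> nrm (\<lambda>x. fs (n + Suc k) x - fs (n + k) x) + nrm (\<lambda>x. fs (n + k) x - fs n x)"
        by (rule nrm_triangle) (rule fs)+
      then show ?case using Suc step[of "n + k"] by simp
    qed simp
    also have "\<dots> = K * r ^ n * (\<Sum>j<k. r ^ j)"
      by (simp add: power_add sum_distrib_left mult.assoc)
    also have "\<dots> \<le> K * r ^ n * (1 / (1 - r))"
    proof (intro mult_left_mono)
      show "(\<Sum>j<k. r ^ j) \<le> 1 / (1 - r)"
        using r by (simp add: sum_gp_strict divide_right_mono)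
    qed (use K r in auto)
    finally show ?thesis by simp
  qed
  have "\<exists>f\<in>A. (\<lambda>n. nrm (\<lambda>x. fs n x - f x)) \<longlonglongrightarrow> 0"
  proof (rule complete[OF fs])
    fix e :: real assume e: "e > 0"
    have "(\<lambda>n. 2 * (K * r ^ n / (1 - r))) \<longlonglongrightarrow> 2 * (K * 0 / (1 - r))"
      by (intro tendsto_intros LIMSEQ_power_zero) (use r in auto)
    then have "\<forall>\<^sub>F n in sequentially. 2 * (K * r ^ n / (1 - r)) < e"
      using e by (auto dest: order_tendstoD(2))
    then obtain N where N: "2 * (K * r ^ N / (1 - r)) < e"
      by (auto simp: eventually_sequentially)
    have "nrm (\<lambda>x. fs m x - fs n x) < e" if "m \<ge> N" "n \<ge> N" for m n
    proof -
      have "nrm (\<lambda>x. fs m x - fs n x) \<le> nrm (\<lambda>x. fs m x - fs N x) + nrm (\<lambda>x. fs N x - fs n x)"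
        by (rule nrm_triangle) (rule fs)+
      also have "nrm (\<lambda>x. fs N x - fs n x) = nrm (\<lambda>x. fs n x - fs N x)"
        by (rule nrm_diff_commute) (rule fs)+
      finally show ?thesis using far[of N "m - N"] far[of N "n - N"] that N by simp
    qed
    then show "\<exists>N. \<forall>m\<ge>N. \<forall>n\<ge>N. nrm (\<lambda>x. fs m x - fs n x) < e" by blast
  qed
  then obtain f where f: "f \<in> A" "(\<lambda>n. nrm (\<lambda>x. fs n x - f x)) \<longlonglongrightarrow> 0" by blast
  have pt: "(\<lambda>n. fs n x) \<longlonglongrightarrow> f x" for x
  proof -
    have "(\<lambda>n. fs n x - f x) \<longlonglongrightarrow> 0"
      by (rule Lim_null_comparison[OF _ f(2)]) (use cmod_le_nrm[OF diff[OF fs f(1)]] in auto)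
    then show ?thesis by (simp add: LIM_zero_iff)
  qed
  have "nrm (\<lambda>x. f x - fs 0 x) \<le> K / (1 - r)"
  proof (rule tendsto_lowerbound)
    show "(\<lambda>n. nrm (\<lambda>x. fs n x - f x) + K / (1 - r)) \<longlonglongrightarrow> K / (1 - r)"
      using tendsto_add[OF f(2) tendsto_const] by simp
    show "\<forall>\<^sub>F n in sequentially. nrm (\<lambda>x. f x - fs 0 x) \<le> nrm (\<lambda>x. fs n x - f x) + K / (1 - r)"
    proof (intro always_eventually allI)
      fix n
      have "nrm (\<lambda>x. f x - fs 0 x) \<le> nrm (\<lambda>x. f x - fs n x) + nrm (\<lambda>x. fs n x - fs 0 x)"
        by (rule nrm_triangle) (rule fs f)+
      then show "nrm (\<lambda>x. f x - fs 0 x) \<le> nrm (\<lambda>x. fs n x - f x) + K / (1 - r)"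
        using far[of 0 n] nrm_diff_commute[OF f(1) fs, of n] by simp
    qed
  qed auto
  then show thesis using that f pt by blast
qed

text \<open>A composition operator has closed graph, because point evaluations are bounded.\<close>

lemma composition_bounded:
  assumes comp: "\<And>f. f \<in> A \<Longrightarrow> (\<lambda>x. f (\<sigma> x)) \<in> A"
  obtains K where "K \<ge> 1" "\<And>f. f \<in> A \<Longrightarrow> nrm (\<lambda>x. f (\<sigma> x)) \<le> K * nrm f"
proof -
  \<comment> \<open>\<open>Metric_space\<close> asks for nonnegativity and symmetry on the whole
    type, hence the value 0 outside \<open>A\<close>.\<close>
  define d where "d f g = (if f \<in> A \<and> g \<in> A then nrm (\<lambda>x. f x - g x) else 0)" for f g
  interpret M: Metric_space A d
  proof
    show "d f g = 0 \<longleftrightarrow> f = g" if "f \<in> A" "g \<in> A" for f g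
      using nrm_eq_0[OF diff[OF that]] that by (auto simp: d_def fun_eq_iff)
    show "d f h \<le> d f g + d g h" if "f \<in> A" "g \<in> A" "h \<in> A" for f g h
      using that nrm_triangle by (simp add: d_def)
  qed (use nrm_diff_commute in \<open>auto simp: d_def diff\<close>)
  have "M.mcomplete"
    unfolding M.mcomplete_def
  proof (intro allI impI)
    fix fs assume "M.MCauchy fs"
    then have fs: "\<And>n. fs n \<in> A"
      and c: "\<And>e. e > 0 \<Longrightarrow> \<exists>N. \<forall>n n'. N \<le> n \<longrightarrow> N \<le> n' \<longrightarrow> d (fs n) (fs n') < e"
      by (auto simp: M.MCauchy_def)
    have "\<exists>f\<in>A. (\<lambda>n. nrm (\<lambda>x. fs n x - f x)) \<longlonglongrightarrow> 0"
      by (rule complete[OF fs]) (use c fs in \<open>auto simp: d_def\<close>)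
    then obtain f where f: "f \<in> A" "(\<lambda>n. d (fs n) f) \<longlonglongrightarrow> 0"
      using fs by (auto simp: d_def)
    then have "limitin M.mtopology fs f sequentially"
      using fs by (auto simp: M.limitin_metric_dist_null)
    then show "\<exists>f. limitin M.mtopology fs f sequentially" by blast
  qed
  define S where "S k = {f \<in> A. nrm (\<lambda>x. f (\<sigma> x)) \<le> real k}" for k
  \<comment> \<open>Baire: the sets \<open>S k\<close> exhaust the complete space \<open>A\<close>,
    so the closure of one of them contains a ball.\<close>
  have "\<exists>k. M.mtopology interior_of (M.mtopology closure_of (S k)) \<noteq> {}"
  proof (rule ccontr)
    assume "\<not> ?thesis"
    then have "M.mtopology interior_of \<Union>(range (\<lambda>k. M.mtopology closure_of (S k))) = {}"
      by (intro M.metric_Baire_category_alt \<open>M.mcomplete\<close>) auto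
    moreover have "\<Union>(range (\<lambda>k. M.mtopology closure_of (S k))) = A"
    proof
      show "\<Union>(range (\<lambda>k. M.mtopology closure_of (S k))) \<subseteq> A"
        using closure_of_subset_topspace[of M.mtopology] by auto
      show "A \<subseteq> \<Union>(range (\<lambda>k. M.mtopology closure_of (S k)))"
      proof
        fix f assume f: "f \<in> A"
        obtain k where "nrm (\<lambda>x. f (\<sigma> x)) \<le> real k" using real_arch_simple by blast
        then have "f \<in> S k" using f by (simp add: S_def)
        moreover have "S k \<subseteq> M.mtopology closure_of (S k)"
          by (rule closure_of_subset) (auto simp: S_def)
        ultimately show "f \<in> \<Union>(range (\<lambda>k. M.mtopology closure_of (S k)))" by blast
      qed
    qed
    moreover have "M.mtopology interior_of A = A"
      using interior_of_topspace[of M.mtopology] by simp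
    ultimately show False using const by auto
  qed
  then obtain k f0 r where f0: "f0 \<in> A" "r > 0"
    and sub: "M.mball f0 r \<subseteq> M.mtopology closure_of (S k)"
    by (auto simp: M.in_interior_of_mball M.metric_interior_of)
  have ball: "\<exists>h\<in>S k. nrm (\<lambda>x. f x - h x) < e"
    if "f \<in> A" "nrm (\<lambda>x. f0 x - f x) < r" "e > 0" for f e
  proof -
    have "f \<in> M.mball f0 r" using that f0 by (simp add: d_def)
    then have "f \<in> M.mtopology closure_of (S k)" using sub by blast
    then obtain h where "h \<in> S k" "h \<in> M.mball f e"
      using \<open>e > 0\<close> by (auto simp: M.metric_closure_of)
    then show ?thesis using that by (auto simp: d_def S_def)
  qed
  \<comment> \<open>Write f as s((f0 + g) - f0) and approximate both points of the ball by elements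
    of \<open>S k\<close>. Their difference has norm at most 2k after composition, and the remainder
    is half the admissible size, ready for the next round.\<close>
  have approx: "\<exists>h\<in>A. nrm (\<lambda>x. h (\<sigma> x)) \<le> s * real (2 * k) \<and> nrm (\<lambda>x. f x - h x) \<le> s * r / 4"
    if f: "f \<in> A" "nrm f \<le> s * r / 2" and s: "s > 0" for f s
  proof -
    define g where "g = (\<lambda>x. complex_of_real (1 / s) * f x)"
    have g: "g \<in> A" unfolding g_def by (rule cmult[OF f(1)])
    have ng: "nrm g \<le> r / 2"
    proof -
      have "nrm g = 1 / s * nrm f"
        unfolding g_def nrm_cmult[OF f(1)] norm_of_real using s by simp
      also have "\<dots> \<le> 1 / s * (s * r / 2)" using f s by (intro mult_left_mono) auto
      finally show ?thesis using s by simp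
    qed
    have fg: "(\<lambda>x. f0 x + g x) \<in> A" by (rule add[OF f0(1) g])
    obtain h1 where h1: "h1 \<in> S k" "nrm (\<lambda>x. (f0 x + g x) - h1 x) < r / 8"
      using ball[OF fg, of "r / 8"] nrm_uminus[OF g] ng f0 by auto
    obtain h2 where h2: "h2 \<in> S k" "nrm (\<lambda>x. f0 x - h2 x) < r / 8"
      using ball[OF f0(1), of "r / 8"] f0 by auto
    have hA: "h1 \<in> A" "h2 \<in> A" using h1 h2 by (auto simp: S_def)
    define h where "h = (\<lambda>x. complex_of_real s * (h1 x - h2 x))"
    have "nrm (\<lambda>x. h (\<sigma> x)) = s * nrm (\<lambda>x. h1 (\<sigma> x) - h2 (\<sigma> x))"
      using nrm_cmult[OF diff[OF comp[OF hA(1)] comp[OF hA(2)]], of "complex_of_real s"] s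
      by (simp add: h_def)
    also have "\<dots> \<le> s * real (2 * k)"
      using nrm_diff[OF comp[OF hA(1)] comp[OF hA(2)]] h1 h2 s
      by (intro mult_left_mono) (auto simp: S_def)
    finally have 1: "nrm (\<lambda>x. h (\<sigma> x)) \<le> s * real (2 * k)" .
    have e1: "(\<lambda>x. (f0 x + g x) - h1 x) \<in> A" and e2: "(\<lambda>x. f0 x - h2 x) \<in> A"
      by (intro diff fg hA f0)+
    have "(\<lambda>x. f x - h x) = (\<lambda>x. complex_of_real s * (((f0 x + g x) - h1 x) - (f0 x - h2 x)))"
      using s by (auto simp: h_def g_def algebra_simps)
    then have "nrm (\<lambda>x. f x - h x) = s * nrm (\<lambda>x. ((f0 x + g x) - h1 x) - (f0 x - h2 x))"
      using nrm_cmult[OF diff[OF e1 e2], of "complex_of_real s"] s by simp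
    also have "\<dots> \<le> s * (r / 4)"
      using nrm_diff[OF e1 e2] h1 h2 s by (intro mult_left_mono) auto
    finally show ?thesis using 1 cmult[OF diff[OF hA]] unfolding h_def by (intro bexI) auto
  qed
  \<comment> \<open>Iterating \<open>approx\<close> with s = 2^-n makes f a limit of functions whose
    compositions converge in \<open>A\<close>; evaluation at points identifies their limit as the
    composition of f. This is the closed graph argument.\<close>
  have bd: "nrm (\<lambda>x. f (\<sigma> x)) \<le> real (4 * k)" if f: "f \<in> A" "nrm f \<le> r / 2" for f
  proof -
      have "\<exists>g. \<forall>n. (g n \<in> A \<and> nrm (\<lambda>x. f x - g n x) \<le> (1/2) ^ n * r / 2 \<and> (n = 0 \<longrightarrow> g n = (\<lambda>x. 0))) \<and>
        nrm (\<lambda>x. g (Suc n) (\<sigma> x) - g n (\<sigma> x)) \<le> (1/2) ^ n * real (2 * k)"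
      proof (rule dependent_nat_choice)
        show "\<exists>x. x \<in> A \<and> nrm (\<lambda>xa. f xa - x xa) \<le> (1 / 2) ^ 0 * r / 2 \<and> (0 = (0::nat) \<longrightarrow> x = (\<lambda>x. 0))"
          using f by (intro exI[of _ "\<lambda>x. 0"]) auto
      next
        fix g n assume g: "g \<in> A \<and> nrm (\<lambda>x. f x - g x) \<le> (1/2) ^ n * r / 2 \<and> (n = 0 \<longrightarrow> g = (\<lambda>x. 0))"
        obtain h where h: "h \<in> A" "nrm (\<lambda>x. h (\<sigma> x)) \<le> (1/2) ^ n * real (2 * k)"
          "nrm (\<lambda>x. (f x - g x) - h x) \<le> (1/2) ^ n * r / 4"
          using approx[OF diff[OF f(1)], of g "(1/2) ^ n"] g by auto
        show "\<exists>y. (y \<in> A \<and> nrm (\<lambda>x. f x - y x) \<le> (1/2) ^ Suc n * r / 2 \<and> (Suc n = 0 \<longrightarrow> y = (\<lambda>x. 0))) \<and>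
          nrm (\<lambda>x. y (\<sigma> x) - g (\<sigma> x)) \<le> (1/2) ^ n * real (2 * k)"
          by (rule exI[of _ "\<lambda>x. g x + h x"]) (use g h add in \<open>auto simp: diff_diff_eq\<close>)
      qed
    then obtain g where "\<And>n. (g n \<in> A \<and> nrm (\<lambda>x. f x - g n x) \<le> (1/2) ^ n * r / 2 \<and> (n = 0 \<longrightarrow> g n = (\<lambda>x. 0))) \<and>
        nrm (\<lambda>x. g (Suc n) (\<sigma> x) - g n (\<sigma> x)) \<le> (1/2) ^ n * real (2 * k)"
      by blast
    then have g: "\<And>n. g n \<in> A" "\<And>n. nrm (\<lambda>x. f x - g n x) \<le> (1/2) ^ n * r / 2"
      "\<And>n. nrm (\<lambda>x. g (Suc n) (\<sigma> x) - g n (\<sigma> x)) \<le> real (2 * k) * (1/2) ^ n" "g 0 = (\<lambda>x. 0)"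
      by (simp_all add: mult.commute)
    obtain u where u: "u \<in> A" "\<And>x. (\<lambda>n. g n (\<sigma> x)) \<longlonglongrightarrow> u x"
      "nrm (\<lambda>x. u x - g 0 (\<sigma> x)) \<le> real (2 * k) / (1 - 1/2)"
      by (rule geometric_limit[of "\<lambda>n x. g n (\<sigma> x)" "real (2 * k)" "1/2"]) (use g comp in auto)
    have "(\<lambda>n. g n y) \<longlonglongrightarrow> f y" for y
    proof -
      have "(\<lambda>n. f y - g n y) \<longlonglongrightarrow> 0"
      proof (rule Lim_null_comparison)
        show "\<forall>\<^sub>F n in sequentially. norm (f y - g n y) \<le> (1/2) ^ n * r / 2"
          using cmod_le_nrm[OF diff[OF f(1) g(1)]] g(2) order_trans by (intro always_eventually) blast
        have "(\<lambda>n. (1/2) ^ n * r / 2) \<longlonglongrightarrow> 0 * r / 2"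
          by (intro tendsto_intros LIMSEQ_power_zero) auto
        then show "(\<lambda>n. (1/2) ^ n * r / 2) \<longlonglongrightarrow> 0" by simp
      qed
      from tendsto_diff[OF tendsto_const[of "f y"] this] show ?thesis by simp
    qed
    then have "u = (\<lambda>x. f (\<sigma> x))"
      using u(2) LIMSEQ_unique by blast
    then show ?thesis using u g by simp
  qed
  show thesis
  proof
    show "8 * real k / r + 1 \<ge> 1" using f0 by simp
    fix f assume f: "f \<in> A"
    show "nrm (\<lambda>x. f (\<sigma> x)) \<le> (8 * real k / r + 1) * nrm f"
    proof (cases "nrm f = 0")
      case True
      then have "f = (\<lambda>x. 0)" using nrm_eq_0 f by blast
      then show ?thesis by simp
    next
      case False
      then have pos: "nrm f > 0" using nrm_nonneg[OF f] by linarith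
      define s where "s = r / (2 * nrm f)"
      have s: "s > 0" using pos f0 by (simp add: s_def)
      have "nrm (\<lambda>x. complex_of_real s * f x) \<le> r / 2"
      proof -
        have "s * nrm f = r / 2" using pos by (simp add: s_def)
        then show ?thesis unfolding nrm_cmult[OF f] norm_of_real using s by simp
      qed
      then have "nrm (\<lambda>x. complex_of_real s * f (\<sigma> x)) \<le> real (4 * k)"
        using bd[OF cmult[OF f]] by blast
      then have "s * nrm (\<lambda>x. f (\<sigma> x)) \<le> 4 * real k"
        using nrm_cmult[OF comp[OF f], of "complex_of_real s"] s by simp
      then have "nrm (\<lambda>x. f (\<sigma> x)) \<le> 8 * real k / r * nrm f"
        using pos f0 by (simp add: s_def field_simps)
      then show ?thesis using pos by (simp add: algebra_simps)
    qed
  qed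
qed

text \<open>A lower bound forces injectivity, so a right inverse picked by choice is linear,
  two-sided and bounded. The two conditions stay separate because they feed different arguments: the
  lower bound gives one-sided growth along orbits, surjectivity forbids both sides at once.\<close>

lemma op_spectrum_iff:
  assumes L: "\<And>f. f \<in> A \<Longrightarrow> L f \<in> A"
    and Ladd: "\<And>f g. f \<in> A \<Longrightarrow> g \<in> A \<Longrightarrow> L (\<lambda>x. f x + g x) = (\<lambda>x. L f x + L g x)"
    and Lmult: "\<And>c f. f \<in> A \<Longrightarrow> L (\<lambda>x. c * f x) = (\<lambda>x. c * L f x)"
  shows "lam \<notin> op_spectrum A nrm L \<longleftrightarrow>
    (\<forall>f\<in>A. \<exists>g\<in>A. (\<lambda>x. L g x - lam * g x) = f) \<and>
    (\<exists>K. \<forall>g\<in>A. nrm g \<le> K * nrm (\<lambda>x. L g x - lam * g x))" (is "_ \<longleftrightarrow> ?surj \<and> ?below")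
proof
  define D where "D g = (\<lambda>x. L g x - lam * g x)" for g
  have D: "D g \<in> A" if "g \<in> A" for g unfolding D_def by (intro diff L cmult that)
  {
    assume "lam \<notin> op_spectrum A nrm L"
    then obtain S where S: "\<forall>f\<in>A. S f \<in> A" "\<exists>K. \<forall>f\<in>A. nrm (S f) \<le> K * nrm f"
      "\<forall>f\<in>A. S (D f) = f" "\<forall>f\<in>A. D (S f) = f"
      unfolding op_spectrum_def D_def mem_Collect_eq not_not by blast
    show "?surj \<and> ?below"
      unfolding D_def[symmetric] using S D by metis
  next
    assume "?surj \<and> ?below"
    then obtain K where sur: "\<And>f. f \<in> A \<Longrightarrow> \<exists>g\<in>A. D g = f"
      and K: "\<And>g. g \<in> A \<Longrightarrow> nrm g \<le> K * nrm (D g)" unfolding D_def by auto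
    have inj: "g = h" if "g \<in> A" "h \<in> A" "D g = D h" for g h
    proof -
      have e: "(\<lambda>x. g x - h x) = (\<lambda>x. g x + (-1) * h x)" by simp
      have "L (\<lambda>x. g x - h x) = (\<lambda>x. L g x - L h x)"
        unfolding e Ladd[OF that(1) cmult[OF that(2)]] Lmult[OF that(2)] by simp
      then have "D (\<lambda>x. g x - h x) = (\<lambda>x. D g x - D h x)"
        by (auto simp: D_def algebra_simps)
      then have "nrm (\<lambda>x. g x - h x) \<le> 0" using K[OF diff[OF that(1,2)]] that(3) by simp
      then have "(\<lambda>x. g x - h x) = (\<lambda>x. 0)"
        using nrm_eq_0[OF diff] nrm_nonneg[OF diff] that by (meson order_antisym)
      then show ?thesis by (auto simp: fun_eq_iff)
    qed
    define S where "S f = (SOME g. g \<in> A \<and> D g = f)" for f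
    have S: "S f \<in> A \<and> D (S f) = f" if "f \<in> A" for f
      using someI_ex[of "\<lambda>g. g \<in> A \<and> D g = f"] sur[OF that] unfolding S_def by blast
    have "S (\<lambda>x. f x + g x) = (\<lambda>x. S f x + S g x)" if "f \<in> A" "g \<in> A" for f g
    proof (rule inj)
      show "D (S (\<lambda>x. f x + g x)) = D (\<lambda>x. S f x + S g x)"
        using S[OF add[OF that]] S[OF that(1)] S[OF that(2)]
        by (auto simp: D_def Ladd algebra_simps fun_eq_iff)
    qed (use S that add in auto)
    moreover have "S (\<lambda>x. c * f x) = (\<lambda>x. c * S f x)" if "f \<in> A" for f c
    proof (rule inj)
      show "D (S (\<lambda>x. c * f x)) = D (\<lambda>x. c * S f x)"
        using S[OF cmult[OF that]] S[OF that] by (auto simp: D_def Lmult algebra_simps fun_eq_iff)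
    qed (use S that cmult in auto)
    moreover have "S (D f) = f" if "f \<in> A" for f
      by (rule inj) (use S D that in auto)
    moreover have "nrm (S f) \<le> K * nrm f" if "f \<in> A" for f
      using K[of "S f"] S[OF that] by simp
    ultimately show "lam \<notin> op_spectrum A nrm L"
      unfolding op_spectrum_def mem_Collect_eq not_not D_def[symmetric]
      using S by (intro exI[of _ S] conjI exI[of _ K]) auto
  }
qed

section \<open>Growth of the powers of a composition operator\<close>

lemma composition_power_closed:
  assumes "\<And>f. f \<in> A \<Longrightarrow> (\<lambda>x. f (\<sigma> x)) \<in> A"
  shows "f \<in> A \<Longrightarrow> (\<lambda>x. f ((\<sigma> ^^ n) x)) \<in> A"
proof (induction n arbitrary: f)
  case (Suc n)
  show ?case using Suc.IH[OF assms[OF Suc.prems]] by simp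
qed simp

lemma composition_power_nrm:
  assumes c: "\<And>f. f \<in> A \<Longrightarrow> (\<lambda>x. f (\<sigma> x)) \<in> A"
    and K: "\<And>f. f \<in> A \<Longrightarrow> nrm (\<lambda>x. f (\<sigma> x)) \<le> K * nrm f" "K \<ge> 0"
  shows "f \<in> A \<Longrightarrow> nrm (\<lambda>x. f ((\<sigma> ^^ n) x)) \<le> K ^ n * nrm f"
proof (induction n arbitrary: f)
  case (Suc n)
  have "nrm (\<lambda>x. f ((\<sigma> ^^ Suc n) x)) \<le> K ^ n * nrm (\<lambda>x. f (\<sigma> x))"
    using Suc.IH[OF c[OF Suc.prems]] by simp
  also have "\<dots> \<le> K ^ n * (K * nrm f)" using K Suc.prems by (intro mult_left_mono) auto
  finally show ?case by (simp add: mult_ac)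
qed simp

text \<open>A lower bound at \<xi> survives with twice the constant on the ball
  \<open>B \<xi>\<close>, whose radius lets the perturbation cost at most half of
  \<open>nrm g\<close>. Finitely many such balls cover the compact disc.\<close>

lemma resolvent_bound_uniform:
  assumes comp: "\<And>f. f \<in> A \<Longrightarrow> (\<lambda>x. f (\<sigma> x)) \<in> A"
    and Ku: "Ku \<ge> 1" "\<And>f. f \<in> A \<Longrightarrow> nrm (\<lambda>x. f (\<sigma> x)) \<le> Ku * nrm f"
    and below: "\<And>\<xi>. cmod \<xi> \<le> \<rho> \<Longrightarrow> \<exists>K. \<forall>g\<in>A. nrm g \<le> K * nrm (\<lambda>x. g x - \<xi> * g (\<sigma> x))"
  obtains M where "M \<ge> 1"
    "\<And>\<xi> g. cmod \<xi> \<le> \<rho> \<Longrightarrow> g \<in> A \<Longrightarrow> nrm g \<le> M * nrm (\<lambda>x. g x - \<xi> * g (\<sigma> x))"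
proof -
  have D: "(\<lambda>x. g x - \<xi> * g (\<sigma> x)) \<in> A" if "g \<in> A" for g \<xi>
    by (intro diff cmult comp that)
  have "\<exists>K\<ge>1. \<forall>g\<in>A. nrm g \<le> K * nrm (\<lambda>x. g x - \<xi> * g (\<sigma> x))" if \<xi>: "cmod \<xi> \<le> \<rho>" for \<xi>
  proof -
    obtain K where K: "\<And>g. g \<in> A \<Longrightarrow> nrm g \<le> K * nrm (\<lambda>x. g x - \<xi> * g (\<sigma> x))"
      using below[OF \<xi>] by blast
    have "nrm g \<le> max K 1 * nrm (\<lambda>x. g x - \<xi> * g (\<sigma> x))" if "g \<in> A" for g
    proof -
      have "K * nrm (\<lambda>x. g x - \<xi> * g (\<sigma> x)) \<le> max K 1 * nrm (\<lambda>x. g x - \<xi> * g (\<sigma> x))"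
        by (intro mult_right_mono nrm_nonneg[OF D[OF that]]) auto
      then show ?thesis using K[OF that] by linarith
    qed
    then show ?thesis by (intro exI[of _ "max K 1"]) auto
  qed
  then obtain K where K: "\<And>\<xi>. cmod \<xi> \<le> \<rho> \<Longrightarrow> K \<xi> \<ge> 1"
    "\<And>\<xi> g. cmod \<xi> \<le> \<rho> \<Longrightarrow> g \<in> A \<Longrightarrow> nrm g \<le> K \<xi> * nrm (\<lambda>x. g x - \<xi> * g (\<sigma> x))"
    by metis
  define B where "B \<xi> = ball \<xi> (1 / (2 * K \<xi> * Ku))" for \<xi>
  have near: "nrm g \<le> 2 * K \<xi> * nrm (\<lambda>x. g x - \<zeta> * g (\<sigma> x))"
    if \<xi>: "cmod \<xi> \<le> \<rho>" and \<zeta>: "\<zeta> \<in> B \<xi>" and g: "g \<in> A" for \<xi> \<zeta> g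
  proof -
    have d: "cmod (\<zeta> - \<xi>) * (K \<xi> * Ku) \<le> 1 / 2"
      using \<zeta> K(1)[OF \<xi>] Ku by (simp add: B_def dist_norm norm_minus_commute field_simps)
    have "nrm g \<le> K \<xi> * nrm (\<lambda>x. g x - \<xi> * g (\<sigma> x))" by (rule K(2)[OF \<xi> g])
    also have "(\<lambda>x. g x - \<xi> * g (\<sigma> x)) = (\<lambda>x. (g x - \<zeta> * g (\<sigma> x)) + (\<zeta> - \<xi>) * g (\<sigma> x))"
      by (simp add: algebra_simps)
    also have "nrm \<dots> \<le> nrm (\<lambda>x. g x - \<zeta> * g (\<sigma> x)) + nrm (\<lambda>x. (\<zeta> - \<xi>) * g (\<sigma> x))"
      by (intro nrm_add D[OF g] cmult comp g)
    also have "nrm (\<lambda>x. (\<zeta> - \<xi>) * g (\<sigma> x)) \<le> cmod (\<zeta> - \<xi>) * (Ku * nrm g)"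
      unfolding nrm_cmult[OF comp[OF g]] by (intro mult_left_mono Ku g) auto
    finally have "nrm g \<le> K \<xi> * (nrm (\<lambda>x. g x - \<zeta> * g (\<sigma> x)) + cmod (\<zeta> - \<xi>) * (Ku * nrm g))"
      using K(1)[OF \<xi>] by (auto intro: mult_left_mono)
    also have "\<dots> = K \<xi> * nrm (\<lambda>x. g x - \<zeta> * g (\<sigma> x)) + (cmod (\<zeta> - \<xi>) * (K \<xi> * Ku)) * nrm g"
      by (simp add: algebra_simps)
    also have "\<dots> \<le> K \<xi> * nrm (\<lambda>x. g x - \<zeta> * g (\<sigma> x)) + 1 / 2 * nrm g"
      by (intro add_left_mono mult_right_mono d) (simp add: g)
    finally show ?thesis by simp
  qed
  have cov: "cball 0 \<rho> \<subseteq> (\<Union>\<xi>\<in>cball 0 \<rho>. B \<xi>)"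
  proof
    fix \<xi> :: complex assume \<xi>: "\<xi> \<in> cball 0 \<rho>"
    then have "1 / (2 * K \<xi> * Ku) > 0" using K(1)[of \<xi>] Ku by simp
    then have "\<xi> \<in> B \<xi>" by (simp add: B_def)
    then show "\<xi> \<in> (\<Union>\<xi>\<in>cball 0 \<rho>. B \<xi>)" using \<xi> by blast
  qed
  obtain F where F: "F \<subseteq> cball 0 \<rho>" "finite F" "cball 0 \<rho> \<subseteq> (\<Union>\<xi>\<in>F. B \<xi>)"
    by (rule compactE_image[OF compact_cball _ cov]) (simp add: B_def)
  have Kpos: "K \<xi> \<ge> 1" if "\<xi> \<in> F" for \<xi> using F(1) K(1) that by auto
  show thesis
  proof
    show "1 + 2 * (\<Sum>\<xi>\<in>F. K \<xi>) \<ge> 1"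
      using sum_nonneg[of F K] Kpos by fastforce
    fix \<zeta> g assume \<zeta>: "cmod \<zeta> \<le> \<rho>" and g: "g \<in> A"
    then obtain \<xi> where \<xi>: "\<xi> \<in> F" "\<zeta> \<in> B \<xi>" using F(3) by auto
    have "K \<xi> \<le> (\<Sum>\<xi>\<in>F. K \<xi>)"
      by (rule member_le_sum) (use \<xi> F Kpos in \<open>auto intro: order_trans[OF zero_le_one]\<close>)
    then have "2 * K \<xi> * nrm (\<lambda>x. g x - \<zeta> * g (\<sigma> x))
        \<le> (1 + 2 * (\<Sum>\<xi>\<in>F. K \<xi>)) * nrm (\<lambda>x. g x - \<zeta> * g (\<sigma> x))"
      by (intro mult_right_mono nrm_nonneg[OF D[OF g]]) auto
    then show "nrm g \<le> (1 + 2 * (\<Sum>\<xi>\<in>F. K \<xi>)) * nrm (\<lambda>x. g x - \<zeta> * g (\<sigma> x))"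
      using near[of \<xi> \<zeta> g] \<xi> F(1) g by auto
  qed
qed

text \<open>
  Rickart's elementary proof of the spectral radius formula: the resolvents of the powers
  are averages of resolvents over roots of unity, hence equicontinuous in the radius.
\<close>

lemma composition_growth:
  assumes comp: "\<And>f. f \<in> A \<Longrightarrow> (\<lambda>x. f (\<sigma> x)) \<in> A"
    and surj: "\<And>\<xi> f. cmod \<xi> < 1 \<Longrightarrow> f \<in> A \<Longrightarrow> \<exists>g\<in>A. (\<lambda>x. g x - \<xi> * g (\<sigma> x)) = f"
    and below: "\<And>\<xi>. cmod \<xi> < 1 \<Longrightarrow> \<exists>K. \<forall>g\<in>A. nrm g \<le> K * nrm (\<lambda>x. g x - \<xi> * g (\<sigma> x))"
    and \<theta>: "\<theta> > 1"
  obtains K where "K \<ge> 1" "\<And>n f. f \<in> A \<Longrightarrow> nrm (\<lambda>x. f ((\<sigma> ^^ n) x)) \<le> K * \<theta> ^ n * nrm f"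
proof -
  obtain Ku where Ku: "Ku \<ge> 1" "\<And>f. f \<in> A \<Longrightarrow> nrm (\<lambda>x. f (\<sigma> x)) \<le> Ku * nrm f"
    using composition_bounded[of \<sigma>, OF comp] by blast
  define \<rho> where "\<rho> = 1 / \<theta>"
  have \<rho>: "0 < \<rho>" "\<rho> < 1" using \<theta> by (auto simp: \<rho>_def)
  obtain M where M: "M \<ge> 1"
    "\<And>\<xi> g. cmod \<xi> \<le> \<rho> \<Longrightarrow> g \<in> A \<Longrightarrow> nrm g \<le> M * nrm (\<lambda>x. g x - \<xi> * g (\<sigma> x))"
    by (rule resolvent_bound_uniform[where \<sigma> = \<sigma>, OF comp Ku, of \<rho>]) (use \<rho> below in force)+
  have compn: "(\<lambda>x. f ((\<sigma> ^^ n) x)) \<in> A" if "f \<in> A" for f n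
    by (rule composition_power_closed[OF _ that]) (rule comp)
  have nrmn: "f \<in> A \<Longrightarrow> nrm (\<lambda>x. f ((\<sigma> ^^ n) x)) \<le> Ku ^ n * nrm f" for f n
    by (rule composition_power_nrm[where \<sigma> = \<sigma>, OF comp Ku(2)]) (use Ku in auto)
  have root: "\<exists>\<eta>. cmod \<eta> = 1 \<and> \<eta> ^ (2 ^ m) = (-1::complex)" for m :: nat
    by (rule exI[of _ "cis (pi / 2 ^ m)"]) (simp add: Complex.DeMoivre)
  have dbl: "(\<sigma> ^^ N) ((\<sigma> ^^ N) x) = (\<sigma> ^^ (N + N)) x" for N x by (simp add: funpow_add)
  have two: "(2::nat) ^ Suc m = 2 ^ m + 2 ^ m" for m by simp
  \<comment> \<open>With V the composition operator and N = 2^m, the operator 1 - \<xi>^(2N) V^(2N)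
    is the product of 1 - \<xi>^N V^N and 1 + \<xi>^N V^N, and a root \<eta>^N = -1 turns the second
    factor into the first kind at \<eta>\<xi>. As g is the mean of g + t and g - t, the constant M
    is kept for all m.\<close>
  have below_pow: "nrm g \<le> M * nrm (\<lambda>x. g x - \<xi> ^ (2 ^ m) * g ((\<sigma> ^^ (2 ^ m)) x))"
    if "cmod \<xi> \<le> \<rho>" "g \<in> A" for m \<xi> g
    using that
  proof (induction m arbitrary: \<xi> g)
    case 0
    then show ?case using M(2) by simp
  next
    case (Suc m)
    define N where "N = (2::nat) ^ m"
    obtain \<eta> where \<eta>: "cmod \<eta> = 1" "\<eta> ^ N = -1" using root[of m] by (auto simp: N_def)
    define t where "t = (\<lambda>x. \<xi> ^ N * g ((\<sigma> ^^ N) x))"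
    have t: "t \<in> A" unfolding t_def by (intro cmult compn Suc.prems)
    have e: "(\<lambda>x. g x - \<xi> ^ (2 ^ Suc m) * g ((\<sigma> ^^ (2 ^ Suc m)) x)) =
      (\<lambda>x. (g x + t x) - \<xi> ^ N * (g ((\<sigma> ^^ N) x) + t ((\<sigma> ^^ N) x)))"
      "(\<lambda>x. g x - \<xi> ^ (2 ^ Suc m) * g ((\<sigma> ^^ (2 ^ Suc m)) x)) =
      (\<lambda>x. (g x - t x) - (\<eta> * \<xi>) ^ N * (g ((\<sigma> ^^ N) x) - t ((\<sigma> ^^ N) x)))"
      unfolding two N_def[symmetric] by (auto simp: t_def dbl power_add \<eta> power_mult_distrib algebra_simps)
    have 1: "nrm (\<lambda>x. g x + t x) \<le> M * nrm (\<lambda>x. g x - \<xi> ^ (2 ^ Suc m) * g ((\<sigma> ^^ (2 ^ Suc m)) x))"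
      unfolding e(1) N_def by (rule Suc.IH) (use Suc.prems t add in auto)
    have 2: "nrm (\<lambda>x. g x - t x) \<le> M * nrm (\<lambda>x. g x - \<xi> ^ (2 ^ Suc m) * g ((\<sigma> ^^ (2 ^ Suc m)) x))"
      unfolding e(2) N_def by (rule Suc.IH) (use Suc.prems t diff \<eta> in \<open>auto simp: norm_mult\<close>)
    have "g = (\<lambda>x. (1/2) * ((g x + t x) + (g x - t x)))" by (simp add: algebra_simps)
    then have "nrm g = 1/2 * nrm (\<lambda>x. (g x + t x) + (g x - t x))"
      using nrm_cmult[OF add[OF add[OF Suc.prems(2) t] diff[OF Suc.prems(2) t]], of "1/2"] by simp
    then show ?case
      using nrm_add[OF add[OF Suc.prems(2) t] diff[OF Suc.prems(2) t]] 1 2 by simp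
  qed
  \<comment> \<open>From the resolvent identity at exponent 1: two resolvents, M each, and one
    composition, Ku.\<close>
  define M' where "M' = M * Ku * M"
  have M': "M' \<ge> 1" using M Ku mult_mono[of 1 "M * Ku" 1 M] mult_mono[of 1 M 1 Ku] by (simp add: M'_def)
  \<comment> \<open>The inverse of 1 - \<xi>^(2N) V^(2N) is the mean of the inverses of 1 - \<xi>^N
    V^N and 1 + \<xi>^N V^N, so the Lipschitz constant in the radius does not deteriorate with
    m.\<close>
  have lip: "\<exists>g\<in>A. \<exists>g'\<in>A. (\<lambda>x. g x - \<xi> ^ (2 ^ m) * g ((\<sigma> ^^ (2 ^ m)) x)) = f \<and>
      (\<lambda>x. g' x - (of_real c * \<xi>) ^ (2 ^ m) * g' ((\<sigma> ^^ (2 ^ m)) x)) = f \<and>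
      nrm (\<lambda>x. g x - g' x) \<le> M' * (1 - c) * nrm f"
    if "cmod \<xi> \<le> \<rho>" "0 \<le> c" "c \<le> 1" "f \<in> A" for m \<xi> c f
    using that
  proof (induction m arbitrary: \<xi>)
    case 0
    have c\<xi>: "cmod (of_real c * \<xi>) \<le> \<rho>"
      using 0 mult_mono[of c 1 "cmod \<xi>" \<rho>] by (simp add: norm_mult)
    obtain g where g: "g \<in> A" "(\<lambda>x. g x - \<xi> * g (\<sigma> x)) = f"
      using surj[of \<xi> f] 0 \<rho> by auto
    obtain g' where g': "g' \<in> A" "(\<lambda>x. g' x - (of_real c * \<xi>) * g' (\<sigma> x)) = f"
      using surj[of "of_real c * \<xi>" f] c\<xi> 0 \<rho> by auto
    have "(\<lambda>x. (g x - g' x) - \<xi> * (g (\<sigma> x) - g' (\<sigma> x))) = (\<lambda>x. ((1 - of_real c) * \<xi>) * g' (\<sigma> x))"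
    proof
      fix x
      show "(g x - g' x) - \<xi> * (g (\<sigma> x) - g' (\<sigma> x)) = ((1 - of_real c) * \<xi>) * g' (\<sigma> x)"
        using fun_cong[OF g(2), of x] fun_cong[OF g'(2), of x] by (simp add: algebra_simps)
    qed
    then have "nrm (\<lambda>x. g x - g' x) \<le> M * nrm (\<lambda>x. ((1 - of_real c) * \<xi>) * g' (\<sigma> x))"
      using M(2)[OF \<open>cmod \<xi> \<le> \<rho>\<close> diff[OF g(1) g'(1)]] by simp
    also have "nrm (\<lambda>x. ((1 - of_real c) * \<xi>) * g' (\<sigma> x)) = cmod ((1 - of_real c) * \<xi>) * nrm (\<lambda>x. g' (\<sigma> x))"
      by (rule nrm_cmult[OF comp[OF g'(1)]])
    also have "\<dots> \<le> (1 - c) * (Ku * (M * nrm f))"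
    proof (rule mult_mono)
      have "cmod (1 - complex_of_real c) = 1 - c"
        using 0 by (metis abs_of_nonneg diff_ge_0_iff_ge norm_of_real of_real_1 of_real_diff)
      then show "cmod ((1 - of_real c) * \<xi>) \<le> 1 - c"
        using 0 \<rho> mult_left_mono[of "cmod \<xi>" 1 "1 - c"] by (simp add: norm_mult)
      have "nrm g' \<le> M * nrm f" using M(2)[OF c\<xi> g'(1)] g'(2) by simp
      then show "nrm (\<lambda>x. g' (\<sigma> x)) \<le> Ku * (M * nrm f)"
        using Ku(2)[OF g'(1)] mult_left_mono[of "nrm g'" "M * nrm f" Ku] Ku(1) by linarith
    qed (use 0 comp g' in auto)
    finally have "nrm (\<lambda>x. g x - g' x) \<le> M' * (1 - c) * nrm f"
      using M(1) by (simp add: M'_def algebra_simps)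
    then show ?case using g g' by (intro bexI[of _ g] bexI[of _ g']) auto
  next
    case (Suc m)
    define N where "N = (2::nat) ^ m"
    obtain \<eta> where \<eta>: "cmod \<eta> = 1" "\<eta> ^ N = -1" using root[of m] by (auto simp: N_def)
    obtain g1 g1' where g1: "g1 \<in> A" "g1' \<in> A" "\<And>x. g1 x - \<xi> ^ N * g1 ((\<sigma> ^^ N) x) = f x"
      "\<And>x. g1' x - (of_real c * \<xi>) ^ N * g1' ((\<sigma> ^^ N) x) = f x"
      "nrm (\<lambda>x. g1 x - g1' x) \<le> M' * (1 - c) * nrm f"
      using Suc.IH[OF Suc.prems] unfolding N_def[symmetric] by (auto simp: fun_eq_iff)
    obtain g2 g2' where g2: "g2 \<in> A" "g2' \<in> A" "\<And>x. g2 x + \<xi> ^ N * g2 ((\<sigma> ^^ N) x) = f x"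
      "\<And>x. g2' x + (of_real c * \<xi>) ^ N * g2' ((\<sigma> ^^ N) x) = f x"
      "nrm (\<lambda>x. g2 x - g2' x) \<le> M' * (1 - c) * nrm f"
      using Suc.IH[of "\<eta> * \<xi>"] Suc.prems \<eta> unfolding N_def[symmetric]
      by (auto simp: fun_eq_iff norm_mult power_mult_distrib)
    have avg: "(1/2) * (a x + b x) - \<zeta> ^ (N + N) * ((1/2) * (a ((\<sigma> ^^ (N + N)) x) + b ((\<sigma> ^^ (N + N)) x))) = f x"
      if a: "\<And>x. a x - \<zeta> ^ N * a ((\<sigma> ^^ N) x) = f x" and b: "\<And>x. b x + \<zeta> ^ N * b ((\<sigma> ^^ N) x) = f x"
      for a b :: "'m \<Rightarrow> complex" and \<zeta> x
    proof -
      have a1: "a x = f x + \<zeta> ^ N * a ((\<sigma> ^^ N) x)" for x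
        using a[of x] by (simp add: algebra_simps)
      have b1: "b x = f x - \<zeta> ^ N * b ((\<sigma> ^^ N) x)" for x
        using b[of x] by (simp add: algebra_simps)
      have "a x = f x + \<zeta> ^ N * (f ((\<sigma> ^^ N) x) + \<zeta> ^ N * a ((\<sigma> ^^ N) ((\<sigma> ^^ N) x)))"
        unfolding a1[of "(\<sigma> ^^ N) x", symmetric] by (rule a1)
      moreover have "b x = f x - \<zeta> ^ N * (f ((\<sigma> ^^ N) x) - \<zeta> ^ N * b ((\<sigma> ^^ N) ((\<sigma> ^^ N) x)))"
        unfolding b1[of "(\<sigma> ^^ N) x", symmetric] by (rule b1)
      ultimately have "a x + b x = 2 * f x + \<zeta> ^ (N + N) * (a ((\<sigma> ^^ (N + N)) x) + b ((\<sigma> ^^ (N + N)) x))"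
        by (simp add: power_add dbl[symmetric] algebra_simps)
      then show ?thesis by (simp add: add_divide_distrib)
    qed
    let ?g = "\<lambda>x. (1/2) * (g1 x + g2 x)" and ?g' = "\<lambda>x. (1/2) * (g1' x + g2' x)"
    have "(\<lambda>x. ?g x - ?g' x) = (\<lambda>x. (1/2) * ((g1 x - g1' x) + (g2 x - g2' x)))"
      by (simp add: algebra_simps)
    then have "nrm (\<lambda>x. ?g x - ?g' x) = 1/2 * nrm (\<lambda>x. (g1 x - g1' x) + (g2 x - g2' x))"
      using nrm_cmult[OF add[OF diff[OF g1(1,2)] diff[OF g2(1,2)]], of "1/2"] by simp
    also have "\<dots> \<le> M' * (1 - c) * nrm f"
      using nrm_add[OF diff[OF g1(1,2)] diff[OF g2(1,2)]] g1(5) g2(5) by simp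
    finally have "nrm (\<lambda>x. ?g x - ?g' x) \<le> M' * (1 - c) * nrm f" .
    moreover have "?g \<in> A" "?g' \<in> A"
      by (rule cmult[OF add[OF g1(1) g2(1)]], rule cmult[OF add[OF g1(2) g2(2)]])
    ultimately show ?case
      unfolding two N_def[symmetric]
      by (intro bexI[of _ ?g] bexI[of _ ?g'] conjI ext avg g1(3,4) g2(3,4))
  qed
  \<comment> \<open>Power boundedness of sV; the goal is \<open>good \<rho>\<close>.\<close>
  define good where "good s \<longleftrightarrow> (\<exists>K\<ge>1. \<forall>n. \<forall>f\<in>A. s ^ n * nrm (\<lambda>x. f ((\<sigma> ^^ n) x)) \<le> K * nrm f)" for s :: real
  \<comment> \<open>Since cs < s', the operators (cs)^N V^N tend to 0, so the solution h' for radius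
    cs is within a quarter of f; \<open>lip\<close> moves to radius s for another quarter. Thus g
    and f = g - s^N V^N g differ by at most half of \<open>nrm f\<close>, which makes s^N V^N a
    contraction.\<close>
  have good_step: "good s" if s': "good s'" "0 < s'" and s: "0 < s" "s \<le> \<rho>" and c: "0 \<le> c" "c \<le> 1"
    "c * s < s'" "M' * (1 - c) \<le> 1/4" for s s' c
  proof -
    obtain K where K: "K \<ge> 1" "\<And>n f. f \<in> A \<Longrightarrow> s' ^ n * nrm (\<lambda>x. f ((\<sigma> ^^ n) x)) \<le> K * nrm f"
      using s'(1) by (auto simp: good_def)
    have cs: "c * s / s' < 1" "0 \<le> c * s / s'" using s s' c by auto
    have "(\<lambda>n. K * M * (c * s / s') ^ n) \<longlonglongrightarrow> K * M * 0"
      by (intro tendsto_intros LIMSEQ_power_zero) (use cs in auto)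
    then have "\<forall>\<^sub>F n in sequentially. K * M * (c * s / s') ^ n < 1/4"
      by (auto dest!: order_tendstoD(2)[of _ _ _ "1/4"])
    then obtain m0 where m0: "\<And>n. n \<ge> m0 \<Longrightarrow> K * M * (c * s / s') ^ n < 1/4"
      by (auto simp: eventually_sequentially)
    define N where "N = (2::nat) ^ m0"
    have Nsm: "K * M * (c * s / s') ^ N < 1/4" by (rule m0) (simp add: N_def less_imp_le)
    have contr: "s ^ N * nrm (\<lambda>x. g ((\<sigma> ^^ N) x)) \<le> nrm g" if g: "g \<in> A" for g
    proof -
      define \<xi> where "\<xi> = complex_of_real s"
      have \<xi>: "cmod \<xi> \<le> \<rho>" using s by (simp add: \<xi>_def)
      have c\<xi>: "cmod (of_real c * \<xi>) \<le> \<rho>"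
        using \<xi> c mult_mono[of c 1 "cmod \<xi>" \<rho>] by (simp add: norm_mult)
      define f where "f = (\<lambda>x. g x - \<xi> ^ N * g ((\<sigma> ^^ N) x))"
      have f: "f \<in> A" unfolding f_def by (intro diff cmult compn g)
      obtain h h' where h: "h \<in> A" "h' \<in> A" "(\<lambda>x. h x - \<xi> ^ N * h ((\<sigma> ^^ N) x)) = f"
        "(\<lambda>x. h' x - (of_real c * \<xi>) ^ N * h' ((\<sigma> ^^ N) x)) = f"
        "nrm (\<lambda>x. h x - h' x) \<le> M' * (1 - c) * nrm f"
        using lip[OF \<xi> c(1,2) f, of m0] unfolding N_def[symmetric] by blast
      have "h = g"
      proof -
        have "(\<lambda>x. (h x - g x) - \<xi> ^ N * (h ((\<sigma> ^^ N) x) - g ((\<sigma> ^^ N) x))) = (\<lambda>x. 0)"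
          using fun_cong[OF h(3)] by (intro ext) (simp add: f_def algebra_simps)
        then have "nrm (\<lambda>x. h x - g x) \<le> 0"
          using below_pow[OF \<xi> diff[OF h(1) g], of m0] unfolding N_def[symmetric] by simp
        then have "(\<lambda>x. h x - g x) = (\<lambda>x. 0)"
          using nrm_eq_0[OF diff] nrm_nonneg[OF diff] h g by (meson order_antisym)
        then show ?thesis by (auto simp: fun_eq_iff)
      qed
      have h'M: "nrm h' \<le> M * nrm f"
        using below_pow[OF c\<xi> h(2), of m0] unfolding N_def[symmetric] h(4) .
      have "(\<lambda>x. h' x - f x) = (\<lambda>x. (of_real c * \<xi>) ^ N * h' ((\<sigma> ^^ N) x))"
        unfolding h(4)[symmetric] by simp
      then have "nrm (\<lambda>x. h' x - f x) = (c * s) ^ N * nrm (\<lambda>x. h' ((\<sigma> ^^ N) x))"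
        unfolding \<xi>_def using nrm_cmult[OF compn[OF h(2)], of "(of_real c * complex_of_real s) ^ N"] s c
        by (simp add: norm_mult norm_power)
      also have "\<dots> = (c * s / s') ^ N * (s' ^ N * nrm (\<lambda>x. h' ((\<sigma> ^^ N) x)))"
        using s' by (simp add: power_divide)
      also have "\<dots> \<le> (c * s / s') ^ N * (K * (M * nrm f))"
      proof (rule mult_left_mono)
        show "s' ^ N * nrm (\<lambda>x. h' ((\<sigma> ^^ N) x)) \<le> K * (M * nrm f)"
          using order_trans[OF K(2)[OF h(2), of N] mult_left_mono[OF h'M]] K(1) by simp
      qed (use cs in auto)
      also have "\<dots> = (K * M * (c * s / s') ^ N) * nrm f" by simp
      also have "\<dots> \<le> 1/4 * nrm f" by (intro mult_right_mono) (use Nsm f in auto)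
      finally have "nrm (\<lambda>x. h' x - f x) \<le> 1/4 * nrm f" .
      moreover have "nrm (\<lambda>x. h x - h' x) \<le> 1/4 * nrm f"
        using h(5) mult_right_mono[OF c(4) nrm_nonneg[OF f]] by linarith
      ultimately have gf: "nrm (\<lambda>x. g x - f x) \<le> 1/2 * nrm f"
        using nrm_triangle[OF h(1,2) f] \<open>h = g\<close> by simp
      have "nrm f \<le> nrm (\<lambda>x. f x - g x) + nrm g"
        using nrm_add[OF diff[OF f g] g] by simp
      then have "nrm f \<le> 2 * nrm g" using gf nrm_diff_commute[OF f g] by simp
      moreover have "nrm (\<lambda>x. g x - f x) = s ^ N * nrm (\<lambda>x. g ((\<sigma> ^^ N) x))"
        using nrm_cmult[OF compn[OF g], of "\<xi> ^ N"] s by (simp add: f_def \<xi>_def norm_power)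
      ultimately show ?thesis using gf by simp
    qed
    have contr_pow: "s ^ (N * j) * nrm (\<lambda>x. g ((\<sigma> ^^ (N * j)) x)) \<le> nrm g" if "g \<in> A" for g j
      using that
    proof (induction j arbitrary: g)
      case (Suc j)
      have "s ^ (N * Suc j) * nrm (\<lambda>x. g ((\<sigma> ^^ (N * Suc j)) x)) =
          s ^ N * (s ^ (N * j) * nrm (\<lambda>x. (\<lambda>x. g ((\<sigma> ^^ N) x)) ((\<sigma> ^^ (N * j)) x)))"
        by (simp add: power_add funpow_add)
      also have "\<dots> \<le> s ^ N * nrm (\<lambda>x. g ((\<sigma> ^^ N) x))"
        by (intro mult_left_mono Suc.IH compn Suc.prems) (use s in auto)
      finally show ?case using contr[OF Suc.prems] by linarith
    qed simp
    show "good s"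
      unfolding good_def
    proof (intro exI[of _ "Ku ^ N"] conjI allI ballI)
      show "1 \<le> Ku ^ N" using Ku(1) by simp
      fix n f assume f: "f \<in> A"
      define j r where "j = n div N" and "r = n mod N"
      have n: "n = N * j + r" and r: "r \<le> N" by (auto simp: j_def r_def N_def less_imp_le)
      have "s ^ n * nrm (\<lambda>x. f ((\<sigma> ^^ n) x)) =
          s ^ r * (s ^ (N * j) * nrm (\<lambda>x. (\<lambda>x. f ((\<sigma> ^^ r) x)) ((\<sigma> ^^ (N * j)) x)))"
        unfolding n by (subst (2) add.commute) (simp add: power_add funpow_add)
      also have "\<dots> \<le> s ^ r * nrm (\<lambda>x. f ((\<sigma> ^^ r) x))"
        by (intro mult_left_mono contr_pow compn f) (use s in auto)
      also have "\<dots> \<le> 1 * (Ku ^ r * nrm f)"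
        by (intro mult_mono nrmn f power_le_one nrm_nonneg compn) (use s \<rho> in auto)
      also have "\<dots> \<le> Ku ^ N * nrm f"
        using f Ku r by (auto intro!: mult_right_mono power_increasing)
      finally show "s ^ n * nrm (\<lambda>x. f ((\<sigma> ^^ n) x)) \<le> Ku ^ N * nrm f" .
    qed
  qed
  \<comment> \<open>c makes the Lipschitz loss exactly 1/4, and \<kappa> > 1 is a fixed ratio with
    c\<kappa> < 1. Each use of \<open>good_step\<close> multiplies the radius by \<kappa> until
    \<rho> is reached, starting from s0, where sV is a contraction by the choice of Ku.\<close>
  define c where "c = 1 - 1 / (4 * M')"
  define \<kappa> where "\<kappa> = 1 + 1 / (8 * M')"
  define s0 where "s0 = min \<rho> (1 / Ku)"
  have c: "0 \<le> c" "c \<le> 1" "M' * (1 - c) \<le> 1/4"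
    using M' by (auto simp: c_def field_simps)
  have \<kappa>: "\<kappa> > 1" using M' by (simp add: \<kappa>_def)
  have c\<kappa>: "c * \<kappa> < 1"
    using M' by (simp add: c_def \<kappa>_def field_simps)
  have s0: "s0 > 0" using \<rho> Ku by (simp add: s0_def)
  have "good s0"
    unfolding good_def
  proof (intro exI[of _ 1] conjI allI ballI)
    fix n f assume f: "f \<in> A"
    have "s0 ^ n * nrm (\<lambda>x. f ((\<sigma> ^^ n) x)) \<le> (1 / Ku) ^ n * (Ku ^ n * nrm f)"
      by (intro mult_mono power_mono nrmn f nrm_nonneg compn) (use s0 Ku in \<open>auto simp: s0_def\<close>)
    also have "\<dots> = nrm f" using Ku(1) by (simp add: power_divide)
    finally show "s0 ^ n * nrm (\<lambda>x. f ((\<sigma> ^^ n) x)) \<le> 1 * nrm f" by simp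
  qed simp
  have iter: "good (min \<rho> (s0 * \<kappa> ^ k))" for k
  proof (induction k)
    case 0
    then show ?case using \<open>good s0\<close> by (simp add: s0_def)
  next
    case (Suc k)
    let ?s' = "min \<rho> (s0 * \<kappa> ^ k)" and ?s = "min \<rho> (s0 * \<kappa> ^ Suc k)"
    have p: "0 < ?s'" "0 < ?s" using \<rho> s0 \<kappa> by auto
    have "?s \<le> \<kappa> * ?s'"
    proof (cases "\<rho> \<le> s0 * \<kappa> ^ k")
      case True
      then have "\<kappa> * ?s' = \<kappa> * \<rho>" by simp
      moreover have "\<rho> \<le> \<kappa> * \<rho>" using \<kappa> \<rho> by simp
      ultimately show ?thesis by linarith
    next
      case False
      then have "\<kappa> * ?s' = s0 * \<kappa> ^ Suc k" by simp
      then show ?thesis by linarith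
    qed
    then have "c * ?s \<le> (c * \<kappa>) * ?s'" using c mult_left_mono[of ?s "\<kappa> * ?s'" c] by (simp add: mult_ac)
    also have "\<dots> < 1 * ?s'" by (rule mult_strict_right_mono[OF c\<kappa> p(1)])
    finally show ?case by (intro good_step[OF Suc p(1) p(2) _ c(1,2) _ c(3)]) auto
  qed
  obtain k where "\<rho> / s0 < \<kappa> ^ k" using real_arch_pow[OF \<kappa>] by blast
  then have "min \<rho> (s0 * \<kappa> ^ k) = \<rho>" using s0 by (simp add: field_simps)
  then have "good \<rho>" using iter[of k] by simp
  then obtain K where K: "K \<ge> 1" "\<And>n f. f \<in> A \<Longrightarrow> \<rho> ^ n * nrm (\<lambda>x. f ((\<sigma> ^^ n) x)) \<le> K * nrm f"
    by (auto simp: good_def)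
  show thesis
  proof (rule that[OF K(1)])
    fix n f assume "f \<in> A"
    then show "nrm (\<lambda>x. f ((\<sigma> ^^ n) x)) \<le> K * \<theta> ^ n * nrm f"
      using K(2)[of f n] \<theta> by (simp add: \<rho>_def power_divide field_simps)
  qed
qed

end

section \<open>Weighted composition operators under the Leibniz inequality\<close>

text \<open>Upper bounds \<beta> stand in for the sup norms of the partial products, so that each
  use needs only pointwise estimates. The uniform closure satisfies the inequality with C =
  1.\<close>

locale leibniz_algebra = function_algebra A nrm
  for A :: "('m::t2_space \<Rightarrow> complex) set" and nrm +
  fixes C :: real
  assumes C: "C \<ge> 1"
    and leibniz: "(p::nat) \<ge> 1 \<Longrightarrow> (\<And>j. j < p \<Longrightarrow> fs j \<in> A) \<Longrightarrow>
      (\<And>j x. j < p \<Longrightarrow> cmod (\<Prod>k\<in>{..<p} - {j}. fs k x) \<le> \<beta> j) \<Longrightarrow>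
      nrm (\<lambda>x. \<Prod>j<p. fs j x) \<le> C * (\<Sum>j<p. nrm (fs j) * \<beta> j)"
begin

text \<open>All p terms of the Leibniz sum agree. For s = 1 the norm of a power therefore grows only
  linearly in p, which makes sharpening a peak by powers cheap.\<close>

lemma nrm_power:
  assumes f: "f \<in> A" and s: "\<And>x. cmod (f x) \<le> s" and p: "p \<ge> 1"
  shows "nrm (\<lambda>x. f x ^ p) \<le> C * real p * nrm f * s ^ (p - 1)"
proof -
  have "nrm (\<lambda>x. \<Prod>j<p. f x) \<le> C * (\<Sum>j<p. nrm f * s ^ (p - 1))"
    by (rule leibniz[OF p]) (auto simp: f norm_power intro!: power_mono s)
  then show ?thesis by (simp add: mult_ac)
qed

end

text \<open>Axioms shared by the algebra, its uniform closure and the inverse operator. Peaking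
  functions are bounded by 2 because they arise by approximating and renormalising true peak
  functions of the closure; \<open>growth\<close> expresses that U and its inverse have spectral
  radius at most 1.\<close>

locale weighted_composition = leibniz_algebra A nrm C
  for A :: "('m::t2_space \<Rightarrow> complex) set" and nrm C +
  fixes phi psi :: "'m \<Rightarrow> 'm" and w :: "'m \<Rightarrow> complex"
  assumes peak: "open V \<Longrightarrow> t \<in> V \<Longrightarrow> \<eta> > 0 \<Longrightarrow>
      \<exists>g\<in>A. g t = 1 \<and> (\<forall>x. cmod (g x) \<le> 2) \<and> (\<forall>x. x \<notin> V \<longrightarrow> cmod (g x) \<le> \<eta>)"
    and phi_psi [simp]: "phi (psi x) = x" "psi (phi x) = x"
    and continuous_phi: "continuous_on UNIV phi"
    and continuous_psi: "continuous_on UNIV psi"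
    and comp_phi: "f \<in> A \<Longrightarrow> (\<lambda>x. f (phi x)) \<in> A"
    and comp_psi: "f \<in> A \<Longrightarrow> (\<lambda>x. f (psi x)) \<in> A"
    and growth: "\<theta> > 1 \<Longrightarrow> \<exists>K\<ge>1. \<forall>n. \<forall>f\<in>A. nrm (\<lambda>x. f ((phi ^^ n) x)) \<le> K * \<theta> ^ n * nrm f \<and>
      nrm (\<lambda>x. f ((psi ^^ n) x)) \<le> K * \<theta> ^ n * nrm f"
    and aperiodic_dense: "open W \<Longrightarrow> W \<noteq> {} \<Longrightarrow> \<exists>y\<in>W. \<forall>n\<ge>1. (phi ^^ n) y \<noteq> y"
    and w_closed: "w \<in> A" and w_nz [simp]: "w x \<noteq> 0" and w_inverse: "(\<lambda>x. 1 / w x) \<in> A"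
begin

section \<open>The cocycle of w and the powers of the operator\<close>

definition P :: "nat \<Rightarrow> 'm \<Rightarrow> complex" where "P n x = (\<Prod>i<n. w ((phi ^^ i) x))"

definition T :: "nat \<Rightarrow> ('m \<Rightarrow> complex) \<Rightarrow> 'm \<Rightarrow> complex" where
  "T n f x = P n x * f ((phi ^^ n) x)"

text \<open>The weight collected over the k steps that lead to y. It is the height of
  \<open>T k h\<close> at \<open>(psi ^^ k) y\<close> when h has modulus 1 at y.\<close>

definition bwd :: "nat \<Rightarrow> 'm \<Rightarrow> real" where "bwd k y = cmod (P k ((psi ^^ k) y))"

lemma phi_pow_psi_pow [simp]: "(phi ^^ n) ((psi ^^ n) x) = x"
  by (induction n arbitrary: x) (simp_all add: funpow_swap1)

lemma psi_pow_phi_pow [simp]: "(psi ^^ n) ((phi ^^ n) x) = x"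
  by (induction n arbitrary: x) (simp_all add: funpow_swap1)

lemma P_0 [simp]: "P 0 x = 1" by (simp add: P_def)

lemma P_nz [simp]: "P n x \<noteq> 0" by (simp add: P_def)

lemma P_Suc: "P (Suc n) x = P n x * w ((phi ^^ n) x)" by (simp add: P_def)

lemma P_add: "P (m + n) x = P m x * P n ((phi ^^ m) x)"
proof (induction n)
  case (Suc n)
  have "(phi ^^ n) ((phi ^^ m) x) = (phi ^^ (m + n)) x"
    by (subst add.commute) (simp add: funpow_add)
  then show ?case using Suc by (simp add: P_Suc)
qed simp

lemma P_Suc': "P (Suc n) x = w x * P n (phi x)"
  using P_add[of 1 n x] by (simp add: P_def)

lemma comp_phi_pow: "f \<in> A \<Longrightarrow> (\<lambda>x. f ((phi ^^ n) x)) \<in> A"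
  by (rule composition_power_closed) (rule comp_phi)

lemma comp_psi_pow: "f \<in> A \<Longrightarrow> (\<lambda>x. f ((psi ^^ n) x)) \<in> A"
  by (rule composition_power_closed) (rule comp_psi)

lemma P_closed: "P n \<in> A"
proof -
  have "P n = (\<lambda>x. \<Prod>i<n. w ((phi ^^ i) x))" by (auto simp: P_def)
  then show ?thesis using prod_closed[of "{..<n}" "\<lambda>i x. w ((phi ^^ i) x)"] comp_phi_pow[OF w_closed] by simp
qed

lemma T_closed: "f \<in> A \<Longrightarrow> T n f \<in> A"
  unfolding T_def[abs_def] by (intro mult P_closed comp_phi_pow)

lemma T_0 [simp]: "T 0 f = f" by (auto simp: T_def)

lemma T_1: "T (Suc 0) f = (\<lambda>x. w x * f (phi x))" by (auto simp: T_def P_def)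

lemma T_T: "T m (T n f) = T (m + n) f"
proof
  fix x
  have "(phi ^^ n) ((phi ^^ m) x) = (phi ^^ (m + n)) x"
    by (subst add.commute) (simp add: funpow_add)
  then show "T m (T n f) x = T (m + n) f x" by (simp add: T_def P_add)
qed

lemma T_linear: "T n (\<lambda>x. c * f x + d * g x) = (\<lambda>x. c * T n f x + d * T n g x)"
  by (auto simp: T_def algebra_simps)

lemma continuous_phi_pow: "continuous_on UNIV (phi ^^ n)"
proof (induction n)
  case (Suc n)
  then show ?case
    using continuous_on_compose[of UNIV "phi ^^ n" phi] continuous_on_subset[OF continuous_phi] by auto
qed (simp add: continuous_on_id[unfolded id_def[symmetric]])

lemma continuous_psi_pow: "continuous_on UNIV (psi ^^ n)"
proof (induction n)
  case (Suc n)
  then show ?case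
    using continuous_on_compose[of UNIV "psi ^^ n" psi] continuous_on_subset[OF continuous_psi] by auto
qed (simp add: continuous_on_id[unfolded id_def[symmetric]])

lemma continuous_bwd: "continuous_on UNIV (bwd k)"
  unfolding bwd_def[abs_def]
  by (intro continuous_on_norm continuous_on_compose2[OF continuous[OF P_closed] continuous_psi_pow]) auto

lemma bwd_0 [simp]: "bwd 0 y = 1" by (simp add: bwd_def)

lemma bwd_pos [simp]: "bwd k y > 0" by (simp add: bwd_def)

lemma bwd_add: "bwd (j + k) y = bwd j y * bwd k ((psi ^^ j) y)"
proof -
  have "(psi ^^ (j + k)) y = (psi ^^ k) ((psi ^^ j) y)"
    by (subst add.commute) (simp add: funpow_add)
  moreover have "(phi ^^ k) ((psi ^^ k) ((psi ^^ j) y)) = (psi ^^ j) y" by simp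
  ultimately show ?thesis
    using P_add[of k j "(psi ^^ (j + k)) y"] by (simp add: bwd_def add.commute norm_mult)
qed

definition omega :: real where "omega = 1 + nrm w + nrm (\<lambda>x. 1 / w x)"

lemma omega: "omega \<ge> 1" "cmod (w x) \<le> omega" "1 / cmod (w x) \<le> omega"
  using nrm_nonneg[OF w_closed] nrm_nonneg[OF w_inverse] cmod_le_nrm[OF w_closed, of x] cmod_le_nrm[OF w_inverse, of x]
  by (auto simp: omega_def norm_divide)

lemma P_le: "cmod (P n x) \<le> omega ^ n"
proof -
  have "cmod (P n x) \<le> (\<Prod>i<n. omega)"
    unfolding P_def prod_norm[symmetric] by (intro prod_mono) (use omega in auto)
  then show ?thesis by simp
qed

lemma P_ge: "1 / cmod (P n x) \<le> omega ^ n"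
proof -
  have "1 / cmod (P n x) = (\<Prod>i<n. 1 / cmod (w ((phi ^^ i) x)))"
    by (simp add: P_def prod_norm[symmetric] prod_dividef)
  also have "\<dots> \<le> (\<Prod>i<n. omega)"
    by (intro prod_mono) (use omega in auto)
  finally show ?thesis by simp
qed

section \<open>Polynomials in the operator: \<open>opp p g\<close> is p(T)g\<close>

definition opp :: "complex poly \<Rightarrow> ('m \<Rightarrow> complex) \<Rightarrow> 'm \<Rightarrow> complex" where
  "opp p g x = (\<Sum>k\<le>degree p. coeff p k * T k g x)"

lemma opp_extend: "degree p \<le> N \<Longrightarrow> opp p g x = (\<Sum>k\<le>N. coeff p k * T k g x)"
  unfolding opp_def by (rule sum.mono_neutral_left) (auto simp: coeff_eq_0)

lemma opp_closed: "g \<in> A \<Longrightarrow> opp p g \<in> A"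
  unfolding opp_def[abs_def] by (intro sum_closed cmult T_closed)

lemma opp_0 [simp]: "opp 0 g = (\<lambda>x. 0)"
  by (auto simp: opp_def)

lemma opp_pCons: "opp (pCons a p) g = (\<lambda>x. a * g x + opp p (T 1 g) x)"
proof
  fix x
  have "opp (pCons a p) g x = (\<Sum>k\<le>Suc (degree p). coeff (pCons a p) k * T k g x)"
    by (rule opp_extend) (rule degree_pCons_le)
  also have "\<dots> = a * g x + (\<Sum>k\<le>degree p. coeff p k * T (Suc k) g x)"
    by (simp add: sum.atMost_Suc_shift del: sum.atMost_Suc)
  finally show "opp (pCons a p) g x = a * g x + opp p (T 1 g) x"
    by (simp add: opp_def T_T)
qed

lemma opp_smult: "opp (smult c p) g = (\<lambda>x. c * opp p g x)"
proof
  fix x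
  have "opp (smult c p) g x = (\<Sum>k\<le>degree p. coeff (smult c p) k * T k g x)"
    by (rule opp_extend) (rule degree_smult_le)
  then show "opp (smult c p) g x = c * opp p g x" by (simp add: opp_def sum_distrib_left mult_ac)
qed

lemma opp_add: "opp (p + r) g = (\<lambda>x. opp p g x + opp r g x)"
proof
  fix x
  let ?N = "max (degree p) (degree r)"
  have "opp (p + r) g x = (\<Sum>k\<le>?N. coeff (p + r) k * T k g x)"
    by (rule opp_extend) (rule degree_add_le_max)
  also have "\<dots> = (\<Sum>k\<le>?N. coeff p k * T k g x) + (\<Sum>k\<le>?N. coeff r k * T k g x)"
    by (simp add: algebra_simps sum.distrib)
  finally show "opp (p + r) g x = opp p g x + opp r g x"
    by (simp add: opp_extend[of p ?N] opp_extend[of r ?N])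
qed

lemma opp_linear: "opp p (\<lambda>x. c * f x + d * g x) = (\<lambda>x. c * opp p f x + d * opp p g x)"
  by (auto simp: opp_def T_linear sum_distrib_left sum.distrib algebra_simps)

lemma opp_T: "opp p (T n g) = T n (opp p g)"
  by (auto simp: opp_def T_T T_def[of n "opp p g"] sum_distrib_left fun_eq_iff add.commute
      T_def[of n "T _ g"] simp flip: T_T intro!: sum.cong) (simp add: T_T add.commute T_def[of n "T _ g", symmetric])

lemma opp_mult: "opp (p * r) g = opp p (opp r g)"
proof (induction p arbitrary: g)
  case (pCons a p)
  have "opp (pCons a p * r) g = (\<lambda>x. a * opp r g x + opp (pCons 0 (p * r)) g x)"
    by (simp add: mult_pCons_left opp_add opp_smult)
  then show ?case by (simp add: opp_pCons pCons.IH opp_T)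
qed (auto simp: fun_eq_iff)

lemma opp_monom: "opp (monom c n) g = (\<lambda>x. c * T n g x)"
proof
  fix x
  have "opp (monom c n) g x = (\<Sum>k\<le>n. coeff (monom c n) k * T k g x)"
    by (rule opp_extend) (rule degree_monom_le)
  also have "\<dots> = (\<Sum>k\<le>n. if n = k then c * T k g x else 0)"
    by (intro sum.cong) auto
  finally show "opp (monom c n) g x = c * T n g x" by simp
qed

lemma opp_1 [simp]: "opp 1 g = g"
  using opp_monom[of 1 0 g] by (simp add: monom_0 one_pCons)

text \<open>\<open>[:-1, z:]\<close> stands for zT - 1 = z((T - 1) - (1/z - 1)); for z this close to
  1 the second term costs at most half of \<open>nrm g\<close>.\<close>

lemma below_perturb:
  assumes M: "M \<ge> 0" "\<And>g. g \<in> A \<Longrightarrow> nrm g \<le> M * nrm (\<lambda>x. w x * g (phi x) - g x)"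
    and z: "cmod z = 1" "M * cmod (z - 1) \<le> 1/2" and g: "g \<in> A"
  shows "nrm g \<le> 2 * M * nrm (opp [:-1, z:] g)"
proof -
  have o: "opp [:-1, z:] g = (\<lambda>x. z * (w x * g (phi x)) - g x)"
    by (simp add: opp_pCons T_1 opp_linear[of 0 0 _ 0] opp_def[of 0])
  have oA: "opp [:-1, z:] g \<in> A" by (rule opp_closed[OF g])
  have z0: "z \<noteq> 0" using z by auto
  have e: "(\<lambda>x. w x * g (phi x) - g x) = (\<lambda>x. (1/z) * opp [:-1, z:] g x + (1/z - 1) * g x)"
    using z0 by (auto simp: o field_simps)
  have "cmod (1/z - 1) = cmod (z - 1)"
    using z z0 norm_divide[of "1 - z" z] by (simp add: diff_divide_distrib norm_minus_commute)
  then have "nrm (\<lambda>x. w x * g (phi x) - g x) \<le> nrm (opp [:-1, z:] g) + cmod (z - 1) * nrm g"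
    unfolding e using nrm_add[OF cmult[OF oA, of "1/z"] cmult[OF g, of "1/z - 1"]] z
    unfolding nrm_cmult[OF oA] nrm_cmult[OF g] by (simp add: norm_divide)
  then have "nrm g \<le> M * (nrm (opp [:-1, z:] g) + cmod (z - 1) * nrm g)"
    using M(2)[OF g] M(1) mult_left_mono order_trans by blast
  also have "\<dots> = M * nrm (opp [:-1, z:] g) + (M * cmod (z - 1)) * nrm g" by (simp add: algebra_simps)
  also have "\<dots> \<le> M * nrm (opp [:-1, z:] g) + 1/2 * nrm g"
    by (intro add_left_mono mult_right_mono z) (simp add: g)
  finally show ?thesis by simp
qed

lemma below_perturb_power:
  assumes M: "M \<ge> 0" "\<And>g. g \<in> A \<Longrightarrow> nrm g \<le> M * nrm (\<lambda>x. w x * g (phi x) - g x)"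
    and z: "cmod z = 1" "M * cmod (z - 1) \<le> 1/2" and g: "g \<in> A"
  shows "nrm g \<le> (2 * M) ^ q * nrm (opp ([:-1, z:] ^ q) g)"
  using g
proof (induction q arbitrary: g)
  case (Suc q)
  have "nrm g \<le> 2 * M * nrm (opp [:-1, z:] g)" by (rule below_perturb[OF M z Suc.prems])
  also have "\<dots> \<le> 2 * M * ((2 * M) ^ q * nrm (opp ([:-1, z:] ^ q) (opp [:-1, z:] g)))"
    by (intro mult_left_mono Suc.IH opp_closed Suc.prems) (use M in auto)
  also have "opp ([:-1, z:] ^ q) (opp [:-1, z:] g) = opp ([:-1, z:] ^ Suc q) g"
    unfolding power_Suc2 by (rule opp_mult[symmetric])
  finally show ?case by (simp only: power_Suc mult.assoc)
qed simp

definition geom :: "nat \<Rightarrow> complex poly" where "geom n = (\<Sum>j<n. monom 1 j)"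

lemma geom_mult: "[:-1, 1:] * geom n = monom 1 n - 1"
proof (induction n)
  case (Suc n)
  have "[:-1, 1:] * monom 1 n = monom 1 (Suc n) - (monom 1 n :: complex poly)"
    by (simp add: monom_Suc)
  then show ?case using Suc by (simp add: geom_def algebra_simps)
qed (simp add: geom_def one_pCons monom_0)

text \<open>\<open>pcompose\<close> with \<open>[:0, z:]\<close> replaces T by zT. The product of
  (zT - 1)^q with the q-th power of the geometric sum in zT is ((zT)^n - 1)^q, which involves only
  the iterates T^(nl), l \<le> q, and has coefficient mass 2^q. Undoing (zT - 1)^q by the lower
  bound costs (2M)^q. So an operator of coefficient mass n^q is controlled by q + 1 widely spaced
  iterates.\<close>

lemma geom_operator_nrm:
  assumes M: "M \<ge> 0" "\<And>g. g \<in> A \<Longrightarrow> nrm g \<le> M * nrm (\<lambda>x. w x * g (phi x) - g x)"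
    and z: "cmod z = 1" "M * cmod (z - 1) \<le> 1/2" and g: "g \<in> A"
    and R: "\<And>l. l \<le> q \<Longrightarrow> nrm (T (n * l) g) \<le> R"
  shows "nrm (opp (pcompose (geom n ^ q) [:0, z:]) g) \<le> (4 * M) ^ q * R"
proof -
  define e where "e = monom (z ^ n) n - (1 :: complex poly)"
  have e': "pcompose (monom 1 n - 1) [:0, z:] = e"
    by (rule poly_eqI) (simp add: coeff_pcompose_linear e_def coeff_monom)
  have pw: "pcompose (p ^ k) r = pcompose p r ^ k" for p r :: "complex poly" and k
    by (induction k) (simp_all add: pcompose_mult pcompose_1)
  have "[:-1, z:] = pcompose [:-1, 1:] [:0, z:]"
    by (rule poly_eqI) (simp add: coeff_pcompose_linear coeff_pCons split: nat.splits)
  then have prod: "[:-1, z:] ^ q * pcompose (geom n ^ q) [:0, z:] = e ^ q"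
    using geom_mult[of n] by (simp add: pw power_mult_distrib[symmetric] pcompose_mult[symmetric] e')
  have oe: "opp e g = (\<lambda>x. z ^ n * T n g x + (-1) * g x)" for g
  proof -
    have "e = monom (z ^ n) n + smult (-1) 1" by (simp add: e_def one_pCons)
    then show ?thesis by (simp only: opp_add opp_smult opp_monom opp_1)
  qed
  have "nrm (opp (e ^ q) g) \<le> 2 ^ q * R"
    using g R
  proof (induction q arbitrary: g)
    case 0
    then show ?case using "0.prems"(2)[of 0] by simp
  next
    case (Suc q)
    have Tg: "T n g \<in> A" by (rule T_closed[OF Suc.prems(1)])
    have R1: "nrm (T (n * l) (T n g)) \<le> R" if "l \<le> q" for l
      using Suc.prems(2)[of "Suc l"] that by (simp add: T_T add.commute)
    have 1: "nrm (opp (e ^ q) (T n g)) \<le> 2 ^ q * R" by (rule Suc.IH[OF Tg R1])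
    have 2: "nrm (opp (e ^ q) g) \<le> 2 ^ q * R" by (rule Suc.IH) (use Suc.prems in auto)
    have "opp (e ^ Suc q) g = opp (e ^ q) (opp e g)"
      by (subst power_Suc2) (rule opp_mult)
    also have "\<dots> = (\<lambda>x. z ^ n * opp (e ^ q) (T n g) x + (-1) * opp (e ^ q) g x)"
      unfolding oe by (rule opp_linear)
    finally have "nrm (opp (e ^ Suc q) g) \<le> cmod (z ^ n) * nrm (opp (e ^ q) (T n g)) + cmod (-1) * nrm (opp (e ^ q) g)"
      using nrm_add[OF cmult[OF opp_closed[OF Tg]] cmult[OF opp_closed[OF Suc.prems(1)]], of "z ^ n" "e ^ q" "-1" "e ^ q"]
      unfolding nrm_cmult[OF opp_closed[OF Tg]] nrm_cmult[OF opp_closed[OF Suc.prems(1)]] by simp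
    then show ?case using 1 2 z by (simp add: norm_power)
  qed
  then have "nrm (opp ([:-1, z:] ^ q) (opp (pcompose (geom n ^ q) [:0, z:]) g)) \<le> 2 ^ q * R"
    by (simp add: opp_mult[symmetric] prod)
  then have "(2 * M) ^ q * nrm (opp ([:-1, z:] ^ q) (opp (pcompose (geom n ^ q) [:0, z:]) g)) \<le> (2 * M) ^ q * (2 ^ q * R)"
    using M by (intro mult_left_mono) auto
  moreover have "(2 * M) ^ q * (2 ^ q * R) = (4 * M) ^ q * R"
  proof -
    have "4 * M = 2 * M * 2" by simp
    then show ?thesis by (simp only: power_mult_distrib mult_ac)
  qed
  moreover have "nrm (opp (pcompose (geom n ^ q) [:0, z:]) g) \<le>
      (2 * M) ^ q * nrm (opp ([:-1, z:] ^ q) (opp (pcompose (geom n ^ q) [:0, z:]) g))"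
    by (rule below_perturb_power[OF M z opp_closed[OF g]])
  ultimately show ?thesis by linarith
qed

text \<open>
  The factors of \<^term>\<open>P k\<close> are cheap and the two copies of \<open>h\<close> are split, so that each
  product of sup norms in the Leibniz inequality still sees the localising function \<open>h\<close>.
\<close>

lemma nrm_T_square:
  assumes K: "\<theta> \<ge> 1" "\<And>n f. f \<in> A \<Longrightarrow> nrm (\<lambda>x. f ((phi ^^ n) x)) \<le> K * \<theta> ^ n * nrm f" "K \<ge> 1"
    and h: "h \<in> A" "\<And>x. cmod (h x) \<le> 1" "nrm h \<ge> 1"
    and loc: "\<And>x. cmod (T k h x) \<le> loc"
  shows "nrm (T k (\<lambda>x. h x ^ 2)) \<le> C * K * \<theta> ^ k * (real k * nrm w * omega + 2) * nrm h * loc"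
proof -
  \<comment> \<open>k single weights and two copies of h: omitting a weight leaves the whole product
    up to a factor omega, omitting a copy of h leaves exactly \<open>T k h\<close>.\<close>
  define fs where "fs j = (if j < k then (\<lambda>x. w ((phi ^^ j) x)) else (\<lambda>x. h ((phi ^^ k) x)))" for j
  define \<beta> where "\<beta> j = (if j < k then omega * loc else loc)" for j
  have loc0: "loc \<ge> 0" using loc[of undefined] norm_ge_zero order_trans by blast
  have full: "(\<Prod>j<k+2. fs j x) = T k (\<lambda>x. h x ^ 2) x" for x
  proof -
    have "(\<Prod>j<k+2. fs j x) = (\<Prod>j<k. fs j x) * h ((phi ^^ k) x) * h ((phi ^^ k) x)"
      by (simp add: fs_def)
    also have "(\<Prod>j<k. fs j x) = P k x" by (auto simp: P_def fs_def)
    finally show ?thesis by (simp add: T_def power2_eq_square)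
  qed
  have "nrm (\<lambda>x. \<Prod>j<k+2. fs j x) \<le> C * (\<Sum>j<k+2. nrm (fs j) * \<beta> j)"
  proof (rule leibniz)
    show "fs j \<in> A" for j unfolding fs_def by (auto intro: comp_phi_pow w_closed h)
    fix j x assume j: "j < k + 2"
    show "cmod (\<Prod>m\<in>{..<k+2} - {j}. fs m x) \<le> \<beta> j"
    proof (cases "j < k")
      case True
      have "(\<Prod>m<k+2. fs m x) = fs j x * (\<Prod>m\<in>{..<k+2} - {j}. fs m x)"
        by (rule prod.remove) (use j in auto)
      then have "cmod (\<Prod>m\<in>{..<k+2} - {j}. fs m x) = 1 / cmod (w ((phi ^^ j) x)) * cmod (T k (\<lambda>x. h x ^ 2) x)"
        using True arg_cong[OF full[of x], of cmod] by (simp add: fs_def[of j] norm_mult field_simps)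
      also have "\<dots> \<le> omega * (cmod (T k h x) * cmod (h ((phi ^^ k) x)))"
        by (intro mult_mono omega) (use omega(1) in \<open>auto simp: T_def norm_mult power2_eq_square\<close>)
      also have "\<dots> \<le> omega * (loc * 1)"
        by (intro mult_left_mono mult_mono loc h) (use omega(1) loc0 in auto)
      finally show ?thesis using True by (simp add: \<beta>_def)
    next
      case False
      then have "{..<k+2} - {j} = insert (if j = k then Suc k else k) {..<k}" using j by auto
      then have "(\<Prod>m\<in>{..<k+2} - {j}. fs m x) = h ((phi ^^ k) x) * (\<Prod>m<k. fs m x)"
        using False j by (auto simp: fs_def)
      also have "(\<Prod>m<k. fs m x) = P k x" by (auto simp: P_def fs_def)
      finally show ?thesis using False loc[of x] by (simp add: \<beta>_def T_def mult.commute)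
    qed
  qed simp
  also have "(\<lambda>x. \<Prod>j<k+2. fs j x) = T k (\<lambda>x. h x ^ 2)" using full by auto
  also have "(\<Sum>j<k+2. nrm (fs j) * \<beta> j) = (\<Sum>j<k. nrm (fs j) * \<beta> j) + 2 * (nrm (fs k) * loc)"
    by (simp add: \<beta>_def fs_def)
  also have "(\<Sum>j<k. nrm (fs j) * \<beta> j) \<le> (\<Sum>j<k. (K * \<theta> ^ k * nrm w) * (omega * loc))"
  proof (rule sum_mono)
    fix j assume j: "j \<in> {..<k}"
    have "nrm (fs j) \<le> K * \<theta> ^ j * nrm w" using j K(2)[OF w_closed] by (simp add: fs_def)
    also have "\<dots> \<le> K * \<theta> ^ k * nrm w"
      using j K by (intro mult_right_mono mult_left_mono power_increasing) (auto simp: w_closed)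
    finally have "nrm (fs j) * (omega * loc) \<le> (K * \<theta> ^ k * nrm w) * (omega * loc)"
      by (rule mult_right_mono) (use omega(1) loc0 in auto)
    then show "nrm (fs j) * \<beta> j \<le> (K * \<theta> ^ k * nrm w) * (omega * loc)"
      using j by (simp add: \<beta>_def)
  qed
  also have "nrm (fs k) * loc \<le> K * \<theta> ^ k * nrm h * loc"
    using K(2)[OF h(1)] loc0 by (auto simp: fs_def intro: mult_right_mono)
  finally have "nrm (T k (\<lambda>x. h x ^ 2)) \<le>
      C * ((\<Sum>j<k. (K * \<theta> ^ k * nrm w) * (omega * loc)) + 2 * (K * \<theta> ^ k * nrm h * loc))"
    using C by (auto intro: mult_left_mono)
  also have "\<dots> = C * K * \<theta> ^ k * loc * (real k * nrm w * omega * 1 + 2 * nrm h)"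
    by (simp add: algebra_simps)
  also have "\<dots> \<le> C * K * \<theta> ^ k * loc * (real k * nrm w * omega * nrm h + 2 * nrm h)"
    using C K loc0 h omega(1) by (intro mult_left_mono add_right_mono mult_nonneg_nonneg) (auto simp: w_closed)
  also have "\<dots> = C * K * \<theta> ^ k * (real k * nrm w * omega + 2) * nrm h * loc"
    by (simp add: algebra_simps)
  finally show ?thesis .
qed

end

section \<open>One-sided growth along orbits\<close>

lemma half_le_sin:
  fixes x :: real
  assumes "0 \<le> x" "x \<le> 1"
  shows "x / 2 \<le> sin x"
proof -
  have "\<bar>sin x - (\<Sum>m<3. sin_coeff m * x ^ m)\<bar> \<le> inverse (fact 3) * \<bar>x\<bar> ^ 3"
    by (rule Maclaurin_sin_bound)
  then have "\<bar>sin x - x\<bar> \<le> x ^ 3 / 6"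
    using assms by (simp add: sin_coeff_def eval_nat_numeral fact_numeral)
  moreover have "x ^ 3 \<le> x"
    using assms power_decreasing[of 1 3 x] by simp
  ultimately show ?thesis using assms by linarith
qed

text \<open>Take z = exp(i\<tau>) with \<tau> of order 1/(MN). The angles m\<tau> stay between
  \<tau> and 1/2, so z^m keeps away from 1, and |1 + u|^2 = 4 - |u - 1|^2 on the circle gives the
  gap. The gap is quadratic in 1/N, which keeps later losses polynomial.\<close>

lemma rotation_gap:
  fixes M :: real and N :: nat
  assumes M: "M \<ge> 1"
  obtains z :: complex where "cmod z = 1" "M * cmod (z - 1) \<le> 1/2"
    "\<And>m. 1 \<le> m \<Longrightarrow> m \<le> N \<Longrightarrow> cmod (1 + z ^ m) \<le> 2 * (1 - 1 / (128 * M\<^sup>2 * (real N + 1)\<^sup>2))"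
proof -
  define \<tau> where "\<tau> = 1 / (2 * M * (real N + 1))"
  have \<tau>: "\<tau> > 0" "\<tau> * (real N + 1) \<le> 1/2"
  proof -
    have "real N + 1 > 0" by simp
    then show "\<tau> > 0" using M unfolding \<tau>_def by (intro divide_pos_pos mult_pos_pos) auto
    have "\<tau> * (real N + 1) = 1 / (2 * M)" using \<open>real N + 1 > 0\<close> by (simp add: \<tau>_def)
    also have "\<dots> \<le> 1/2" using M by simp
    finally show "\<tau> * (real N + 1) \<le> 1/2" .
  qed
  have dist: "cmod (cis t - 1) = 2 * \<bar>sin (t / 2)\<bar>" for t
    using dist_exp_i_1[of t] by (simp add: cis_conv_exp mult.commute)
  have par: "(cmod (1 + u))\<^sup>2 = 4 - (cmod (u - 1))\<^sup>2" if "cmod u = 1" for u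
  proof -
    have "(Re u)\<^sup>2 + (Im u)\<^sup>2 = 1" using that by (simp add: cmod_def)
    then show ?thesis unfolding cmod_power2 by (simp add: power2_eq_square algebra_simps)
  qed
  show thesis
  proof
    show "cmod (cis \<tau>) = 1" by simp
    have "cmod (cis \<tau> - 1) \<le> \<tau>"
      unfolding dist using abs_sin_x_le_abs_x[of "\<tau> / 2"] \<tau> by simp
    also have "\<tau> \<le> 1 / (2 * M)" unfolding \<tau>_def
      by (rule divide_left_mono) (use M mult_left_mono[of 1 "real N + 1" "2 * M"] in auto)
    finally show "M * cmod (cis \<tau> - 1) \<le> 1/2" using M by (simp add: field_simps)
    fix m :: nat assume m: "1 \<le> m" "m \<le> N"
    have mt: "\<tau> \<le> real m * \<tau>" "real m * \<tau> \<le> 1/2"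
    proof -
      show "\<tau> \<le> real m * \<tau>" using m \<tau> by simp
      have "real m * \<tau> \<le> (real N + 1) * \<tau>" using m \<tau> by (intro mult_right_mono) auto
      also have "\<dots> = \<tau> * (real N + 1)" by (rule mult.commute)
      finally show "real m * \<tau> \<le> 1/2" using \<tau>(2) by linarith
    qed
    have "real m * \<tau> / 2 / 2 \<le> sin (real m * \<tau> / 2)"
      by (rule half_le_sin) (use mt \<tau> in auto)
    then have "\<tau> / 2 \<le> cmod (cis (real m * \<tau>) - 1)" using mt unfolding dist by simp
    then have "(\<tau> / 2)\<^sup>2 \<le> (cmod (cis (real m * \<tau>) - 1))\<^sup>2" using \<tau> by (intro power_mono) auto
    then have "(cmod (1 + cis \<tau> ^ m))\<^sup>2 \<le> 4 - (\<tau> / 2)\<^sup>2"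
      using par[of "cis (real m * \<tau>)"] by (simp add: Complex.DeMoivre)
    also have "\<dots> \<le> (2 * (1 - \<tau>\<^sup>2 / 32))\<^sup>2"
    proof -
      have "(2 * (1 - \<tau>\<^sup>2 / 32))\<^sup>2 = 4 - \<tau>\<^sup>2 / 4 + 4 * (\<tau>\<^sup>2 / 32)\<^sup>2"
        by (simp add: power2_eq_square field_simps)
      moreover have "(\<tau> / 2)\<^sup>2 = \<tau>\<^sup>2 / 4" by (simp add: power2_eq_square)
      ultimately show ?thesis using zero_le_power2[of "\<tau>\<^sup>2 / 32"] by linarith
    qed
    finally have "(cmod (1 + cis \<tau> ^ m))\<^sup>2 \<le> (2 * (1 - \<tau>\<^sup>2 / 32))\<^sup>2" .
    moreover have "0 \<le> 2 * (1 - \<tau>\<^sup>2 / 32)"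
    proof -
      have "\<tau> \<le> 1" using mt by linarith
      then have "\<tau>\<^sup>2 \<le> 1" using \<tau> by (simp add: power_le_one)
      then show ?thesis by simp
    qed
    ultimately have "cmod (1 + cis \<tau> ^ m) \<le> 2 * (1 - \<tau>\<^sup>2 / 32)"
      by (rule power2_le_imp_le)
    moreover have "\<tau>\<^sup>2 / 32 = 1 / (128 * M\<^sup>2 * (real N + 1)\<^sup>2)"
      by (simp add: \<tau>_def power_divide power_mult_distrib)
    ultimately show "cmod (1 + cis \<tau> ^ m) \<le> 2 * (1 - 1 / (128 * M\<^sup>2 * (real N + 1)\<^sup>2))"
      by simp
  qed
qed

context weighted_composition
begin

section \<open>Coefficients of the powers of a geometric sum\<close>

definition gc :: "nat \<Rightarrow> nat \<Rightarrow> nat \<Rightarrow> real" where "gc n q k = cmod (coeff (geom n ^ q) k)"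

lemma degree_geom: "degree (geom n ^ q) \<le> q * n"
proof -
  have "degree (geom n) \<le> n"
    unfolding geom_def by (rule degree_sum_le) (auto intro: order_trans[OF degree_monom_le])
  then have "degree (geom n) * q \<le> q * n" by (simp add: mult.commute)
  then show ?thesis using degree_power_le[of "geom n" q] by linarith
qed

text \<open>The coefficients are nonnegative reals, so their moduli add up to the value of the
  polynomial at 1.\<close>

lemma sum_gc: "(\<Sum>k\<le>q * n. gc n q k) = real n ^ q"
proof -
  have nn: "coeff (geom n ^ q) k \<in> \<real> \<and> 0 \<le> Re (coeff (geom n ^ q) k)" for k
  proof (induction q arbitrary: k)
    case 0
    then show ?case by auto
  next
    case (Suc q)
    have g: "coeff (geom n) j \<in> \<real> \<and> 0 \<le> Re (coeff (geom n) j)" for j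
      by (auto simp: geom_def coeff_sum intro!: sum_nonneg sum_in_Reals)
    have "0 \<le> Re (a * b)" if "a \<in> \<real> \<and> 0 \<le> Re a" "b \<in> \<real> \<and> 0 \<le> Re b" for a b :: complex
      using that by (auto elim!: Reals_cases)
    then show ?case
      using g Suc by (auto simp: coeff_mult intro!: sum_nonneg sum_in_Reals Reals_mult)
  qed
  have "gc n q k = Re (coeff (geom n ^ q) k)" for k
    using nn[of k] by (auto simp: gc_def elim!: Reals_cases)
  then have "(\<Sum>k\<le>q * n. gc n q k) = Re (\<Sum>k\<le>q * n. coeff (geom n ^ q) k * 1 ^ k)" by simp
  also have "(\<Sum>k\<le>q * n. coeff (geom n ^ q) k * 1 ^ k) = poly (geom n ^ q) 1"
    unfolding poly_altdef
    by (rule sum.mono_neutral_right) (use degree_geom in \<open>auto simp: coeff_eq_0\<close>)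
  also have "poly (geom n ^ q) 1 = of_nat n ^ q"
    by (simp add: poly_power geom_def poly_sum poly_monom)
  finally show ?thesis by (metis Re_complex_of_real of_real_of_nat_eq of_real_power)
qed

lemma gc_0: "n \<ge> 1 \<Longrightarrow> gc n q 0 = 1"
proof -
  assume n: "n \<ge> 1"
  have "coeff (geom n ^ q) 0 = poly (geom n) 0 ^ q" by (simp add: poly_0_coeff_0[symmetric] poly_power)
  also have "poly (geom n) 0 = 1"
    using n by (cases n) (simp_all add: geom_def poly_sum poly_monom sum.lessThan_Suc_shift del: sum.lessThan_Suc)
  finally show ?thesis by (simp add: gc_def)
qed

lemma gc_nonneg [simp]: "gc n q k \<ge> 0" by (simp add: gc_def)

lemma gc_1: "k < n \<Longrightarrow> gc n 1 k = 1"
  by (simp add: gc_def geom_def coeff_sum)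

section \<open>Peaking functions and the comparison of their norms\<close>

definition peaked :: "'m set \<Rightarrow> real \<Rightarrow> ('m \<Rightarrow> complex) \<Rightarrow> bool" where
  "peaked V \<eta> h \<longleftrightarrow> h \<in> A \<and> (\<forall>x. cmod (h x) \<le> 1) \<and> (\<exists>x. cmod (h x) = 1) \<and> (\<forall>x. x \<notin> V \<longrightarrow> cmod (h x) \<le> \<eta>)"

text \<open>F is the mean of G(T)h^2 and z^(-i) G(zT)h^2, where G is the q-th power of the geometric
  sum. No orbit meets V twice within N steps, so F consists of disjoint bumps, the k-th of height
  about \<open>gc n q k * av k\<close> times the modulus of (1 + z^(k-i))/2. The index i maximises
  the first factor and is the only one whose second factor is 1; the gap \<epsilon> makes its bump
  dominant. Normalising, raising to the power l and moving back by i steps gives h'. By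
  \<open>geom_operator_nrm\<close> its norm involves only the heights \<open>av (n * j)\<close>,
  whence the quotient of \<open>Am\<close> by the height of bump i.\<close>

lemma peaked_improve:
  assumes M: "M \<ge> 1" "\<And>g. g \<in> A \<Longrightarrow> nrm g \<le> M * nrm (\<lambda>x. w x * g (phi x) - g x)"
    and K: "\<theta> \<ge> 1" "K \<ge> 1" "\<And>n f. f \<in> A \<Longrightarrow> nrm (\<lambda>x. f ((phi ^^ n) x)) \<le> K * \<theta> ^ n * nrm f"
      "\<And>n f. f \<in> A \<Longrightarrow> nrm (\<lambda>x. f ((psi ^^ n) x)) \<le> K * \<theta> ^ n * nrm f"
    and N: "N = q * n"
    and sep: "\<And>v m. v \<in> V \<Longrightarrow> 1 \<le> m \<Longrightarrow> m \<le> N \<Longrightarrow> (phi ^^ m) v \<notin> V"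
    and z: "cmod z = 1" "M * cmod (z - 1) \<le> 1/2"
    and gap: "\<And>m. 1 \<le> m \<Longrightarrow> m \<le> N \<Longrightarrow> cmod (1 + z ^ m) \<le> 2 * (1 - \<epsilon>)" "0 < \<epsilon>" "\<epsilon> \<le> 1/2"
    and var: "\<And>v k. v \<in> V \<Longrightarrow> k \<le> N \<Longrightarrow> bwd k v \<le> (1 + \<epsilon>/8) * av k"
      "\<And>v k. v \<in> V \<Longrightarrow> k \<le> N \<Longrightarrow> (1 - \<epsilon>/8) * av k \<le> bwd k v"
    and av: "\<And>k. k \<le> N \<Longrightarrow> 1 / omega ^ N \<le> av k"
    and \<eta>: "0 < \<eta>" "\<eta> < 1" "\<eta> * omega ^ N * omega ^ N \<le> 1" "real n ^ q * omega ^ N * \<eta> \<le> \<epsilon>/8"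
    and l: "1 \<le> l" "(1 - \<epsilon>/2) ^ l \<le> \<eta>"
    and i: "i \<le> N" "\<And>k. k \<le> N \<Longrightarrow> gc n q k * av k \<le> gc n q i * av i" "1 \<le> gc n q i * av i"
    and Am: "\<And>j. j \<le> q \<Longrightarrow> av (n * j) \<le> Am"
    and h: "peaked V \<eta> h"
  shows "\<exists>h'. peaked V \<eta> h' \<and> nrm h' \<le> 4 * C\<^sup>2 * K\<^sup>2 * real l * (real N * nrm w * omega + 2) *
    \<theta> ^ (2 * N) * (4 * M) ^ q * (Am / (gc n q i * av i)) * nrm h"
proof -
  have hA: "h \<in> A" and h1: "\<And>x. cmod (h x) \<le> 1" and hoff: "\<And>x. x \<notin> V \<Longrightarrow> cmod (h x) \<le> \<eta>"
    using h by (auto simp: peaked_def)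
  obtain v0 where v0: "cmod (h v0) = 1" using h by (auto simp: peaked_def)
  have v0V: "v0 \<in> V" using hoff[of v0] v0 \<eta> by force
  have nh: "nrm h \<ge> 1" using cmod_le_nrm[OF hA, of v0] v0 by simp
  define \<beta> where "\<beta> = gc n q i * av i"
  have \<beta>1: "\<beta> \<ge> 1" using i by (simp add: \<beta>_def)
  have om: "omega ^ N \<ge> 1" using omega(1) by simp
  have avp: "av k > 0" if "k \<le> N" for k
    using av[OF that] om by (meson less_le_trans zero_less_divide_1_iff zero_less_one)
  have nl: "n * j \<le> N" if "j \<le> q" for j using that by (simp add: N mult.commute)
  have Ppw: "cmod (P k x) \<le> omega ^ N" if "k \<le> N" for k x
    using P_le[of k x] power_increasing[OF that omega(1)] by linarith
  have Pb: "cmod (P k x) = bwd k ((phi ^^ k) x)" for k x by (simp add: bwd_def)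
  define h2 where "h2 = (\<lambda>x. h x ^ 2)"
  have h2A: "h2 \<in> A" unfolding h2_def by (rule power_closed[OF hA])
  have loc: "cmod (T k h x) \<le> 2 * av k" if k: "k \<le> N" for k x
  proof (cases "(phi ^^ k) x \<in> V")
    case True
    have "cmod (T k h x) \<le> bwd k ((phi ^^ k) x) * 1"
      unfolding T_def norm_mult Pb by (intro mult_left_mono h1) (simp add: less_imp_le)
    also have "\<dots> \<le> (1 + \<epsilon>/8) * av k" using var(1)[OF True k] by simp
    also have "\<dots> \<le> 2 * av k" using gap(2,3) avp[OF k] by (intro mult_right_mono) auto
    finally show ?thesis .
  next
    case False
    have "cmod (T k h x) \<le> omega ^ N * \<eta>"
      unfolding T_def norm_mult by (intro mult_mono Ppw k hoff False) (use om in auto)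
    also have "\<dots> \<le> 1 / omega ^ N" using \<eta>(3) om by (simp add: field_simps)
    also have "\<dots> \<le> 2 * av k" using av[OF k] avp[OF k] by linarith
    finally show ?thesis .
  qed
  define R where "R = C * K * \<theta> ^ N * (real N * nrm w * omega + 2) * nrm h * (2 * Am)"
  have Am0: "Am > 0" using Am[of 0] avp[of 0] by simp
  have nw: "nrm w \<ge> 0" by (rule nrm_nonneg[OF w_closed])
  have R: "nrm (T (n * j) h2) \<le> R" if j: "j \<le> q" for j
  proof -
    let ?k = "n * j"
    have "nrm (T ?k h2) \<le> C * K * \<theta> ^ ?k * (real ?k * nrm w * omega + 2) * nrm h * (2 * av ?k)"
      unfolding h2_def by (rule nrm_T_square[OF K(1,3,2) hA h1 nh loc[OF nl[OF j]]])
    also have "\<dots> \<le> R"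
      unfolding R_def
      using C K nl[OF j] nw omega(1) nh Am[OF j] avp[OF nl[OF j]]
      by (intro mult_mono add_mono power_increasing mult_nonneg_nonneg add_nonneg_nonneg) (auto simp del: of_nat_mult)
    finally show ?thesis .
  qed
  define f1 where "f1 = opp (pcompose (geom n ^ q) [:0, 1:]) h2"
  define fz where "fz = opp (pcompose (geom n ^ q) [:0, z:]) h2"
  have f1: "f1 \<in> A" "nrm f1 \<le> (4 * M) ^ q * R"
    unfolding f1_def by (rule opp_closed[OF h2A], rule geom_operator_nrm[OF _ M(2) _ _ h2A R]) (use M in auto)
  have fz: "fz \<in> A" "nrm fz \<le> (4 * M) ^ q * R"
    unfolding fz_def by (rule opp_closed[OF h2A], rule geom_operator_nrm[OF _ M(2) z h2A R]) (use M in auto)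
  define F where "F = (\<lambda>x. (1/2) * (f1 x + (1 / z ^ i) * fz x))"
  have FA: "F \<in> A" unfolding F_def by (intro cmult add f1 fz)
  have nF: "nrm F \<le> (4 * M) ^ q * R"
  proof -
    have "nrm F = 1/2 * nrm (\<lambda>x. f1 x + (1 / z ^ i) * fz x)"
      unfolding F_def nrm_cmult[OF add[OF f1(1) cmult[OF fz(1)]]] by simp
    also have "\<dots> \<le> 1/2 * (nrm f1 + nrm (\<lambda>x. (1 / z ^ i) * fz x))"
      by (intro mult_left_mono nrm_add f1 cmult fz) auto
    also have "nrm (\<lambda>x. (1 / z ^ i) * fz x) = nrm fz"
      unfolding nrm_cmult[OF fz(1)] using z by (simp add: norm_divide norm_power)
    finally show ?thesis using f1 fz by simp
  qed
  define om where "om k = (1 + z ^ k / z ^ i) / 2" for k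
  define tm where "tm k x = coeff (geom n ^ q) k * om k * T k h2 x" for k x
  have z0: "z \<noteq> 0" using z by auto
  have F: "F x = (\<Sum>k\<le>N. tm k x)" for x
  proof -
    have d: "degree (geom n ^ q) \<le> N" using degree_geom[of n q] by (simp add: N)
    have dz: "degree (pcompose (geom n ^ q) [:0, z:]) \<le> N"
      by (rule degree_le) (use d in \<open>auto simp: coeff_pcompose_linear coeff_eq_0\<close>)
    have "f1 x = (\<Sum>k\<le>N. coeff (geom n ^ q) k * T k h2 x)"
      unfolding f1_def by (simp add: opp_extend[OF d])
    moreover have "fz x = (\<Sum>k\<le>N. z ^ k * coeff (geom n ^ q) k * T k h2 x)"
      unfolding fz_def opp_extend[OF dz] by (simp add: coeff_pcompose_linear)
    ultimately show ?thesis
      unfolding F_def by (simp add: tm_def om_def sum_distrib_left sum.distrib[symmetric] field_simps sum_divide_distrib)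
  qed
  have om_le: "cmod (om k) \<le> 1" for k
  proof -
    have "cmod (1 + z ^ k / z ^ i) \<le> 1 + cmod (z ^ k / z ^ i)"
      using norm_triangle_ineq[of "1::complex" "z ^ k / z ^ i"] by simp
    then show ?thesis using z by (simp add: om_def norm_divide norm_power)
  qed
  have om_i: "om i = 1" using z0 by (simp add: om_def)
  have om_gap: "cmod (om k) \<le> 1 - \<epsilon>" if k: "k \<le> N" "k \<noteq> i" for k
  proof (cases "i < k")
    case True
    then have "z ^ k / z ^ i = z ^ (k - i)" using z0 by (simp add: power_diff)
    moreover have "cmod (1 + z ^ (k - i)) \<le> 2 * (1 - \<epsilon>)" by (rule gap(1)) (use True k in auto)
    ultimately show ?thesis by (simp add: om_def norm_divide)
  next
    case False
    then have lt: "k < i" using k by simp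
    then have "1 + z ^ k / z ^ i = (1 + z ^ (i - k)) * (z ^ k / z ^ i)"
      using z0 by (simp add: power_diff field_simps)
    then have "cmod (1 + z ^ k / z ^ i) = cmod (1 + z ^ (i - k))"
      using z by (simp add: norm_mult norm_divide norm_power)
    moreover have "cmod (1 + z ^ (i - k)) \<le> 2 * (1 - \<epsilon>)" by (rule gap(1)) (use lt i in auto)
    ultimately show ?thesis by (simp add: om_def norm_divide)
  qed
  have tm_off: "cmod (tm k x) \<le> gc n q k * (omega ^ N * \<eta>)" if "k \<le> N" "(phi ^^ k) x \<notin> V" for k x
  proof -
    have "cmod (tm k x) = gc n q k * cmod (om k) * (cmod (P k x) * (cmod (h ((phi ^^ k) x)) * cmod (h ((phi ^^ k) x))))"
      by (simp add: tm_def norm_mult gc_def T_def h2_def power2_eq_square)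
    also have "\<dots> \<le> gc n q k * 1 * (omega ^ N * (\<eta> * 1))"
      using om_le h1 hoff that om Ppw \<eta> by (intro mult_mono) auto
    finally show ?thesis by simp
  qed
  have tm_on: "cmod (tm k x) \<le> cmod (om k) * (1 + \<epsilon>/8) * \<beta>" if "k \<le> N" "(phi ^^ k) x \<in> V" for k x
  proof -
    have "cmod (tm k x) = cmod (om k) * (gc n q k * (bwd k ((phi ^^ k) x) * (cmod (h ((phi ^^ k) x)) ^ 2)))"
      by (simp add: tm_def norm_mult gc_def T_def h2_def norm_power Pb)
    also have "\<dots> \<le> cmod (om k) * (gc n q k * (((1 + \<epsilon>/8) * av k) * 1))"
      using var(1)[OF that(2,1)] h1 gap(2,3) avp[OF that(1)]
      by (intro mult_left_mono mult_mono power_le_one) (auto simp: less_imp_le)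
    also have "\<dots> = cmod (om k) * (1 + \<epsilon>/8) * (gc n q k * av k)" by simp
    also have "\<dots> \<le> cmod (om k) * (1 + \<epsilon>/8) * \<beta>"
      using i(2)[OF that(1)] gap(2,3) by (intro mult_left_mono) (auto simp: \<beta>_def)
    finally show ?thesis .
  qed
  have sum_off: "cmod (\<Sum>k\<in>I. tm k x) \<le> \<epsilon>/8" if "I \<subseteq> {..N}" "\<And>k. k \<in> I \<Longrightarrow> (phi ^^ k) x \<notin> V" for I x
  proof -
    have fin: "finite I" using that(1) finite_subset by blast
    have "cmod (\<Sum>k\<in>I. tm k x) \<le> (\<Sum>k\<in>I. gc n q k * (omega ^ N * \<eta>))"
      by (rule order_trans[OF norm_sum sum_mono]) (use that tm_off in auto)
    also have "\<dots> \<le> (\<Sum>k\<le>N. gc n q k * (omega ^ N * \<eta>))"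
      by (rule sum_mono2) (use that om \<eta> in auto)
    also have "\<dots> = real n ^ q * omega ^ N * \<eta>"
      using sum_gc[of n q] by (simp add: N sum_distrib_right[symmetric])
    finally show ?thesis using \<eta>(4) by linarith
  qed
  have uniq: "k = k'" if "(phi ^^ k) x \<in> V" "(phi ^^ k') x \<in> V" "k \<le> N" "k' \<le> N" for k k' x
  proof (rule ccontr)
    have aux: False if "(phi ^^ a) x \<in> V" "(phi ^^ b) x \<in> V" "b \<le> N" "a < b" for a b
    proof -
      have "(phi ^^ (b - a)) ((phi ^^ a) x) = (phi ^^ b) x"
        using \<open>a < b\<close> funpow_add[of "b - a" a phi] by simp
      moreover have "(phi ^^ (b - a)) ((phi ^^ a) x) \<notin> V"
        by (rule sep[OF that(1)]) (use that in auto)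
      ultimately show False using that by simp
    qed
    assume "k \<noteq> k'"
    then show False using aux[of k k'] aux[of k' k] that by linarith
  qed
  define x0 where "x0 = (psi ^^ i) v0"
  have x0: "(phi ^^ i) x0 = v0" by (simp add: x0_def)
  \<comment> \<open>Bump i keeps at least 1 - \<epsilon>/4 of its nominal height \<beta>, and
    \<open>high\<close> leaves at most 1 - 3\<epsilon>/4 of \<beta> elsewhere. The quotient is at
    most 1 - \<epsilon>/2, the base of the power l.\<close>
  have low: "(1 - \<epsilon>/4) * \<beta> \<le> cmod (F x0)"
  proof -
    have "F x0 = tm i x0 + (\<Sum>k\<in>{..N} - {i}. tm k x0)"
      unfolding F by (rule sum.remove) (use i in auto)
    moreover have "cmod (\<Sum>k\<in>{..N} - {i}. tm k x0) \<le> \<epsilon>/8"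
    proof (rule sum_off)
      fix k assume "k \<in> {..N} - {i}"
      then show "(phi ^^ k) x0 \<notin> V" using uniq[of k x0 i] x0 v0V i by auto
    qed auto
    moreover have "cmod (tm i x0) = gc n q i * bwd i v0"
      by (simp add: tm_def om_i norm_mult gc_def T_def h2_def norm_power Pb x0 v0)
    moreover have "(1 - \<epsilon>/8) * \<beta> \<le> gc n q i * bwd i v0"
      using mult_left_mono[OF var(2)[OF v0V i(1)], of "gc n q i"] by (simp add: \<beta>_def mult_ac)
    moreover have "\<epsilon>/8 \<le> \<epsilon>/8 * \<beta>" using gap(2,3) \<beta>1 by simp
    moreover have "cmod (tm i x0) \<le> cmod (F x0) + cmod (\<Sum>k\<in>{..N} - {i}. tm k x0)"
      using calculation(1) norm_diff_triangle_le norm_triangle_ineq4[of "F x0" "\<Sum>k\<in>{..N} - {i}. tm k x0"]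
      by (simp add: algebra_simps)
    ultimately show ?thesis by (simp add: algebra_simps)
  qed
  have high: "cmod (F x) \<le> (1 - 3*\<epsilon>/4) * \<beta>" if x: "(phi ^^ i) x \<notin> V" for x
  proof (cases "\<exists>k\<le>N. (phi ^^ k) x \<in> V")
    case True
    then obtain k where k: "k \<le> N" "(phi ^^ k) x \<in> V" by blast
    have ki: "k \<noteq> i" using k x by auto
    have "F x = tm k x + (\<Sum>j\<in>{..N} - {k}. tm j x)"
      unfolding F by (rule sum.remove) (use k in auto)
    moreover have "cmod (\<Sum>j\<in>{..N} - {k}. tm j x) \<le> \<epsilon>/8"
    proof (rule sum_off)
      fix j assume "j \<in> {..N} - {k}"
      then show "(phi ^^ j) x \<notin> V" using uniq[of j x k] k by blast
    qed auto
    ultimately have "cmod (F x) \<le> cmod (tm k x) + \<epsilon>/8"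
      using norm_triangle_ineq[of "tm k x" "\<Sum>j\<in>{..N} - {k}. tm j x"] by simp
    also have "cmod (tm k x) \<le> (1 - \<epsilon>) * (1 + \<epsilon>/8) * \<beta>"
      by (rule order_trans[OF tm_on[OF k]], intro mult_right_mono om_gap[OF k(1) ki]) (use gap(2) \<beta>1 in auto)
    also have "(1 - \<epsilon>) * (1 + \<epsilon>/8) * \<beta> \<le> (1 - 7*\<epsilon>/8) * \<beta>"
      using \<beta>1 gap(2,3) by (intro mult_right_mono) (auto simp: algebra_simps)
    finally have "cmod (F x) \<le> (1 - 7*\<epsilon>/8) * \<beta> + \<epsilon>/8" by simp
    also have "\<dots> = (1 - 3*\<epsilon>/4) * \<beta> - \<epsilon> * (\<beta> - 1) / 8" by (simp add: field_simps)
    also have "\<dots> \<le> (1 - 3*\<epsilon>/4) * \<beta>" using gap(2) \<beta>1 by simp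
    finally show ?thesis .
  next
    case False
    then have "cmod (F x) \<le> \<epsilon>/8" unfolding F by (intro sum_off) auto
    also have "\<dots> \<le> (1 - 3*\<epsilon>/4) * 1" using gap(2,3) by simp
    also have "\<dots> \<le> (1 - 3*\<epsilon>/4) * \<beta>" using gap(2,3) \<beta>1 by (intro mult_left_mono) auto
    finally show ?thesis .
  qed
  obtain xm where xm: "\<And>x. cmod (F x) \<le> cmod (F xm)"
    using continuous_attains_sup[OF compact_space, of "\<lambda>x. cmod (F x)"] continuous_on_norm[OF continuous[OF FA]]
    by auto
  define s where "s = cmod (F xm)"
  have s: "s \<ge> (1 - \<epsilon>/4) * \<beta>" using low xm[of x0] by (simp add: s_def)
  have s_half: "s \<ge> \<beta> / 2"
  proof -
    have "1/2 * \<beta> \<le> (1 - \<epsilon>/4) * \<beta>" using gap(2,3) \<beta>1 by (intro mult_right_mono) auto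
    then show ?thesis using s by simp
  qed
  have s0: "s > 0" using s_half \<beta>1 by linarith
  define G where "G = (\<lambda>x. complex_of_real (1 / s) * F x)"
  have GA: "G \<in> A" unfolding G_def by (rule cmult[OF FA])
  have Gm: "cmod (G x) = cmod (F x) / s" for x using s0 by (simp add: G_def norm_mult norm_divide)
  have G1: "cmod (G x) \<le> 1" for x using xm[of x] s0 by (simp add: Gm s_def)
  have nG: "nrm G \<le> 2 / \<beta> * ((4 * M) ^ q * R)"
  proof -
    have "nrm G = 1 / s * nrm F" unfolding G_def nrm_cmult[OF FA] norm_of_real using s0 by simp
    also have "\<dots> \<le> (2 / \<beta>) * ((4 * M) ^ q * R)"
    proof (intro mult_mono nF)
      show "1 / s \<le> 2 / \<beta>" using s_half s0 \<beta>1 by (simp add: field_simps)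
    qed (use \<beta>1 FA in auto)
    finally show ?thesis .
  qed
  define h' where "h' = (\<lambda>x. G ((psi ^^ i) x) ^ l)"
  have GlA: "(\<lambda>x. G x ^ l) \<in> A" by (rule power_closed[OF GA])
  have h'A: "h' \<in> A" unfolding h'_def using comp_psi_pow[OF GlA, of i] by simp
  have "nrm h' \<le> K * \<theta> ^ i * nrm (\<lambda>x. G x ^ l)"
    unfolding h'_def using K(4)[OF GlA, of i] by simp
  also have "\<dots> \<le> K * \<theta> ^ N * (C * real l * nrm G * 1)"
    using K i nrm_power[OF GA G1 l(1)] GlA
    by (intro mult_mono power_increasing) auto
  also have "\<dots> \<le> K * \<theta> ^ N * (C * real l * (2 / \<beta> * ((4 * M) ^ q * R)) * 1)"
    using K C nG by (intro mult_left_mono mult_right_mono) auto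
  also have "\<dots> = 4 * C\<^sup>2 * K\<^sup>2 * real l * (real N * nrm w * omega + 2) *
    \<theta> ^ (2 * N) * (4 * M) ^ q * (Am / \<beta>) * nrm h"
  proof -
    have "k * t * (c * j * (2 / b * (y * (c * k * t * X * u * (2 * a)))) * 1) =
        4 * c\<^sup>2 * k\<^sup>2 * j * X * (t * t) * y * (a / b) * u" for k t c j b y X u a :: real
      by (simp add: power2_eq_square)
    moreover have "\<theta> ^ (2 * N) = \<theta> ^ N * \<theta> ^ N" by (simp add: mult_2 power_add)
    ultimately show ?thesis unfolding R_def by presburger
  qed
  finally have bound: "nrm h' \<le> 4 * C\<^sup>2 * K\<^sup>2 * real l * (real N * nrm w * omega + 2) *
    \<theta> ^ (2 * N) * (4 * M) ^ q * (Am / \<beta>) * nrm h" .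
  have "peaked V \<eta> h'"
    unfolding peaked_def
  proof (intro conjI allI impI h'A)
    show "cmod (h' x) \<le> 1" for x by (simp add: h'_def norm_power power_le_one G1)
    show "\<exists>x. cmod (h' x) = 1"
      by (rule exI[of _ "(phi ^^ i) xm"]) (use s0 in \<open>simp add: h'_def norm_power Gm s_def\<close>)
    fix x assume x: "x \<notin> V"
    have "cmod (F ((psi ^^ i) x)) \<le> (1 - 3*\<epsilon>/4) * \<beta>" by (rule high) (use x in simp)
    also have "\<dots> \<le> ((1 - \<epsilon>/2) * (1 - \<epsilon>/4)) * \<beta>"
      using \<beta>1 gap(2,3) by (intro mult_right_mono) (auto simp: algebra_simps)
    also have "\<dots> \<le> (1 - \<epsilon>/2) * s" using s gap(2,3) by (simp add: mult.assoc)
    finally have "cmod (G ((psi ^^ i) x)) \<le> 1 - \<epsilon>/2" using s0 by (simp add: Gm field_simps)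
    then have "cmod (G ((psi ^^ i) x)) ^ l \<le> (1 - \<epsilon>/2) ^ l" by (intro power_mono) auto
    then show "cmod (h' x) \<le> \<eta>" using l by (simp add: h'_def norm_power)
  qed
  then show ?thesis using bound unfolding \<beta>_def by blast
qed

end

lemma finite_argmax:
  fixes f :: "'a \<Rightarrow> real"
  assumes "finite S" "S \<noteq> {}"
  obtains i where "i \<in> S" "\<And>k. k \<in> S \<Longrightarrow> f k \<le> f i"
proof -
  have "Max (f ` S) \<in> f ` S" using assms by simp
  then obtain i where "i \<in> S" "Max (f ` S) = f i" by auto
  moreover have "f k \<le> Max (f ` S)" if "k \<in> S" for k using assms that by simp
  ultimately show thesis using that by metis
qed

lemma summable_blocks:
  fixes f :: "nat \<Rightarrow> real"
  assumes L: "L \<ge> 1" and f: "\<And>m. 0 \<le> f m" "\<And>m. f m \<le> B * (1/2) ^ (m div L)"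
  shows "summable f"
proof -
  \<comment> \<open>The L-th root turns block decay into geometric decay; within a block it costs at
    most a factor 2.\<close>
  define \<kappa> where "\<kappa> = root L (1/2)"
  have \<kappa>: "0 < \<kappa>" "\<kappa> < 1" "\<kappa> ^ L = 1/2" using L by (auto simp: \<kappa>_def)
  have B: "B \<ge> 0" using f(1)[of 0] f(2)[of 0] by simp
  have "f m \<le> 2 * B * \<kappa> ^ m" for m
  proof -
    have "m mod L \<le> L" using L by (simp add: less_imp_le)
    then have r: "1/2 \<le> \<kappa> ^ (m mod L)"
      unfolding \<kappa>(3)[symmetric] using \<kappa>(1,2) by (intro power_decreasing) auto
    have "\<kappa> ^ m = \<kappa> ^ (L * (m div L) + m mod L)" by simp
    also have "\<dots> = (\<kappa> ^ L) ^ (m div L) * \<kappa> ^ (m mod L)" unfolding power_add power_mult ..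
    finally have e: "\<kappa> ^ m = (1/2) ^ (m div L) * \<kappa> ^ (m mod L)" unfolding \<kappa>(3) .
    have "(1/2) ^ (m div L) * (1/2) \<le> \<kappa> ^ m" unfolding e by (rule mult_left_mono[OF r]) simp
    then have "(1/2) ^ (m div L) \<le> 2 * \<kappa> ^ m" by simp
    then have "B * (1/2) ^ (m div L) \<le> B * (2 * \<kappa> ^ m)" using B by (intro mult_left_mono)
    then show ?thesis using f(2)[of m] by simp
  qed
  then have le: "norm (f m) \<le> 2 * B * \<kappa> ^ m" for m using f(1)[of m] by simp
  have "summable (\<lambda>m. 2 * B * \<kappa> ^ m)"
    by (intro summable_mult summable_geometric) (use \<kappa> in simp)
  then show ?thesis by (rule summable_comparison_test'[where N = 0]) (rule le)
qed

context weighted_composition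
begin

text \<open>Only finitely many conditions are imposed, each valid on a neighbourhood of an aperiodic
  y.\<close>

lemma separating_neighbourhood:
  fixes N :: nat
  assumes y: "\<And>m. m \<ge> 1 \<Longrightarrow> (phi ^^ m) y \<noteq> y" and \<delta>: "\<delta> > 0"
  obtains V where "open V" "y \<in> V" "\<And>v m. v \<in> V \<Longrightarrow> 1 \<le> m \<Longrightarrow> m \<le> N \<Longrightarrow> (phi ^^ m) v \<notin> V"
    "\<And>v k. v \<in> V \<Longrightarrow> k \<le> N \<Longrightarrow> \<bar>bwd k v - bwd k y\<bar> < \<delta> * bwd k y"
proof -
  have "\<exists>S. open S \<and> y \<in> S \<and> (\<forall>v\<in>S. (phi ^^ m) v \<notin> S)" if m: "m \<ge> 1" for m
  proof -
    obtain S1 S2 where S: "open S1" "open S2" "y \<in> S1" "(phi ^^ m) y \<in> S2" "S1 \<inter> S2 = {}"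
      using hausdorff[of y "(phi ^^ m) y"] y[OF m] by metis
    have "open ((phi ^^ m) -` S2)"
      using continuous_phi_pow[of m] S(2) by (simp add: continuous_on_open_vimage)
    then show ?thesis
      by (intro exI[of _ "S1 \<inter> (phi ^^ m) -` S2"]) (use S in auto)
  qed
  then obtain S where S: "\<And>m. m \<ge> 1 \<Longrightarrow> open (S m) \<and> y \<in> S m \<and> (\<forall>v\<in>S m. (phi ^^ m) v \<notin> S m)"
    by metis
  define R where "R k = {v. \<bar>bwd k v - bwd k y\<bar> < \<delta> * bwd k y}" for k
  have R: "open (R k)" for k
    unfolding R_def by (intro open_Collect_less continuous_intros continuous_bwd)
  define V where "V = (\<Inter>m\<in>{1..N}. S m) \<inter> (\<Inter>k\<in>{..N}. R k)"
  show thesis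
  proof
    show "open V" unfolding V_def using S R by (intro open_Int open_INT) auto
    show "y \<in> V" unfolding V_def R_def using S \<delta> by auto
    show "(phi ^^ m) v \<notin> V" if "v \<in> V" "1 \<le> m" "m \<le> N" for v m
    proof -
      have "v \<in> S m" using that by (auto simp: V_def)
      then have "(phi ^^ m) v \<notin> S m" using S[OF that(2)] by blast
      moreover have "m \<in> {1..N}" using that by simp
      ultimately show ?thesis unfolding V_def by blast
    qed
    show "\<bar>bwd k v - bwd k y\<bar> < \<delta> * bwd k y" if "v \<in> V" "k \<le> N" for v k
      using that by (auto simp: V_def R_def)
  qed
qed

text \<open>The maximum of g is at least 1, so rescaling by it does not raise the values off
  V.\<close>

lemma peaked_exists:
  assumes V: "open V" "y \<in> V" "\<eta> > 0"
  obtains h where "peaked V \<eta> h"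
proof -
  obtain g where g: "g \<in> A" "g y = 1" "\<And>x. x \<notin> V \<Longrightarrow> cmod (g x) \<le> \<eta>"
    using peak[OF V] by blast
  obtain xm where xm: "\<And>x. cmod (g x) \<le> cmod (g xm)"
    using continuous_attains_sup[OF compact_space, of "\<lambda>x. cmod (g x)"] continuous_on_norm[OF continuous[OF g(1)]]
    by auto
  define s where "s = cmod (g xm)"
  have s: "s \<ge> 1" using xm[of y] g(2) by (simp add: s_def)
  have "peaked V \<eta> (\<lambda>x. complex_of_real (1 / s) * g x)"
    unfolding peaked_def
  proof (intro conjI allI impI cmult g)
    have m: "cmod (complex_of_real (1 / s) * g x) = cmod (g x) / s" for x
      using s by (simp add: norm_mult norm_divide)
    show "cmod (complex_of_real (1 / s) * g x) \<le> 1" for x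
      unfolding m using xm[of x] s unfolding s_def[symmetric] by simp
    show "\<exists>x. cmod (complex_of_real (1 / s) * g x) = 1"
      unfolding m using s by (intro exI[of _ xm]) (simp flip: s_def)
    show "cmod (complex_of_real (1 / s) * g x) \<le> \<eta>" if "x \<notin> V" for x
    proof -
      have "cmod (g x) / s \<le> cmod (g x) / 1" using s by (intro divide_left_mono) auto
      then show ?thesis unfolding m using g(3)[OF that] by simp
    qed
  qed
  then show thesis using that by blast
qed

text \<open>
  If the estimate failed at an aperiodic point \<open>y\<close>, \<open>peaked_improve\<close> would halve the norm of
  every function peaking near \<open>y\<close>, although these norms are bounded below by 1.
\<close>

lemma geom_bound:
  assumes M: "M \<ge> 1" "\<And>g. g \<in> A \<Longrightarrow> nrm g \<le> M * nrm (\<lambda>x. w x * g (phi x) - g x)"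
    and \<theta>: "\<theta> > 1"
  obtains Kc where "Kc > 0" "\<And>n q y k. n \<ge> 1 \<Longrightarrow> k \<le> q * n \<Longrightarrow>
     \<exists>l\<le>q. gc n q k * bwd k y \<le> Kc * \<theta> ^ (q * n) * (4 * M) ^ q * bwd (n * l) y"
proof -
  \<comment> \<open>Of three factors t^N, two pay for composing with iterates of phi and of psi, and
    the third absorbs the polynomial losses.\<close>
  define t where "t = root 3 \<theta>"
  have t: "t > 1" "t ^ 3 = \<theta>" using \<theta> by (auto simp: t_def)
  obtain K where K: "K \<ge> 1" "\<And>n f. f \<in> A \<Longrightarrow> nrm (\<lambda>x. f ((phi ^^ n) x)) \<le> K * t ^ n * nrm f"
      "\<And>n f. f \<in> A \<Longrightarrow> nrm (\<lambda>x. f ((psi ^^ n) x)) \<le> K * t ^ n * nrm f"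
    using growth[OF t(1)] by auto
  \<comment> \<open>Degree 4 comes from the exponent l, degree 1 from the N weight factors in
    \<open>nrm_T_square\<close>.\<close>
  have "(\<lambda>N. (real N + 1) ^ 5 / t ^ N) \<longlonglongrightarrow> 0" using t(1) by real_asymp
  then have "Bseq (\<lambda>N. (real N + 1) ^ 5 / t ^ N)" by (rule convergent_imp_Bseq[OF convergentI])
  then obtain K5 where K5: "K5 > 0" "\<And>N. norm ((real N + 1) ^ 5 / t ^ N) \<le> K5" by (auto elim: BseqE)
  have K5': "(real N + 1) ^ 5 \<le> K5 * t ^ N" for N
  proof -
    have "(real N + 1) ^ 5 / t ^ N \<le> K5" using K5(2)[of N] by (metis abs_ge_self order_trans real_norm_def)
    then show ?thesis using t by (simp add: pos_divide_le_eq)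
  qed
  define e0 where "e0 = 128 * M\<^sup>2"
  \<comment> \<open>D^N dominates at once the coefficient mass n^q \<le> 2^N and the weight ratios
    up to omega^(2N); \<open>et\<close> below is the resulting level off the peak.\<close>
  define D where "D = 2 * omega\<^sup>2"
  have M2: "M\<^sup>2 \<ge> 1" using M(1) by simp
  have e0: "e0 \<ge> 128" using M2 by (simp add: e0_def)
  have om2: "omega\<^sup>2 \<ge> 1" using omega(1) by simp
  have D: "D \<ge> 2" using om2 by (simp add: D_def)
  define ep where "ep N = 1 / (e0 * (real N + 1)\<^sup>2)" for N :: nat
  have s1: "(real N + 1)\<^sup>2 \<ge> 1" for N by simp
  have ep: "0 < ep N" "ep N \<le> 1/2" for N
  proof -
    have "e0 * (real N + 1)\<^sup>2 \<ge> 128 * 1" using e0 s1[of N] by (intro mult_mono) auto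
    then show "0 < ep N" "ep N \<le> 1/2" by (auto simp: ep_def divide_simps)
  qed
  define et where "et N = ep N / (8 * D ^ N)" for N
  have D1: "D ^ N \<ge> 1" for N using D by simp
  have et: "0 < et N" "et N < 1" for N
  proof -
    have p: "8 * D ^ N > 0" "ep N < 8 * D ^ N" using ep[of N] D1[of N] by linarith+
    then show "0 < et N" "et N < 1" using ep[of N] by (simp_all add: et_def)
  qed
  \<comment> \<open>As 1 - \<epsilon>/2 is at most exp(-\<epsilon>/2), an exponent of (2/\<epsilon>)
    ln(1/\<eta>) suffices; here ln(1/\<eta>) = ln(8/\<epsilon>) + N ln D is bounded with ln x \<le>
    x. Since 1/\<epsilon> is quadratic in N, l has degree 4.\<close>
  define l where "l N = Suc (nat \<lceil>(2 / ep N) * (8 / ep N + real N * D)\<rceil>)" for N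
  have l_ge: "real (l N) \<ge> (2 / ep N) * (8 / ep N + real N * D)" for N
    unfolding l_def using real_nat_ceiling_ge[of "(2 / ep N) * (8 / ep N + real N * D)"] by simp
  have l_eta: "(1 - ep N / 2) ^ l N \<le> et N" for N
  proof -
    have "(1 - ep N / 2) ^ l N \<le> exp (- (ep N / 2)) ^ l N"
      using exp_ge_add_one_self[of "- (ep N / 2)"] ep[of N] by (intro power_mono) auto
    also have "\<dots> = exp (- (ep N / 2 * real (l N)))"
      by (simp add: exp_of_nat_mult[symmetric] mult.commute)
    also have "\<dots> \<le> exp (- (8 / ep N + real N * D))"
    proof -
      have "ep N / 2 * ((2 / ep N) * (8 / ep N + real N * D)) \<le> ep N / 2 * real (l N)"
        using l_ge[of N] ep[of N] by (intro mult_left_mono) auto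
      then show ?thesis using ep[of N] by simp
    qed
    also have "\<dots> \<le> exp (- (ln (8 / ep N) + real N * ln D))"
    proof -
      have "ln (8 / ep N) \<le> 8 / ep N" using ln_le_minus_one[of "8 / ep N"] ep[of N] by simp
      moreover have "real N * ln D \<le> real N * D"
        using ln_le_minus_one[of D] D by (intro mult_left_mono) auto
      ultimately show ?thesis by simp
    qed
    also have "\<dots> = et N"
    proof -
      have "exp (real N * ln D) = D ^ N" using D by (simp add: exp_of_nat_mult)
      then have "exp (ln (8 / ep N) + real N * ln D) = 8 / ep N * D ^ N"
        using ep[of N] by (simp add: exp_add)
      then show ?thesis unfolding exp_minus et_def by simp
    qed
    finally show ?thesis .
  qed
  define c1 where "c1 = 2 * e0 * (8 * e0 + D) + 2"
  have l_le: "real (l N) \<le> c1 * (real N + 1) ^ 4" for N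
  proof -
    define s where "s = real N + 1"
    have s: "s \<ge> 1" by (simp add: s_def)
    have e: "1 / ep N = e0 * s\<^sup>2" by (simp add: ep_def s_def)
    have s2: "s \<le> s\<^sup>2" "1 \<le> s ^ 4" using s self_le_power[of s 2] by auto
    have "(2 / ep N) * (8 / ep N + real N * D) = 2 * (1 / ep N) * (8 * (1 / ep N) + real N * D)" by simp
    also have "\<dots> = (2 * e0 * s\<^sup>2) * (8 * e0 * s\<^sup>2 + real N * D)" unfolding e by simp
    also have "\<dots> \<le> (2 * e0 * s\<^sup>2) * (8 * e0 * s\<^sup>2 + s\<^sup>2 * D)"
      using s2 D e0 by (intro mult_left_mono add_left_mono mult_right_mono) (auto simp: s_def)
    also have "\<dots> = 2 * e0 * (8 * e0 + D) * s ^ 4"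
      by (simp add: algebra_simps power2_eq_square power4_eq_xxxx)
    finally have b: "(2 / ep N) * (8 / ep N + real N * D) \<le> 2 * e0 * (8 * e0 + D) * s ^ 4" .
    have "0 \<le> (2 / ep N) * (8 / ep N + real N * D)" using ep[of N] D by auto
    then have "real (l N) \<le> (2 / ep N) * (8 / ep N + real N * D) + 2"
      unfolding l_def by linarith
    also have "\<dots> \<le> 2 * e0 * (8 * e0 + D) * s ^ 4 + 2 * s ^ 4" using b s2 by linarith
    finally show ?thesis by (simp add: c1_def s_def algebra_simps)
  qed
  have c1: "c1 > 0" using e0 D by (auto simp: c1_def intro!: add_pos_pos mult_pos_pos)
  have nw: "nrm w \<ge> 0" by (rule nrm_nonneg[OF w_closed])
  define W where "W = nrm w * omega + 2"
  have W: "W > 0" using nw omega(1) by (auto simp: W_def intro!: add_nonneg_pos)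
  define Q where "Q N = 4 * C\<^sup>2 * K\<^sup>2 * real (l N) * (real N * nrm w * omega + 2) * t ^ (2 * N)" for N
  define Kc where "Kc = 8 * C\<^sup>2 * K\<^sup>2 * c1 * W * K5"
  have Kc: "Kc > 0" using C K(1) c1 W K5 by (auto simp: Kc_def intro!: mult_pos_pos)
  have QK: "2 * Q N \<le> Kc * \<theta> ^ N" for N
  proof -
    define s where "s = real N + 1"
    have s: "s \<ge> 1" by (simp add: s_def)
    have "real N * nrm w * omega + 2 \<le> s * W"
      using nw omega(1) mult_nonneg_nonneg[of "nrm w" omega] by (simp add: s_def W_def algebra_simps)
    then have "2 * Q N \<le> 2 * (4 * C\<^sup>2 * K\<^sup>2 * (c1 * s ^ 4) * (s * W) * t ^ (2 * N))"
      unfolding Q_def using l_le[of N] C K(1) c1 s t nw omega(1)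
      by (intro mult_left_mono mult_mono mult_right_mono) (auto simp: s_def)
    also have "\<dots> = 8 * C\<^sup>2 * K\<^sup>2 * c1 * W * t ^ (2 * N) * s ^ 5"
      by (simp add: eval_nat_numeral)
    also have "\<dots> \<le> 8 * C\<^sup>2 * K\<^sup>2 * c1 * W * t ^ (2 * N) * (K5 * t ^ N)"
      using K5'[of N] c1 W t by (intro mult_left_mono) (auto simp: s_def intro!: mult_nonneg_nonneg)
    also have "\<dots> = Kc * (t ^ (2 * N) * t ^ N)" by (simp add: Kc_def)
    also have "t ^ (2 * N) * t ^ N = \<theta> ^ N"
    proof -
      have "2 * N + N = 3 * N" by simp
      then show ?thesis unfolding t(2)[symmetric] power_add[symmetric] power_mult[symmetric] by simp
    qed
    finally show ?thesis .
  qed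
  have ap: "\<exists>j\<le>q. gc n q k * bwd k y \<le> Kc * \<theta> ^ (q * n) * (4 * M) ^ q * bwd (n * j) y"
    if n: "n \<ge> 1" and k: "k \<le> q * n" and y: "\<And>m. m \<ge> 1 \<Longrightarrow> (phi ^^ m) y \<noteq> y" for n q k y
  proof (rule ccontr)
    assume "\<not> ?thesis"
    then have neg: "\<And>j. j \<le> q \<Longrightarrow> Kc * \<theta> ^ (q * n) * (4 * M) ^ q * bwd (n * j) y < gc n q k * bwd k y"
      by force
    define N where "N = q * n"
    define \<epsilon> where "\<epsilon> = ep N"
    define \<eta> where "\<eta> = et N"
    define av where "av k = bwd k y" for k
    obtain V where V: "open V" "y \<in> V" "\<And>v m. v \<in> V \<Longrightarrow> 1 \<le> m \<Longrightarrow> m \<le> N \<Longrightarrow> (phi ^^ m) v \<notin> V"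
      "\<And>v k. v \<in> V \<Longrightarrow> k \<le> N \<Longrightarrow> \<bar>bwd k v - bwd k y\<bar> < \<epsilon>/8 * bwd k y"
    proof -
      have "\<epsilon>/8 > 0" using ep[of N] by (simp add: \<epsilon>_def)
      from separating_neighbourhood[where N = N, OF y this] that show thesis by blast
    qed
    obtain z where z: "cmod z = 1" "M * cmod (z - 1) \<le> 1/2"
      "\<And>m. 1 \<le> m \<Longrightarrow> m \<le> N \<Longrightarrow> cmod (1 + z ^ m) \<le> 2 * (1 - \<epsilon>)"
      using rotation_gap[OF M(1), of N] unfolding \<epsilon>_def ep_def e0_def by blast
    obtain i where i: "i \<in> {..N}" "\<And>k. k \<in> {..N} \<Longrightarrow> gc n q k * av k \<le> gc n q i * av i"
      by (rule finite_argmax[of "{..N}" "\<lambda>k. gc n q k * av k"]) auto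
    obtain j where j: "j \<in> {..q}" "\<And>k. k \<in> {..q} \<Longrightarrow> av (n * k) \<le> av (n * j)"
      by (rule finite_argmax[of "{..q}" "\<lambda>k. av (n * k)"]) auto
    define Am where "Am = av (n * j)"
    define \<beta> where "\<beta> = gc n q i * av i"
    have \<beta>1: "1 \<le> \<beta>" using i(2)[of 0] gc_0[OF n, of q] by (simp add: av_def \<beta>_def)
    have small: "Q N * (4 * M) ^ q * (Am / \<beta>) \<le> 1/2"
    proof -
      have "2 * Q N * ((4 * M) ^ q * Am) \<le> Kc * \<theta> ^ N * ((4 * M) ^ q * Am)"
        using QK[of N] M(1) by (intro mult_right_mono) (auto simp: Am_def av_def less_imp_le)
      also have "\<dots> < gc n q k * av k"
        using neg[of j] j by (simp add: Am_def av_def N_def mult_ac)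
      also have "\<dots> \<le> \<beta>" using i(2)[of k] k by (simp add: \<beta>_def N_def)
      finally show ?thesis using \<beta>1 by (simp add: field_simps)
    qed
    have om: "omega ^ N \<ge> 1" using omega(1) by simp
    have DN: "D ^ N = 2 ^ N * (omega ^ N * omega ^ N)"
      by (simp add: D_def power_mult_distrib power2_eq_square)
    have improve: "\<exists>h'. peaked V \<eta> h' \<and> nrm h' \<le> 1/2 * nrm h" if h: "peaked V \<eta> h" for h
    proof -
      have "\<exists>h'. peaked V \<eta> h' \<and> nrm h' \<le> 4 * C\<^sup>2 * K\<^sup>2 * real (l N) * (real N * nrm w * omega + 2) *
          t ^ (2 * N) * (4 * M) ^ q * (Am / (gc n q i * av i)) * nrm h"
      proof (rule peaked_improve[OF M _ K(1) K(2,3) N_def V(3) z(1,2,3), where av = av])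
        show "bwd k v \<le> (1 + \<epsilon>/8) * av k" "(1 - \<epsilon>/8) * av k \<le> bwd k v" if "v \<in> V" "k \<le> N" for v k
        proof -
          have "(1 + \<epsilon>/8) * av k = bwd k y + \<epsilon>/8 * bwd k y" "(1 - \<epsilon>/8) * av k = bwd k y - \<epsilon>/8 * bwd k y"
            by (simp_all add: av_def algebra_simps)
          then show "bwd k v \<le> (1 + \<epsilon>/8) * av k" "(1 - \<epsilon>/8) * av k \<le> bwd k v"
            using V(4)[OF that] by linarith+
        qed
        show "1 / omega ^ N \<le> av k" if "k \<le> N" for k
        proof -
          have "1 / av k \<le> omega ^ k" unfolding av_def bwd_def by (rule P_ge)
          also have "\<dots> \<le> omega ^ N" using that omega(1) by (rule power_increasing)
          finally show ?thesis using om by (simp add: av_def divide_simps mult.commute)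
        qed
        have e1: "\<eta> * omega ^ N * omega ^ N = \<epsilon> / (8 * 2 ^ N)"
          using omega(1) by (simp add: \<eta>_def et_def DN \<epsilon>_def)
        have "\<epsilon> / (8 * 2 ^ N) \<le> \<epsilon> / 1" using ep[of N] unfolding \<epsilon>_def
          by (intro divide_left_mono) (auto intro: order_trans[of _ 8])
        then show "\<eta> * omega ^ N * omega ^ N \<le> 1" using ep[of N] unfolding e1 \<epsilon>_def by linarith
        have "real n ^ q \<le> 2 ^ N"
        proof -
          have "real n \<le> 2 ^ n" using of_nat_less_two_power[of n] by (simp add: less_imp_le)
          then have "real n ^ q \<le> (2 ^ n) ^ q" by (intro power_mono) auto
          then show ?thesis by (simp add: N_def power_mult[symmetric] mult.commute)
        qed
        moreover have "omega ^ N \<le> omega ^ N * omega ^ N"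
          using mult_left_mono[OF om, of "omega ^ N"] om by simp
        ultimately have "real n ^ q * omega ^ N * \<eta> \<le> 2 ^ N * (omega ^ N * omega ^ N) * \<eta>"
          using om et(1)[of N] unfolding \<eta>_def
          by (intro mult_right_mono mult_mono) auto
        also have "\<dots> = \<epsilon> / 8" unfolding \<eta>_def et_def DN[symmetric] \<epsilon>_def using D by simp
        finally show "real n ^ q * omega ^ N * \<eta> \<le> \<epsilon> / 8" .
      qed (use t ep[of N] et[of N] l_eta[of N] i j h \<beta>1 in
          \<open>auto simp: \<epsilon>_def \<eta>_def l_def Am_def \<beta>_def\<close>)
      then obtain h' where h': "peaked V \<eta> h'"
        "nrm h' \<le> Q N * (4 * M) ^ q * (Am / \<beta>) * nrm h" unfolding Q_def \<beta>_def by blast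
      moreover have "Q N * (4 * M) ^ q * (Am / \<beta>) * nrm h \<le> 1/2 * nrm h"
        by (rule mult_right_mono[OF small]) (use h in \<open>auto simp: peaked_def\<close>)
      ultimately show ?thesis using order_trans by blast
    qed
    have one: "nrm h \<ge> 1" if "peaked V \<eta> h" for h
      using that cmod_le_nrm[of h] unfolding peaked_def by metis
    \<comment> \<open>A peaking function of norm below twice the infimum would be improved to one
      below the infimum.\<close>
    define I where "I = Inf (nrm ` {h. peaked V \<eta> h})"
    obtain h0 where h0: "peaked V \<eta> h0"
      using peaked_exists[OF V(1,2)] et[of N] unfolding \<eta>_def by blast
    have bdd: "bdd_below (nrm ` {h. peaked V \<eta> h})" using one by (intro bdd_belowI[of _ 1]) auto
    have I1: "I \<ge> 1" unfolding I_def by (rule cInf_greatest) (use h0 one in auto)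
    then have "I < 2 * I" by simp
    then obtain h where h: "peaked V \<eta> h" "nrm h < 2 * I"
      unfolding I_def using cInf_lessD[of "nrm ` {h. peaked V \<eta> h}"] h0 by blast
    obtain h' where h': "peaked V \<eta> h'" "nrm h' \<le> 1/2 * nrm h" using improve[OF h(1)] by blast
    have "I \<le> nrm h'" unfolding I_def by (rule cInf_lower[OF _ bdd]) (use h' in auto)
    then show False using h h' by simp
  qed
  show thesis
  proof (rule that[OF Kc])
    fix n q y k assume n: "(n::nat) \<ge> 1" and k: "k \<le> q * n"
    show "\<exists>l\<le>q. gc n q k * bwd k y \<le> Kc * \<theta> ^ (q * n) * (4 * M) ^ q * bwd (n * l) y"
    proof (rule ccontr)
      assume neg: "\<not> ?thesis"
      \<comment> \<open>Failure is an open condition on y, so it would occur at an aperiodic point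
        as well.\<close>
      define S where "S = (\<Inter>l\<in>{..q}. {y. Kc * \<theta> ^ (q * n) * (4 * M) ^ q * bwd (n * l) y < gc n q k * bwd k y})"
      have "open S" unfolding S_def
        by (intro open_INT ballI open_Collect_less continuous_intros continuous_bwd) auto
      moreover have "Kc * \<theta> ^ (q * n) * (4 * M) ^ q * bwd (n * l) y < gc n q k * bwd k y" if "l \<le> q" for l
        using neg that by (meson not_le)
      then have "y \<in> S" unfolding S_def by blast
      ultimately obtain v where v: "v \<in> S" "\<And>m. m \<ge> 1 \<Longrightarrow> (phi ^^ m) v \<noteq> v"
        using aperiodic_dense[of S] by blast
      obtain j where "j \<le> q" "gc n q k * bwd k v \<le> Kc * \<theta> ^ (q * n) * (4 * M) ^ q * bwd (n * j) v"
        using ap[OF n k v(2)] by blast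
      then show False using v(1) by (force simp: S_def)
    qed
  qed
qed

lemma bwd_nonneg [simp]: "0 \<le> bwd k y"
  by (simp add: bwd_def)

lemma bwd_phi_pow: "bwd k ((phi ^^ k) x) = cmod (P k x)"
  by (simp add: bwd_def)

text \<open>\<open>geom_bound\<close> is used at two scales. For a high power of a short geometric
  sum, the largest coefficient sits at an index ks independent of the point, and
  \<open>bwd ks y\<close> is exponentially smaller than \<open>bwd j y\<close> for some j \<le> N.
  Seen from c, the point ks steps before y, this is growth before c if j > ks and decay after c if j
  < ks, over an uncontrolled number of steps. One geometric sum of length L (\<open>quasi\<close>)
  then transfers either alternative to the common time L.\<close>

lemma one_sided_growth:
  assumes M: "M \<ge> 1" "\<And>g. g \<in> A \<Longrightarrow> nrm g \<le> M * nrm (\<lambda>x. w x * g (phi x) - g x)"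
  obtains L where "L \<ge> 1" "\<And>c. bwd L c \<ge> 2 \<or> cmod (P L c) \<le> 1/2"
proof -
  \<comment> \<open>64M = 16(4M): the factor (4M)^q pays for the lower bound, 2^q for \<theta>^N,
    and 8^q remains as the gain in \<rho>.\<close>
  define n where "n = nat \<lceil>64 * M\<rceil>"
  have n64: "real n \<ge> 64 * M" unfolding n_def by (rule real_nat_ceiling_ge)
  then have n: "n \<ge> 1" using M(1) by linarith
  define \<theta> where "\<theta> = root n 2"
  have \<theta>: "\<theta> > 1" "\<theta> ^ n = 2" using n by (auto simp: \<theta>_def)
  have \<theta>2: "\<theta> \<le> 2" using \<theta> n self_le_power[of \<theta> n] by auto
  obtain Kc where Kc: "Kc > 0" "\<And>n q y k. n \<ge> 1 \<Longrightarrow> k \<le> q * n \<Longrightarrow>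
     \<exists>l\<le>q. gc n q k * bwd k y \<le> Kc * \<theta> ^ (q * n) * (4 * M) ^ q * bwd (n * l) y"
    using geom_bound[OF M \<theta>(1)] by blast
  have lim1: "(\<lambda>q. Kc * (real q * real n + 1) * (1/8) ^ q) \<longlonglongrightarrow> 0" by real_asymp
  have lim2: "(\<lambda>q. Kc * (real q * real n + 1) * (Kc * 8 * M) * (1/4) ^ q) \<longlonglongrightarrow> 0" by real_asymp
  have "\<forall>\<^sub>F q in sequentially. Kc * (real q * real n + 1) * (1/8) ^ q < 1 \<and>
      Kc * (real q * real n + 1) * (Kc * 8 * M) * (1/4) ^ q < 1/2"
    using order_tendstoD(2)[OF lim1, of 1] order_tendstoD(2)[OF lim2, of "1/2"] by (auto elim: eventually_elim2)
  then obtain q where q: "Kc * (real q * real n + 1) * (1/8) ^ q < 1"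
      "Kc * (real q * real n + 1) * (Kc * 8 * M) * (1/4) ^ q < 1/2"
    by (auto simp: eventually_sequentially)
  define N where "N = q * n"
  \<comment> \<open>One more than N: the geometric sum of length L gives coefficient 1 to every k
    \<le> N, and L - d \<le> N whenever d \<ge> 1.\<close>
  define L where "L = Suc N"
  define \<rho> where "\<rho> = Kc * (real N + 1) * (1/8) ^ q"
  \<comment> \<open>The constant of \<open>quasi\<close>. It grows like 2^q only, so its product
    with \<rho> still decays, like q/4^q.\<close>
  define C2 where "C2 = Kc * 8 * M * 2 ^ q"
  have \<rho>: "0 < \<rho>" "\<rho> < 1"
    using Kc(1) q(1) unfolding \<rho>_def by (auto simp: N_def intro!: mult_pos_pos add_nonneg_pos)
  have C2: "0 < C2" using Kc(1) M(1) by (simp add: C2_def)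
  have \<rho>C2: "\<rho> * C2 < 1/2"
  proof -
    have "(1/4::real) ^ q = (1/8) ^ q * 2 ^ q" by (simp add: power_mult_distrib[symmetric])
    then have "\<rho> * C2 = Kc * (real q * real n + 1) * (Kc * 8 * M) * (1/4) ^ q"
      by (simp only: \<rho>_def C2_def N_def of_nat_mult mult_ac)
    then show ?thesis using q(2) by linarith
  qed
  have \<theta>N: "\<theta> ^ N = 2 ^ q" using \<theta>(2) by (simp add: N_def mult.commute[of q] power_mult)
  obtain ks where ks: "ks \<in> {..N}" "\<And>k. k \<in> {..N} \<Longrightarrow> gc n q k \<le> gc n q ks"
    by (rule finite_argmax[of "{..N}" "gc n q"]) auto
  have gcs: "real n ^ q \<le> (real N + 1) * gc n q ks"
    using sum_bounded_above[of "{..N}" "gc n q" "gc n q ks"] ks(2) sum_gc[of n q] by (simp add: N_def add.commute)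
  have mid: "\<exists>j\<le>N. bwd ks y \<le> \<rho> * bwd j y" for y
  proof -
    obtain l where l: "l \<le> q" "gc n q ks * bwd ks y \<le> Kc * \<theta> ^ (q * n) * (4 * M) ^ q * bwd (n * l) y"
      using Kc(2)[OF n, of ks q y] ks(1) by (auto simp: N_def)
    have "(16 * (4 * M)) ^ q * bwd ks y \<le> real n ^ q * bwd ks y"
      using n64 M(1) by (intro mult_right_mono power_mono) auto
    also have "\<dots> \<le> ((real N + 1) * gc n q ks) * bwd ks y"
      by (intro mult_right_mono gcs) simp
    also have "\<dots> \<le> (real N + 1) * (Kc * 2 ^ q * (4 * M) ^ q * bwd (n * l) y)"
      unfolding mult.assoc[of "real N + 1"]
      by (rule mult_left_mono) (use l(2) \<theta>N in \<open>simp_all add: N_def\<close>)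
    finally have *: "(16 * (4 * M)) ^ q * bwd ks y \<le> (real N + 1) * (Kc * 2 ^ q * (4 * M) ^ q * bwd (n * l) y)" .
    have "(16 * (4 * M)) ^ q * bwd ks y = (4 * M) ^ q * (16 ^ q * bwd ks y)"
      by (simp only: power_mult_distrib mult_ac)
    moreover have "(real N + 1) * (Kc * 2 ^ q * (4 * M) ^ q * bwd (n * l) y) =
        (4 * M) ^ q * ((real N + 1) * Kc * 2 ^ q * bwd (n * l) y)" by (simp only: mult_ac)
    ultimately have "(4 * M) ^ q * (16 ^ q * bwd ks y) \<le> (4 * M) ^ q * ((real N + 1) * Kc * 2 ^ q * bwd (n * l) y)"
      using * by argo
    then have "16 ^ q * bwd ks y \<le> (real N + 1) * Kc * 2 ^ q * bwd (n * l) y"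
      by (rule mult_left_le_imp_le) (use M(1) in simp)
    moreover have "(16::real) ^ q = 2 ^ q * 8 ^ q" by (simp add: power_mult_distrib[symmetric])
    ultimately have "2 ^ q * (8 ^ q * bwd ks y) \<le> 2 ^ q * ((real N + 1) * Kc * bwd (n * l) y)"
      by (simp add: mult_ac)
    then have "8 ^ q * bwd ks y \<le> (real N + 1) * Kc * bwd (n * l) y"
      by (rule mult_left_le_imp_le) simp
    then have "bwd ks y \<le> \<rho> * bwd (n * l) y"
      by (simp add: \<rho>_def power_divide field_simps)
    moreover have "n * l \<le> N" using l(1) by (simp add: N_def mult.commute)
    ultimately show ?thesis by blast
  qed
  have quasi: "bwd k y \<le> C2 \<or> bwd k y \<le> C2 * bwd L y" if k: "k \<le> N" for k y
  proof -
    obtain l where l: "l \<le> 1" "gc L 1 k * bwd k y \<le> Kc * \<theta> ^ (1 * L) * (4 * M) ^ 1 * bwd (L * l) y"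
      using Kc(2)[of L k 1 y] k by (auto simp: L_def)
    have "\<theta> ^ L = \<theta> * 2 ^ q" by (simp add: L_def \<theta>N)
    also have "\<dots> \<le> 2 * 2 ^ q" using \<theta>2 by simp
    finally have "Kc * \<theta> ^ L * (4 * M) \<le> Kc * (2 * 2 ^ q) * (4 * M)"
      using Kc(1) M(1) by (intro mult_right_mono mult_left_mono) auto
    then have "Kc * \<theta> ^ L * (4 * M) \<le> C2" by (simp add: C2_def)
    then have "Kc * \<theta> ^ L * (4 * M) * bwd (L * l) y \<le> C2 * bwd (L * l) y"
      by (rule mult_right_mono[OF _ bwd_nonneg])
    moreover have "gc L 1 k = 1" by (rule gc_1) (use k in \<open>simp add: L_def\<close>)
    then have "bwd k y \<le> Kc * \<theta> ^ L * (4 * M) * bwd (L * l) y" using l(2) by simp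
    ultimately have b: "bwd k y \<le> C2 * bwd (L * l) y" by linarith
    have "l = 0 \<or> l = 1" using l(1) by auto
    then show ?thesis using b by auto
  qed
  show thesis
  proof (rule that)
    show "L \<ge> 1" by (simp add: L_def)
    fix c
    define y where "y = (phi ^^ ks) c"
    obtain j where j: "j \<le> N" "bwd ks y \<le> \<rho> * bwd j y" using mid by blast
    consider "ks < j" | "j < ks" | "j = ks" by linarith
    then show "bwd L c \<ge> 2 \<or> cmod (P L c) \<le> 1/2"
    proof cases
      case 1
      have "bwd j y = bwd ks y * bwd (j - ks) c"
        using bwd_add[of ks "j - ks" y] 1 by (simp add: y_def)
      then have "bwd ks y * 1 \<le> bwd ks y * (\<rho> * bwd (j - ks) c)" using j(2) by (simp add: mult_ac)
      then have g: "1 \<le> \<rho> * bwd (j - ks) c" by (rule mult_left_le_imp_le) simp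
      have "bwd (j - ks) c \<le> C2 \<or> bwd (j - ks) c \<le> C2 * bwd L c" by (rule quasi) (use j in simp)
      then have "1 \<le> \<rho> * C2 \<or> 1 \<le> \<rho> * C2 * bwd L c"
        using g \<rho>(1) mult_left_mono[of "bwd (j - ks) c" _ \<rho>] by (smt (verit) mult.assoc)
      then have "1 \<le> \<rho> * C2 * bwd L c" using \<rho>C2 by linarith
      also have "\<dots> \<le> 1/2 * bwd L c" using \<rho>C2 by (intro mult_right_mono) auto
      finally show ?thesis by simp
    next
      case 2
      define d where "d = ks - j"
      have d: "1 \<le> d" "d \<le> N" using 2 ks(1) by (auto simp: d_def)
      have "(phi ^^ ks) c = (phi ^^ j) ((phi ^^ d) c)"
        using 2 funpow_add[of j d phi] by (simp add: d_def)
      then have "(psi ^^ j) y = (phi ^^ d) c" by (simp add: y_def)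
      then have "bwd ks y = bwd j y * cmod (P d c)"
        using bwd_add[of j d y] 2 bwd_phi_pow[of d c] by (simp add: d_def)
      then have "bwd j y * cmod (P d c) \<le> bwd j y * \<rho>" using j(2) by (simp add: mult_ac)
      then have s: "cmod (P d c) \<le> \<rho>" by (rule mult_left_le_imp_le) simp
      define y1 where "y1 = (phi ^^ L) c"
      have Ld: "L = (L - d) + d" using d by (simp add: L_def)
      have "(phi ^^ L) c = (phi ^^ (L - d)) ((phi ^^ d) c)"
        using Ld funpow_add[of "L - d" d phi] by simp
      then have "bwd (L - d) y1 = cmod (P (L - d) ((phi ^^ d) c))"
        using bwd_phi_pow[of "L - d" "(phi ^^ d) c"] by (simp add: y1_def)
      moreover have "cmod (P L c) = cmod (P d c) * cmod (P (L - d) ((phi ^^ d) c))"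
        using P_add[of d "L - d" c] Ld by (simp add: norm_mult)
      ultimately have e: "cmod (P L c) = cmod (P d c) * bwd (L - d) y1" by simp
      have "bwd (L - d) y1 \<le> C2 \<or> bwd (L - d) y1 \<le> C2 * cmod (P L c)"
        using quasi[of "L - d" y1] d bwd_phi_pow[of L c] by (simp add: L_def y1_def)
      then have "cmod (P L c) \<le> \<rho> * C2 \<or> cmod (P L c) \<le> \<rho> * (C2 * cmod (P L c))"
        unfolding e using s \<rho> C2 by (smt (verit) mult_mono bwd_pos norm_ge_zero e)
      moreover have "\<not> cmod (P L c) \<le> \<rho> * (C2 * cmod (P L c))"
      proof -
        have "\<rho> * C2 * cmod (P L c) < 1 * cmod (P L c)"
          using \<rho>C2 by (intro mult_strict_right_mono) auto
        then show ?thesis by (simp add: mult.assoc)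
      qed
      ultimately show ?thesis using \<rho>C2 by linarith
    next
      case 3
      then show ?thesis using j(2) \<rho> mult_strict_right_mono[of \<rho> 1 "bwd ks y"] by simp
    qed
  qed
qed

text \<open>
  A two-sidedly summable orbit would carry a nonzero finite measure annihilating the range of
  \<^term>\<open>\<lambda>g x. w x * g (phi x) - g x\<close>; the two telescoping sums below are its two halves.
\<close>

lemma no_summable_orbit:
  assumes surj: "\<And>f. f \<in> A \<Longrightarrow> \<exists>g\<in>A. (\<lambda>x. w x * g (phi x) - g x) = f"
    and fwd_sum: "summable (\<lambda>m. cmod (P m x))" and bwd_sum: "summable (\<lambda>m. 1 / bwd m x)"
  shows False
proof (cases "\<exists>p\<ge>1. (phi ^^ p) x = x")
  case True
  then obtain p where p: "p \<ge> 1" "(phi ^^ p) x = x" by blast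
  \<comment> \<open>On a periodic orbit the two series contain all powers of a positive number and
    of its inverse, which cannot both tend to 0.\<close>
  have per: "(phi ^^ (p * m)) x = x" for m
    by (induction m) (simp_all add: p funpow_add)
  have pow: "P (p * m) x = P p x ^ m" for m
  proof (induction m)
    case (Suc m)
    then show ?case using P_add[of "p * m" p x] per[of m] by (simp add: add.commute)
  qed simp
  have perb: "(psi ^^ (p * m)) x = x" for m
    using psi_pow_phi_pow[of "p * m" x] per[of m] by simp
  have sub: "strict_mono (\<lambda>m. p * m)" using p by (simp add: strict_mono_def)
  have "(\<lambda>m. cmod (P (p * m) x)) \<longlonglongrightarrow> 0"
    using LIMSEQ_subseq_LIMSEQ[OF summable_LIMSEQ_zero[OF fwd_sum] sub] by (simp add: comp_def)
  then have "(\<lambda>m. cmod (P p x) ^ m) \<longlonglongrightarrow> 0" by (simp add: pow norm_power)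
  moreover have "(\<lambda>m. 1 / bwd (p * m) x) \<longlonglongrightarrow> 0"
    using LIMSEQ_subseq_LIMSEQ[OF summable_LIMSEQ_zero[OF bwd_sum] sub] by (simp add: comp_def)
  then have "(\<lambda>m. 1 / cmod (P p x) ^ m) \<longlonglongrightarrow> 0" by (simp add: bwd_def perb pow norm_power)
  ultimately have "(\<lambda>m. cmod (P p x) ^ m * (1 / cmod (P p x) ^ m)) \<longlonglongrightarrow> 0 * 0" by (rule tendsto_mult)
  then have "(\<lambda>m::nat. 1::real) \<longlonglongrightarrow> 0" by simp
  then show False by (simp add: LIMSEQ_const_iff)
next
  case False
  define al where "al m = cmod (P (Suc m) x)" for m
  define be where "be m = 1 / bwd (Suc m) x" for m
  have al: "summable al" unfolding al_def using fwd_sum by (subst summable_Suc_iff)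
  have be: "summable be" unfolding be_def using bwd_sum by (subst summable_Suc_iff)
  have nn: "al m \<ge> 0" "be m \<ge> 0" for m by (simp_all add: al_def be_def)
  have ab: "summable (\<lambda>m. al m + be m)" by (rule summable_add[OF al be])
  define S where "S = (\<Sum>m. al m + be m)"
  have S: "S \<ge> 0" unfolding S_def by (rule suminf_nonneg[OF ab]) (use nn in auto)
  have "(\<lambda>m0. S - (\<Sum>m<m0. al m + be m)) \<longlonglongrightarrow> S - S"
    unfolding S_def by (intro tendsto_intros summable_LIMSEQ[OF ab])
  then have "\<forall>\<^sub>F m0 in sequentially. S - (\<Sum>m<m0. al m + be m) < 1/8"
    by (auto dest!: order_tendstoD(2)[of _ _ _ "1/8"])
  then obtain m0 where m0: "S - (\<Sum>m<m0. al m + be m) < 1/8" by (auto simp: eventually_sequentially)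
  \<comment> \<open>g will be 1 at x, at most \<eta> on the finitely many orbit points
    \<open>Z\<close> that carry almost all weight, and at most 2 on the rest, of weight below 1/8.
    Its pairing with the orbit measure then stays within 1/2 of 1, whereas telescoping makes it
    0.\<close>
  define \<eta> where "\<eta> = 1 / (4 * (S + 1))"
  have \<eta>: "\<eta> > 0" "\<eta> * S \<le> 1/4" using S by (auto simp: \<eta>_def divide_simps)
  define Z where "Z = (\<lambda>m. (phi ^^ Suc m) x) ` {..<m0} \<union> (\<lambda>m. (psi ^^ Suc m) x) ` {..<m0}"
  have nper: "(phi ^^ Suc m) x \<noteq> x" for m using False by auto
  moreover have "(psi ^^ Suc m) x \<noteq> x" for m
    using nper[of m] phi_pow_psi_pow[of "Suc m" x] by metis
  ultimately have xZ: "x \<in> - Z" unfolding Z_def by (metis (no_types, lifting) ComplI UnE imageE)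
  have "open (- Z)" by (intro open_Compl finite_imp_closed) (simp add: Z_def)
  then obtain g where g: "g \<in> A" "g x = 1" "\<And>v. cmod (g v) \<le> 2" "\<And>v. v \<in> Z \<Longrightarrow> cmod (g v) \<le> \<eta>"
    using peak[OF _ xZ \<eta>(1)] by auto
  obtain f where f: "f \<in> A" "\<And>v. w v * f (phi v) - f v = g v"
    using surj[OF g(1)] by (auto simp: fun_eq_iff)
  have fwd_tel: "(\<Sum>m<k. P m x * g ((phi ^^ m) x)) = P k x * f ((phi ^^ k) x) - f x" for k
  proof (induction k)
    case (Suc k)
    have "g ((phi ^^ k) x) = w ((phi ^^ k) x) * f ((phi ^^ Suc k) x) - f ((phi ^^ k) x)"
      using f(2)[of "(phi ^^ k) x"] by simp
    then have "P k x * g ((phi ^^ k) x) = P (Suc k) x * f ((phi ^^ Suc k) x) - P k x * f ((phi ^^ k) x)"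
      by (simp add: P_Suc right_diff_distrib)
    then show ?case using Suc by simp
  qed simp
  have bwd_tel: "(\<Sum>m<k. g ((psi ^^ Suc m) x) / P (Suc m) ((psi ^^ Suc m) x)) =
      f x - f ((psi ^^ k) x) / P k ((psi ^^ k) x)" for k
  proof (induction k)
    case (Suc k)
    let ?v = "(psi ^^ Suc k) x"
    have v: "phi ?v = (psi ^^ k) x" by simp
    have "g ?v = w ?v * f ((psi ^^ k) x) - f ?v" using f(2)[of ?v] unfolding v by simp
    moreover have "P (Suc k) ?v = w ?v * P k ((psi ^^ k) x)" unfolding P_Suc' v ..
    ultimately have "g ?v / P (Suc k) ?v = f ((psi ^^ k) x) / P k ((psi ^^ k) x) - f ?v / P (Suc k) ?v"
      by (simp add: diff_divide_distrib)
    then show ?case using Suc by simp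
  qed simp
  define tm where "tm m = P (Suc m) x * g ((phi ^^ Suc m) x) + g ((psi ^^ Suc m) x) / P (Suc m) ((psi ^^ Suc m) x)" for m
  have fb: "cmod (f v) \<le> nrm f" for v by (rule cmod_le_nrm[OF f(1)])
  have tot: "1 + (\<Sum>m<k. tm m) = P (Suc k) x * f ((phi ^^ Suc k) x) - f ((psi ^^ k) x) / P k ((psi ^^ k) x)" for k
  proof -
    have "(\<Sum>m<Suc k. P m x * g ((phi ^^ m) x)) = 1 + (\<Sum>m<k. P (Suc m) x * g ((phi ^^ Suc m) x))"
      using g(2) by (simp add: sum.lessThan_Suc_shift del: sum.lessThan_Suc)
    then have "1 + (\<Sum>m<k. P (Suc m) x * g ((phi ^^ Suc m) x)) = P (Suc k) x * f ((phi ^^ Suc k) x) - f x"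
      using fwd_tel[of "Suc k"] by simp
    moreover have "(\<Sum>m<k. tm m) = (\<Sum>m<k. P (Suc m) x * g ((phi ^^ Suc m) x)) +
        (f x - f ((psi ^^ k) x) / P k ((psi ^^ k) x))"
      unfolding bwd_tel[symmetric] tm_def by (rule sum.distrib)
    ultimately show ?thesis by (simp add: algebra_simps)
  qed
  have "(\<lambda>k. 1 + (\<Sum>m<k. tm m)) \<longlonglongrightarrow> 0"
  proof (rule Lim_null_comparison)
    show "\<forall>\<^sub>F k in sequentially. norm (1 + (\<Sum>m<k. tm m)) \<le> (cmod (P (Suc k) x) + 1 / bwd k x) * nrm f"
    proof (intro always_eventually allI)
      fix k
      have "norm (1 + (\<Sum>m<k. tm m)) \<le> cmod (P (Suc k) x) * cmod (f ((phi ^^ Suc k) x)) +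
          1 / bwd k x * cmod (f ((psi ^^ k) x))"
        unfolding tot using norm_triangle_ineq4[of "P (Suc k) x * f ((phi ^^ Suc k) x)" "f ((psi ^^ k) x) / P k ((psi ^^ k) x)"]
        by (simp add: norm_mult norm_divide bwd_def)
      also have "\<dots> \<le> cmod (P (Suc k) x) * nrm f + 1 / bwd k x * nrm f"
        by (intro add_mono mult_left_mono fb) auto
      finally show "norm (1 + (\<Sum>m<k. tm m)) \<le> (cmod (P (Suc k) x) + 1 / bwd k x) * nrm f"
        by (simp add: algebra_simps)
    qed
    have "(\<lambda>k. (al k + 1 / bwd k x) * nrm f) \<longlonglongrightarrow> (0 + 0) * nrm f"
      by (intro tendsto_intros summable_LIMSEQ_zero al bwd_sum)
    then show "(\<lambda>k. (cmod (P (Suc k) x) + 1 / bwd k x) * nrm f) \<longlonglongrightarrow> 0" by (simp add: al_def)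
  qed
  moreover have "norm (\<Sum>m<k. tm m) \<le> 1/2" for k
  proof -
    have gm: "cmod (tm m) \<le> (if m < m0 then \<eta> else 2) * (al m + be m)" for m
    proof -
      define b where "b = (if m < m0 then \<eta> else 2)"
      have gb: "cmod (g ((phi ^^ Suc m) x)) \<le> b" "cmod (g ((psi ^^ Suc m) x)) \<le> b"
        using g(3,4) by (auto simp: b_def Z_def simp del: funpow.simps)
      have "cmod (tm m) \<le> al m * cmod (g ((phi ^^ Suc m) x)) + be m * cmod (g ((psi ^^ Suc m) x))"
        unfolding tm_def al_def be_def bwd_def
        by (rule order_trans[OF norm_triangle_ineq]) (simp add: norm_mult norm_divide)
      also have "\<dots> \<le> al m * b + be m * b" by (intro add_mono mult_left_mono gb nn)
      finally show ?thesis by (simp add: b_def algebra_simps)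
    qed
    have "norm (\<Sum>m<k. tm m) \<le> (\<Sum>m<k. (if m < m0 then \<eta> else 2) * (al m + be m))"
      by (rule order_trans[OF norm_sum sum_mono]) (rule gm)
    also have "\<dots> \<le> (\<Sum>m<k + m0. (if m < m0 then \<eta> else 2) * (al m + be m))"
      by (rule sum_mono2) (use \<eta> nn in \<open>auto intro!: mult_nonneg_nonneg add_nonneg_nonneg simp: less_imp_le\<close>)
    also have "\<dots> \<le> (\<Sum>m<k + m0. \<eta> * (al m + be m) + 2 * (if m < m0 then 0 else al m + be m))"
      by (rule sum_mono) (use \<eta> nn in \<open>auto intro!: add_nonneg_nonneg simp: less_imp_le\<close>)
    also have "\<dots> = \<eta> * (\<Sum>m<k + m0. al m + be m) + 2 * (\<Sum>m<k + m0. if m < m0 then 0 else al m + be m)"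
      unfolding sum_distrib_left by (rule sum.distrib)
    also have "(\<Sum>m<k + m0. if m < m0 then 0 else al m + be m) = (\<Sum>m<k + m0. al m + be m) - (\<Sum>m<m0. al m + be m)"
    proof -
      have "(\<Sum>m<k + m0. if m < m0 then 0 else al m + be m) = (\<Sum>m\<in>{..<k + m0} - {..<m0}. al m + be m)"
        by (rule sum.mono_neutral_cong_right) auto
      also have "\<dots> = (\<Sum>m<k + m0. al m + be m) - (\<Sum>m<m0. al m + be m)"
        by (rule sum_diff) auto
      finally show ?thesis .
    qed
    finally have "norm (\<Sum>m<k. tm m) \<le> \<eta> * (\<Sum>m<k + m0. al m + be m) +
        2 * ((\<Sum>m<k + m0. al m + be m) - (\<Sum>m<m0. al m + be m))" .
    moreover have T: "(\<Sum>m<k + m0. al m + be m) \<le> S" unfolding S_def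
      by (rule sum_le_suminf[OF ab]) (use nn in auto)
    moreover have "\<eta> * (\<Sum>m<k + m0. al m + be m) \<le> \<eta> * S"
      by (rule mult_left_mono[OF T]) (use \<eta>(1) in simp)
    ultimately have "norm (\<Sum>m<k. tm m) \<le> \<eta> * S + 2 * (S - (\<Sum>m<m0. al m + be m))" by argo
    also have "\<dots> \<le> 1/4 + 2 * (1/8)" using \<eta>(2) m0 by (intro add_mono mult_left_mono) auto
    finally show ?thesis by simp
  qed
  then have "1/2 \<le> norm (1 + (\<Sum>m<k. tm m))" for k
  proof -
    have "norm (1::complex) \<le> norm (1 + (\<Sum>m<k. tm m)) + norm (\<Sum>m<k. tm m)"
      using norm_triangle_ineq4[of "1 + (\<Sum>m<k. tm m)" "\<Sum>m<k. tm m"] by simp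
    then show ?thesis using \<open>\<And>k. norm (\<Sum>m<k. tm m) \<le> 1/2\<close>[of k] by simp
  qed
  ultimately have "(1/2::real) \<le> norm (0::complex)"
    by (intro tendsto_lowerbound[OF tendsto_norm]) auto
  then show False by simp
qed

text \<open>Call c contracting if \<open>cmod (P L c) \<le> 1/2\<close>, expanding if
  \<open>bwd L c \<ge> 2\<close>; every point is one of the two. Contracting points stay so under
  phi^L and have summable forward weights, expanding points stay so under psi^L and have summable
  inverse backward weights. Each summability is constant along orbits and the two exclude each
  other, so F is invariant under phi itself and not merely under phi^L.\<close>

theorem dichotomy:
  assumes M: "M \<ge> 1" "\<And>g. g \<in> A \<Longrightarrow> nrm g \<le> M * nrm (\<lambda>x. w x * g (phi x) - g x)"
    and surj: "\<And>f. f \<in> A \<Longrightarrow> \<exists>g\<in>A. (\<lambda>x. w x * g (phi x) - g x) = f"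
  obtains L F where "L \<ge> 1" "closed F" "closed (- F)" "\<And>x. phi x \<in> F \<longleftrightarrow> x \<in> F"
    "\<And>x. x \<in> F \<Longrightarrow> cmod (P L x) \<le> 1/2" "\<And>x. x \<notin> F \<Longrightarrow> cmod (P L x) \<ge> 2"
proof -
  obtain L where L: "L \<ge> 1" "\<And>c. bwd L c \<ge> 2 \<or> cmod (P L c) \<le> 1/2"
    using one_sided_growth[OF M] by blast
  define F where "F = {c. cmod (P L c) \<le> 1/2}"
  have F_step: "(phi ^^ L) c \<in> F" if "c \<in> F" for c
    using L(2)[of "(phi ^^ L) c"] that by (auto simp: F_def bwd_phi_pow)
  have E_step: "bwd L ((psi ^^ L) c) \<ge> 2" if "bwd L c \<ge> 2" for c
    using L(2)[of "(psi ^^ L) c"] that by (auto simp: bwd_def)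
  have F_sum: "summable (\<lambda>m. cmod (P m c))" if c: "c \<in> F" for c
  proof (rule summable_blocks[OF L(1)])
    have Fj: "(phi ^^ (L * j)) c \<in> F \<and> cmod (P (L * j) c) \<le> (1/2) ^ j" for j
    proof (induction j)
      case (Suc j)
      have "(phi ^^ (L * Suc j)) c = (phi ^^ L) ((phi ^^ (L * j)) c)" by (simp add: funpow_add)
      moreover have "cmod (P (L * Suc j) c) \<le> (1/2) ^ j * (1/2)"
        using P_add[of "L * j" L c] Suc mult_mono[of "cmod (P (L * j) c)" "(1/2) ^ j" "cmod (P L ((phi ^^ (L * j)) c))" "1/2"]
        by (simp add: norm_mult F_def add.commute)
      ultimately show ?case using Suc F_step by simp
    qed (use c in simp)
    show "cmod (P m c) \<le> omega ^ L * (1/2) ^ (m div L)" for m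
    proof -
      have "P m c = P (L * (m div L)) c * P (m mod L) ((phi ^^ (L * (m div L))) c)"
        using P_add[of "L * (m div L)" "m mod L" c] by simp
      then have "cmod (P m c) = cmod (P (L * (m div L)) c) * cmod (P (m mod L) ((phi ^^ (L * (m div L))) c))"
        by (simp add: norm_mult)
      also have "\<dots> \<le> (1/2) ^ (m div L) * omega ^ L"
      proof (intro mult_mono)
        have "cmod (P (m mod L) ((phi ^^ (L * (m div L))) c)) \<le> omega ^ (m mod L)" by (rule P_le)
        also have "\<dots> \<le> omega ^ L" using L(1) omega(1) by (intro power_increasing) auto
        finally show "cmod (P (m mod L) ((phi ^^ (L * (m div L))) c)) \<le> omega ^ L" .
      qed (use Fj in auto)
      finally show ?thesis by (simp add: mult.commute)
    qed
  qed simp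
  have E_sum: "summable (\<lambda>m. 1 / bwd m c)" if c: "bwd L c \<ge> 2" for c
  proof (rule summable_blocks[OF L(1)])
    have Ej: "bwd L ((psi ^^ (L * j)) c) \<ge> 2 \<and> bwd (L * j) c \<ge> 2 ^ j" for j
    proof (induction j)
      case (Suc j)
      have "(psi ^^ (L * Suc j)) c = (psi ^^ L) ((psi ^^ (L * j)) c)" by (simp add: funpow_add)
      moreover have "bwd (L * Suc j) c \<ge> 2 ^ j * 2"
        using bwd_add[of "L * j" L c] Suc mult_mono[of "2 ^ j" "bwd (L * j) c" 2 "bwd L ((psi ^^ (L * j)) c)"]
        by (simp add: add.commute less_imp_le)
      ultimately show ?case using Suc E_step by simp
    qed (use c in simp)
    show "0 \<le> 1 / bwd m c" for m by simp
    show "1 / bwd m c \<le> omega ^ L * (1/2) ^ (m div L)" for m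
    proof -
      have "bwd m c = bwd (L * (m div L)) c * bwd (m mod L) ((psi ^^ (L * (m div L))) c)"
        using bwd_add[of "L * (m div L)" "m mod L" c] by simp
      then have "1 / bwd m c = 1 / bwd (L * (m div L)) c * (1 / bwd (m mod L) ((psi ^^ (L * (m div L))) c))"
        by simp
      also have "\<dots> \<le> (1/2) ^ (m div L) * omega ^ L"
      proof (intro mult_mono)
        show "1 / bwd (L * (m div L)) c \<le> (1/2) ^ (m div L)"
          using Ej[of "m div L"] by (simp add: power_divide divide_simps)
        have "1 / bwd (m mod L) ((psi ^^ (L * (m div L))) c) \<le> omega ^ (m mod L)"
          unfolding bwd_def by (rule P_ge)
        also have "\<dots> \<le> omega ^ L" using L(1) omega(1) by (intro power_increasing) auto
        finally show "1 / bwd (m mod L) ((psi ^^ (L * (m div L))) c) \<le> omega ^ L" .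
      qed auto
      finally show ?thesis by (simp add: mult.commute)
    qed
  qed
  have shiftF: "summable (\<lambda>m. cmod (P m (phi c))) \<longleftrightarrow> summable (\<lambda>m. cmod (P m c))" for c
  proof -
    have "summable (\<lambda>m. cmod (P m c)) \<longleftrightarrow> summable (\<lambda>m. cmod (w c) * cmod (P m (phi c)))"
      using summable_Suc_iff[of "\<lambda>m. cmod (P m c)"] by (simp add: P_Suc' norm_mult)
    then show ?thesis by (simp add: summable_cmult_iff)
  qed
  have shiftE: "summable (\<lambda>m. 1 / bwd m (phi c)) \<longleftrightarrow> summable (\<lambda>m. 1 / bwd m c)" for c
  proof -
    define b where "b = bwd 1 (phi c)"
    have "bwd (Suc m) (phi c) = b * bwd m c" for m
      using bwd_add[of 1 m "phi c"] by (simp add: b_def)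
    then have e: "(\<lambda>m. 1 / bwd (Suc m) (phi c)) = (\<lambda>m. (1 / b) * (1 / bwd m c))"
      by simp
    have nz: "1 / b \<noteq> 0" using bwd_pos[of 1 "phi c"] unfolding b_def by (metis divide_eq_0_iff less_irrefl zero_neq_one)
    show ?thesis
      using summable_Suc_iff[of "\<lambda>m. 1 / bwd m (phi c)"] unfolding e summable_cmult_iff using nz by simp
  qed
  have excl: False if "summable (\<lambda>m. cmod (P m c))" "summable (\<lambda>m. 1 / bwd m c)" for c
    using no_summable_orbit[OF surj that] by blast
  have inv: "phi c \<in> F \<longleftrightarrow> c \<in> F" for c
  proof -
    have "c \<in> F \<and> phi c \<notin> F \<Longrightarrow> False"
      using L(2)[of "phi c"] F_sum[of c] E_sum[of "phi c"] shiftE[of c] excl[of c] by (auto simp: F_def)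
    moreover have "c \<notin> F \<and> phi c \<in> F \<Longrightarrow> False"
      using L(2)[of c] F_sum[of "phi c"] E_sum[of c] shiftF[of c] excl[of c] by (auto simp: F_def)
    ultimately show ?thesis by blast
  qed
  have invn: "(phi ^^ k) c \<in> F \<longleftrightarrow> c \<in> F" for k c by (induction k) (simp_all add: inv)
  have big: "cmod (P L c) \<ge> 2" if "c \<notin> F" for c
    using L(2)[of "(phi ^^ L) c"] invn[of L c] that by (auto simp: F_def bwd_phi_pow)
  have cont: "continuous_on UNIV (\<lambda>c. cmod (P L c))" by (intro continuous_on_norm continuous P_closed)
  have "closed F" unfolding F_def by (intro closed_Collect_le cont continuous_intros)
  moreover have "- F = {c. 2 \<le> cmod (P L c)}" using big by (auto simp: F_def)
  then have "closed (- F)" by (simp add: closed_Collect_le[OF continuous_on_const cont])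
  ultimately show thesis using that[OF L(1) _ _ inv _ big] by (auto simp: F_def)
qed

end

section \<open>The spectral idempotent and the inverse\<close>

context leibniz_algebra
begin

lemma nrm_mult_sup:
  assumes f: "f \<in> A" "\<And>x. cmod (f x) \<le> a" and g: "g \<in> A" "\<And>x. cmod (g x) \<le> b"
  shows "nrm (\<lambda>x. f x * g x) \<le> C * (nrm f * b + nrm g * a)"
proof -
  define fs where "fs j = (if j = 0 then f else g)" for j :: nat
  have s: "{..<2} - {j} = {if j = 0 then 1 else 0}" if "j < 2" for j :: nat using that by auto
  have "nrm (\<lambda>x. \<Prod>j<2. fs j x) \<le> C * (\<Sum>j<2. nrm (fs j) * (if j = 0 then b else a))"
  proof (rule leibniz)
    fix j :: nat and x assume "j < 2"
    then show "cmod (\<Prod>k\<in>{..<2} - {j}. fs k x) \<le> (if j = 0 then b else a)"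
      unfolding s[OF \<open>j < 2\<close>] using f g by (auto simp: fs_def)
  qed (use f g in \<open>auto simp: fs_def\<close>)
  then show ?thesis by (simp add: fs_def numeral_2_eq_2)
qed

lemma nrm_mult:
  assumes "f \<in> A" "g \<in> A"
  shows "nrm (\<lambda>x. f x * g x) \<le> 2 * C * nrm f * nrm g"
  using nrm_mult_sup[OF assms(1) cmod_le_nrm[OF assms(1)] assms(2) cmod_le_nrm[OF assms(2)]]
  by (simp add: mult_ac)

text \<open>
  The cubic \<open>3 t\<^sup>2 - 2 t\<^sup>3\<close> attracts quadratically to 0 and 1; the Leibniz inequality turns the
  uniform decay of the defect \<open>t\<^sup>2 - t\<close> into decay in the algebra norm.
\<close>

lemma idempotent_closed:
  fixes F :: "'m set"
  assumes approx: "\<And>\<delta>. \<delta> > 0 \<Longrightarrow> \<exists>f\<in>A. \<forall>x. cmod (f x - indicator F x) \<le> \<delta>"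
  shows "indicator F \<in> A"
proof -
  \<comment> \<open>Small enough that the defect bound s = 2\<delta> has C s = 1/100; one step then
    shrinks the norm of the defect by the factor 18/100, below 1/4.\<close>
  define \<delta> where "\<delta> = 1 / (200 * C)"
  have \<delta>: "0 < \<delta>" "\<delta> \<le> 1/200" "C * \<delta> = 1/200" using C by (auto simp: \<delta>_def divide_simps)
  obtain f0 where f0: "f0 \<in> A" "\<And>x. cmod (f0 x - indicator F x) \<le> \<delta>" using approx[OF \<delta>(1)] by blast
  define f where "f = rec_nat f0 (\<lambda>_ g x. 3 * g x ^ 2 - 2 * g x ^ 3)"
  have f_0: "f 0 = f0" and f_Suc: "f (Suc k) = (\<lambda>x. 3 * f k x ^ 2 - 2 * f k x ^ 3)" for k by (simp_all add: f_def)
  have fA: "f k \<in> A" for k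
    by (induction k) (auto simp: f_0 f_Suc intro!: f0 diff cmult power_closed)
  have near: "cmod (f k x - indicator F x) \<le> \<delta>" for k x
  proof (induction k)
    case (Suc k)
    define u where "u = f k x - indicator F x"
    have u: "cmod u \<le> \<delta>" using Suc by (simp add: u_def)
    have "f (Suc k) x - indicator F x = u\<^sup>2 * (if x \<in> F then - (2 * u + 3) else 3 - 2 * u)"
      by (auto simp: f_Suc u_def power2_eq_square power3_eq_cube algebra_simps)
    then have "cmod (f (Suc k) x - indicator F x) = cmod u ^ 2 * cmod (if x \<in> F then - (2 * u + 3) else 3 - 2 * u)"
      by (simp add: norm_mult norm_power)
    also have "\<dots> \<le> \<delta>\<^sup>2 * 5"
    proof (intro mult_mono power_mono u)
      have "cmod (2 * u + 3) \<le> 2 * cmod u + 3" "cmod (3 - 2 * u) \<le> 3 + 2 * cmod u"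
        using norm_triangle_ineq[of "2 * u" 3] norm_triangle_ineq4[of 3 "2 * u"] by (simp_all add: norm_mult)
      then show "cmod (if x \<in> F then - (2 * u + 3) else 3 - 2 * u) \<le> 5"
        unfolding norm_minus_cancel if_distrib[of cmod] using u \<delta> by auto
    qed auto
    also have "\<dots> \<le> \<delta>" using \<delta> by (simp add: power2_eq_square)
    finally show ?case .
  qed (simp add: f_0 f0)
  \<comment> \<open>The defect obeys a closed recursion without linear term (\<open>e_Suc\<close>),
    and the increments of f are multiples of it (\<open>f_diff\<close>); so decay is proved for e
    and transferred.\<close>
  define e where "e k = (\<lambda>x. f k x ^ 2 - f k x)" for k
  have eA: "e k \<in> A" for k unfolding e_def by (intro diff power_closed fA)
  have e_Suc: "e (Suc k) x = 4 * e k x ^ 3 - 3 * e k x ^ 2" for k x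
    by (simp add: e_def f_Suc power2_eq_square power3_eq_cube algebra_simps)
  have f_diff: "f (Suc k) x - f k x = (1 - 2 * f k x) * e k x" for k x
    by (simp add: e_def f_Suc power2_eq_square power3_eq_cube algebra_simps)
  define s where "s = 2 * \<delta>"
  have s: "0 < s" "s \<le> 1/100" "C * s = 1/100" using \<delta> by (auto simp: s_def)
  have fb: "cmod (f k x) \<le> 1 + \<delta>" for k x
    using norm_triangle_ineq2[of "f k x" "indicator F x"] near[of k x] by (cases "x \<in> F") auto
  have e0: "cmod (e 0 x) \<le> s" for x
  proof -
    have "e 0 x = f 0 x * (f 0 x - 1)" by (simp add: e_def power2_eq_square algebra_simps)
    then have ee: "cmod (e 0 x) = cmod (f 0 x) * cmod (f 0 x - 1)" by (simp add: norm_mult)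
    show ?thesis
    proof (cases "x \<in> F")
      case True
      then show ?thesis using mult_mono[of "cmod (f 0 x)" 2 "cmod (f 0 x - 1)" \<delta>] near[of 0 x] fb[of 0 x] \<delta>
        unfolding ee by (simp add: s_def)
    next
      case False
      then have "cmod (f 0 x) \<le> \<delta>" using near[of 0 x] by simp
      moreover have "cmod (f 0 x - 1) \<le> 2" using norm_triangle_ineq4[of "f 0 x" 1] fb[of 0 x] calculation \<delta> by simp
      ultimately show ?thesis using mult_mono[of "cmod (f 0 x)" \<delta> "cmod (f 0 x - 1)" 2] \<delta>
        unfolding ee by (simp add: s_def)
    qed
  qed
  have s4: "s * (1/4) ^ k \<le> s" for k
    using mult_left_mono[OF power_le_one[of "1/4::real" k], of s] s by simp
  have es: "cmod (e k x) \<le> s * (1/4) ^ k" for k x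
  proof (induction k)
    case (Suc k)
    have le: "cmod (e k x) \<le> s" using Suc s4[of k] by linarith
    have "cmod (e (Suc k) x) \<le> 4 * cmod (e k x) ^ 3 + 3 * cmod (e k x) ^ 2"
      unfolding e_Suc using norm_triangle_ineq4[of "4 * e k x ^ 3" "3 * e k x ^ 2"] by (simp add: norm_mult norm_power)
    also have "\<dots> = cmod (e k x) * (cmod (e k x) * (4 * cmod (e k x) + 3))"
      by (simp add: power2_eq_square power3_eq_cube algebra_simps)
    also have "\<dots> \<le> cmod (e k x) * (1/100 * 5)"
      using le s by (intro mult_left_mono mult_mono) auto
    also have "\<dots> \<le> s * (1/4) ^ k * (1/4)" using Suc norm_ge_zero[of "e k x"] by linarith
    finally show ?case by simp
  qed (simp add: e0)
  have es': "cmod (e k x) \<le> s" for k x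
    using es[of k x] s4[of k] by linarith
  define E where "E = nrm (e 0)"
  have E: "nrm (e k) \<le> E * (1/4) ^ k" for k
  proof (induction k)
    case (Suc k)
    have p3: "nrm (\<lambda>x. e k x ^ 3) \<le> C * 3 * nrm (e k) * s\<^sup>2"
      using nrm_power[OF eA es', of 3 k] by simp
    have p2: "nrm (\<lambda>x. e k x ^ 2) \<le> C * 2 * nrm (e k) * s"
      using nrm_power[OF eA es', of 2 k] by simp
    have "nrm (e (Suc k)) = nrm (\<lambda>x. 4 * e k x ^ 3 - 3 * e k x ^ 2)"
      by (rule arg_cong[of _ _ nrm]) (auto simp: e_Suc)
    also have "\<dots> \<le> nrm (\<lambda>x. 4 * e k x ^ 3) + nrm (\<lambda>x. 3 * e k x ^ 2)"
      by (intro nrm_diff cmult power_closed eA)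
    also have "\<dots> = 4 * nrm (\<lambda>x. e k x ^ 3) + 3 * nrm (\<lambda>x. e k x ^ 2)"
      using nrm_cmult[OF power_closed[OF eA], of 4] nrm_cmult[OF power_closed[OF eA], of 3] by simp
    also have "\<dots> \<le> 4 * (C * 3 * nrm (e k) * s\<^sup>2) + 3 * (C * 2 * nrm (e k) * s)"
      using p2 p3 by linarith
    also have "\<dots> = (C * s) * nrm (e k) * (12 * s + 6)" by (simp add: power2_eq_square algebra_simps)
    also have "\<dots> \<le> (C * s) * nrm (e k) * 18"
      using s C eA by (intro mult_left_mono) auto
    also have "\<dots> \<le> 1/4 * nrm (e k)" unfolding s(3) using nrm_nonneg[OF eA[of k]] by simp
    also have "\<dots> \<le> 1/4 * (E * (1/4) ^ k)" using Suc by simp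
    finally show ?case by simp
  qed (simp add: E_def)
  have E0: "E \<ge> 0" unfolding E_def by (rule nrm_nonneg[OF eA])
  define n1 where "n1 = nrm (\<lambda>x. 1)"
  have n1: "n1 \<ge> 0" unfolding n1_def by (rule nrm_nonneg) simp
  have step: "nrm (\<lambda>x. f (Suc k) x - f k x) \<le> C * ((n1 + 2 * nrm (f k)) * (s * (1/4) ^ k) + E * (1/4) ^ k * 4)" for k
  proof -
    have gA: "(\<lambda>x. 1 - 2 * f k x) \<in> A" by (intro diff cmult fA const)
    have gn: "nrm (\<lambda>x. 1 - 2 * f k x) \<le> n1 + 2 * nrm (f k)"
      unfolding n1_def using nrm_diff[OF const cmult[OF fA], of 1 2 k] nrm_cmult[OF fA, of 2 k] by simp
    have gs: "cmod (1 - 2 * f k x) \<le> 4" for x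
      using norm_triangle_ineq4[of 1 "2 * f k x"] fb[of k x] \<delta> by (simp add: norm_mult)
    have "nrm (\<lambda>x. (1 - 2 * f k x) * e k x) \<le> C * (nrm (\<lambda>x. 1 - 2 * f k x) * (s * (1/4) ^ k) + nrm (e k) * 4)"
      by (rule nrm_mult_sup[OF gA gs eA es])
    also have "\<dots> \<le> C * ((n1 + 2 * nrm (f k)) * (s * (1/4) ^ k) + E * (1/4) ^ k * 4)"
      using gn E[of k] C s by (intro mult_left_mono add_mono mult_right_mono) auto
    finally show ?thesis by (simp add: f_diff)
  qed
  \<comment> \<open>A crude doubling bound on \<open>nrm (f k)\<close> is enough, because the
    increments carry the factor (1/4)^k.\<close>
  define B where "B = nrm (f 0) + 2 * C * (n1 * s + 4 * E)"
  have B0: "B \<ge> 0" "nrm (f 0) \<le> B" "2 * C * (n1 * s + 4 * E) \<le> B"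
    using n1 E0 s C fA by (auto simp: B_def intro!: add_nonneg_nonneg mult_nonneg_nonneg)
  have fk: "nrm (f k) \<le> B * 2 ^ k" for k
  proof (induction k)
    case (Suc k)
    have q: "(1/4::real) ^ k \<le> 1" by (simp add: power_le_one)
    have "nrm (f (Suc k)) \<le> nrm (\<lambda>x. f (Suc k) x - f k x) + nrm (f k)"
      using nrm_add[OF diff[OF fA fA] fA, of "Suc k" k k] by simp
    also have "nrm (\<lambda>x. f (Suc k) x - f k x) \<le> C * ((n1 + 2 * nrm (f k)) * (s * 1) + E * 1 * 4)"
      by (rule order_trans[OF step], intro mult_left_mono add_mono mult_right_mono q)
        (use n1 E0 s C fA in \<open>auto intro!: add_nonneg_nonneg mult_nonneg_nonneg\<close>)
    also have "\<dots> = C * (n1 * s + 4 * E) + 2 * (C * s) * nrm (f k)" by (simp add: algebra_simps)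
    also have "\<dots> \<le> B / 2 + 1/2 * nrm (f k)"
      unfolding s(3) using B0 nrm_nonneg[OF fA[of k]] by simp
    finally have "nrm (f (Suc k)) \<le> B / 2 + 3/2 * nrm (f k)" by simp
    also have "\<dots> \<le> B / 2 * 2 ^ k + 3/2 * (B * 2 ^ k)"
      using Suc B0 mult_left_mono[of 1 "2 ^ k" "B / 2"] by simp
    finally show ?case by simp
  qed (use B0 in simp)
  have geo: "nrm (\<lambda>x. f (Suc k) x - f k x) \<le> (C * ((n1 + 2 * B) * s + 4 * E)) * (1/2) ^ k" for k
  proof -
    have h: "(1/4::real) ^ k \<le> (1/2) ^ k" by (intro power_mono) auto
    have d: "(2::real) ^ k * (1/4) ^ k = (1/2) ^ k" by (simp add: power_mult_distrib[symmetric])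
    have "(n1 + 2 * nrm (f k)) * (s * (1/4) ^ k) \<le> (n1 + 2 * (B * 2 ^ k)) * (s * (1/4) ^ k)"
      using fk[of k] s by (intro mult_right_mono) auto
    also have "\<dots> = n1 * s * (1/4) ^ k + 2 * B * s * (2 ^ k * (1/4) ^ k)" by (simp add: algebra_simps)
    also have "\<dots> \<le> n1 * s * (1/2) ^ k + 2 * B * s * (1/2) ^ k"
      unfolding d using h n1 s B0(1) by (intro add_mono mult_left_mono) auto
    finally have a: "(n1 + 2 * nrm (f k)) * (s * (1/4) ^ k) \<le> (n1 + 2 * B) * s * (1/2) ^ k" by (simp add: algebra_simps)
    have b: "E * (1/4) ^ k * 4 \<le> 4 * E * (1/2) ^ k" using h E0 mult_left_mono[OF h, of "4 * E"] by (simp add: mult_ac)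
    have "nrm (\<lambda>x. f (Suc k) x - f k x) \<le> C * ((n1 + 2 * B) * s * (1/2) ^ k + 4 * E * (1/2) ^ k)"
      by (rule order_trans[OF step]) (use a b C in \<open>intro mult_left_mono add_mono; simp\<close>)
    then show ?thesis by (simp add: algebra_simps)
  qed
  obtain g where g: "g \<in> A" "\<And>x. (\<lambda>k. f k x) \<longlonglongrightarrow> g x"
    by (rule geometric_limit[OF fA geo]) auto
  have "g x = indicator F x" for x
  proof -
    have "(\<lambda>k. e k x) \<longlonglongrightarrow> g x ^ 2 - g x" unfolding e_def by (intro tendsto_intros g)
    moreover have "(\<lambda>k. e k x) \<longlonglongrightarrow> 0"
    proof (rule Lim_null_comparison)
      show "\<forall>\<^sub>F k in sequentially. norm (e k x) \<le> s * (1/4) ^ k" using es by (intro always_eventually) auto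
      have "(\<lambda>k. s * (1/4) ^ k) \<longlonglongrightarrow> s * 0" by (intro tendsto_intros LIMSEQ_power_zero) auto
      then show "(\<lambda>k. s * (1/4) ^ k) \<longlonglongrightarrow> 0" by simp
    qed
    ultimately have "g x ^ 2 - g x = 0" by (rule LIMSEQ_unique)
    then have "g x * (g x - 1) = 0" by (simp add: power2_eq_square algebra_simps)
    then have 01: "g x = 0 \<or> g x = 1" by simp
    have "cmod (g x - indicator F x) \<le> \<delta>"
    proof (rule tendsto_upperbound)
      show "(\<lambda>k. cmod (f k x - indicator F x)) \<longlonglongrightarrow> cmod (g x - indicator F x)"
        by (intro tendsto_intros g)
    qed (use near in auto)
    then show ?thesis using 01 \<delta> by (cases "x \<in> F") auto
  qed
  then have "g = indicator F" by auto
  then show ?thesis using g by simp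
qed

end

context weighted_composition
begin

section \<open>Solving T g - \<zeta> g = f under the dichotomy\<close>

lemma T_telescope: "(\<Sum>j<k. T j (\<lambda>x. w x * g (phi x) - g x) x) = T k g x - g x"
proof (induction k)
  case (Suc k)
  have "T k (\<lambda>x. w x * g (phi x) - g x) x = T (Suc k) g x - T k g x"
    by (simp add: T_def P_Suc algebra_simps)
  then show ?case using Suc by simp
qed simp

lemma decay:
  assumes L: "L \<ge> 1" and inv: "\<And>x. phi x \<in> F \<longleftrightarrow> x \<in> F"
    and small: "\<And>x. x \<in> F \<Longrightarrow> cmod (P L x) \<le> 1/2"
  shows "x \<in> F \<Longrightarrow> cmod (P n x) \<le> omega ^ L * (1/2) ^ (n div L)"
proof -
  assume x: "x \<in> F"
  have invn: "(phi ^^ k) x \<in> F" for k by (induction k) (simp_all add: inv x)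
  have Fj: "cmod (P (L * j) x) \<le> (1/2) ^ j" for j
  proof (induction j)
    case (Suc j)
    have "P (L * Suc j) x = P (L * j) x * P L ((phi ^^ (L * j)) x)"
      using P_add[of "L * j" L x] by (simp add: add.commute)
    then have "cmod (P (L * Suc j) x) = cmod (P (L * j) x) * cmod (P L ((phi ^^ (L * j)) x))"
      by (simp only: norm_mult)
    also have "\<dots> \<le> (1/2) ^ j * (1/2)" by (intro mult_mono Suc small invn) auto
    finally show ?case by simp
  qed simp
  have "P n x = P (L * (n div L)) x * P (n mod L) ((phi ^^ (L * (n div L))) x)"
    using P_add[of "L * (n div L)" "n mod L" x] by simp
  then have "cmod (P n x) = cmod (P (L * (n div L)) x) * cmod (P (n mod L) ((phi ^^ (L * (n div L))) x))"
    by (simp add: norm_mult)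
  also have "\<dots> \<le> (1/2) ^ (n div L) * omega ^ L"
  proof (intro mult_mono Fj)
    have "cmod (P (n mod L) ((phi ^^ (L * (n div L))) x)) \<le> omega ^ (n mod L)" by (rule P_le)
    also have "\<dots> \<le> omega ^ L" using L omega(1) by (intro power_increasing) (auto simp: less_imp_le)
    finally show "cmod (P (n mod L) ((phi ^^ (L * (n div L))) x)) \<le> omega ^ L" .
  qed auto
  finally show ?thesis by (simp add: mult.commute)
qed

text \<open>T^L at least halves moduli on F and at least doubles them off F, while T^L g stays
  within s' of \<zeta>^L g. Either way the supremum of \<open>cmod (g x)\<close> is at most half of
  itself plus s'. Only moduli enter, so the constant is the same for all \<zeta> on the circle, as
  \<open>circle_surj\<close> requires.\<close>

lemma dichotomy_sup_bound:
  assumes L: "L \<ge> 1" and inv: "\<And>x. phi x \<in> F \<longleftrightarrow> x \<in> F"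
    and small: "\<And>x. x \<in> F \<Longrightarrow> cmod (P L x) \<le> 1/2" and big: "\<And>x. x \<notin> F \<Longrightarrow> cmod (P L x) \<ge> 2"
    and \<zeta>: "cmod \<zeta> = 1"
    and g: "\<And>x. cmod (g x) \<le> B" and s: "\<And>x. cmod (w x * g (phi x) - \<zeta> * g x) \<le> s"
  shows "cmod (g x) \<le> 2 * real L * omega ^ L * s"
proof -
  define e where "e = (\<lambda>x. w x * g (phi x) - \<zeta> * g x)"
  define s' where "s' = real L * omega ^ L * s"
  have s0: "s \<ge> 0" using s[of undefined] norm_ge_zero order_trans by blast
  have tel: "T k g x - \<zeta> ^ k * g x = (\<Sum>j<k. \<zeta> ^ (k - Suc j) * T j e x)" for k x
  proof (induction k)
    case (Suc k)
    have "T (Suc k) g x - \<zeta> ^ Suc k * g x = T k e x + \<zeta> * (T k g x - \<zeta> ^ k * g x)"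
      by (simp add: T_def P_Suc e_def algebra_simps)
    also have "\<dots> = T k e x + (\<Sum>j<k. \<zeta> ^ (Suc k - Suc j) * T j e x)"
      unfolding Suc sum_distrib_left by (auto simp: Suc_diff_Suc mult.assoc[symmetric] intro!: sum.cong)
        (simp add: Suc_diff_le[symmetric] power_Suc[symmetric] del: power_Suc)
    finally show ?case by simp
  qed simp
  have tb: "cmod (T L g x - \<zeta> ^ L * g x) \<le> s'" for x
  proof -
    have "cmod (\<zeta> ^ (L - Suc j) * T j e x) \<le> omega ^ L * s" if "j < L" for j
    proof -
      have "cmod (\<zeta> ^ (L - Suc j) * T j e x) = cmod (P j x) * cmod (e ((phi ^^ j) x))"
        using \<zeta> by (simp add: T_def norm_mult norm_power)
      also have "\<dots> \<le> omega ^ L * s"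
      proof (intro mult_mono)
        show "cmod (P j x) \<le> omega ^ L"
          using P_le[of j x] power_increasing[of j L omega] omega(1) that by linarith
      qed (use s omega(1) in \<open>auto simp: e_def\<close>)
      finally show ?thesis .
    qed
    then have "cmod (T L g x - \<zeta> ^ L * g x) \<le> (\<Sum>j<L. omega ^ L * s)"
      unfolding tel by (intro order_trans[OF norm_sum sum_mono]) auto
    then show ?thesis by (simp add: s'_def mult_ac)
  qed
  define Bs where "Bs = (SUP x. cmod (g x))"
  have bdd: "bdd_above (range (\<lambda>x. cmod (g x)))" using g by (intro bdd_aboveI[of _ B]) auto
  have gB: "cmod (g x) \<le> Bs" for x unfolding Bs_def by (rule cSUP_upper[OF _ bdd]) simp
  have s'0: "s' \<ge> 0" using s0 omega(1) by (simp add: s'_def)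
  have invp: "psi x \<in> F \<longleftrightarrow> x \<in> F" for x using inv[of "psi x"] by simp
  have invpn: "(psi ^^ k) x \<in> F \<longleftrightarrow> x \<in> F" for k x by (induction k) (simp_all add: invp)
  have half: "cmod (g x) \<le> Bs / 2 + s'" for x
  proof (cases "x \<in> F")
    case True
    have "cmod (g x) = cmod (\<zeta> ^ L * g x)" using \<zeta> by (simp add: norm_mult norm_power)
    also have "\<dots> \<le> cmod (T L g x) + cmod (T L g x - \<zeta> ^ L * g x)"
      using norm_triangle_ineq4[of "T L g x" "T L g x - \<zeta> ^ L * g x"] by simp
    also have "cmod (T L g x) \<le> 1/2 * Bs"
      unfolding T_def norm_mult by (intro mult_mono small True gB) auto
    finally show ?thesis using tb[of x] by simp
  next
    case False
    define v where "v = (psi ^^ L) x"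
    have v: "v \<notin> F" "(phi ^^ L) v = x" using False by (simp_all add: v_def invpn)
    have "2 * cmod (g x) \<le> cmod (P L v) * cmod (g x)" by (intro mult_right_mono big v) auto
    also have "\<dots> = cmod (T L g v)" by (simp add: T_def norm_mult v)
    also have "\<dots> \<le> cmod (T L g v - \<zeta> ^ L * g v) + cmod (\<zeta> ^ L * g v)"
      using norm_triangle_ineq[of "T L g v - \<zeta> ^ L * g v" "\<zeta> ^ L * g v"] by simp
    also have "cmod (\<zeta> ^ L * g v) \<le> Bs" using \<zeta> gB[of v] by (simp add: norm_mult norm_power)
    finally show ?thesis using tb[of v] s'0 by simp
  qed
  have "Bs \<le> Bs / 2 + s'" unfolding Bs_def by (rule cSUP_least) (use half in \<open>auto simp: Bs_def\<close>)
  then show ?thesis using gB[of x] by (simp add: s'_def)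
qed

text \<open>Iterate g \<mapsto> S(f + (\<zeta>' - \<zeta>)g) with S any choice of solutions. The
  lower bound, applied to differences of iterates, replaces linearity and boundedness of S.\<close>

lemma surj_perturb:
  assumes K: "K \<ge> 1" "\<And>g. g \<in> A \<Longrightarrow> nrm g \<le> K * nrm (\<lambda>x. w x * g (phi x) - \<zeta> * g x)"
    and surj: "\<And>f. f \<in> A \<Longrightarrow> \<exists>g\<in>A. (\<lambda>x. w x * g (phi x) - \<zeta> * g x) = f"
    and d: "cmod (\<zeta>' - \<zeta>) * K \<le> 1/2" and f: "f \<in> A"
  shows "\<exists>g\<in>A. (\<lambda>x. w x * g (phi x) - \<zeta>' * g x) = f"
proof -
  obtain S where S: "\<And>f. f \<in> A \<Longrightarrow> S f \<in> A" "\<And>f x. f \<in> A \<Longrightarrow> w x * S f (phi x) - \<zeta> * S f x = f x"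
    using surj by (metis (no_types, lifting))
  define g where "g = rec_nat (\<lambda>x. 0) (\<lambda>_ h. S (\<lambda>x. f x + (\<zeta>' - \<zeta>) * h x))"
  have g0: "g 0 = (\<lambda>x. 0)" and gS: "g (Suc k) = S (\<lambda>x. f x + (\<zeta>' - \<zeta>) * g k x)" for k by (simp_all add: g_def)
  have gA: "g k \<in> A" for k by (induction k) (auto simp: g0 gS intro!: S add cmult f)
  have eq: "w x * g (Suc k) (phi x) - \<zeta> * g (Suc k) x = f x + (\<zeta>' - \<zeta>) * g k x" for k x
    unfolding gS by (rule S(2)) (intro add cmult f gA)
  have step: "nrm (\<lambda>x. g (Suc k) x - g k x) \<le> nrm (g 1) * (1/2) ^ k" for k
  proof (induction k)
    case 0
    then show ?case by (simp add: g0)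
  next
    case (Suc k)
    let ?d = "\<lambda>x. g (Suc (Suc k)) x - g (Suc k) x"
    have "(\<lambda>x. w x * ?d (phi x) - \<zeta> * ?d x) = (\<lambda>x. (\<zeta>' - \<zeta>) * (g (Suc k) x - g k x))"
    proof
      fix x
      show "w x * ?d (phi x) - \<zeta> * ?d x = (\<zeta>' - \<zeta>) * (g (Suc k) x - g k x)"
        using eq[of x "Suc k"] eq[of x k] by (simp add: algebra_simps)
    qed
    then have "nrm ?d \<le> K * nrm (\<lambda>x. (\<zeta>' - \<zeta>) * (g (Suc k) x - g k x))"
      using K(2)[OF diff[OF gA gA], of "Suc (Suc k)" "Suc k"] by simp
    also have "\<dots> = (cmod (\<zeta>' - \<zeta>) * K) * nrm (\<lambda>x. g (Suc k) x - g k x)"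
      unfolding nrm_cmult[OF diff[OF gA gA]] by simp
    also have "\<dots> \<le> 1/2 * (nrm (g 1) * (1/2) ^ k)"
      by (intro mult_mono d Suc nrm_nonneg diff gA) auto
    finally show ?case by simp
  qed
  obtain h where h: "h \<in> A" "\<And>x. (\<lambda>k. g k x) \<longlonglongrightarrow> h x"
    by (rule geometric_limit[OF gA step]) auto
  have "w x * h (phi x) - \<zeta> * h x = f x + (\<zeta>' - \<zeta>) * h x" for x
  proof (rule LIMSEQ_unique)
    show "(\<lambda>k. w x * g (Suc k) (phi x) - \<zeta> * g (Suc k) x) \<longlonglongrightarrow> w x * h (phi x) - \<zeta> * h x"
      by (intro tendsto_intros LIMSEQ_Suc h)
    show "(\<lambda>k. w x * g (Suc k) (phi x) - \<zeta> * g (Suc k) x) \<longlonglongrightarrow> f x + (\<zeta>' - \<zeta>) * h x"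
      unfolding eq by (intro tendsto_intros h)
  qed
  then have "(\<lambda>x. w x * h (phi x) - \<zeta>' * h x) = f" by (auto simp: algebra_simps)
  then show ?thesis using h(1) by blast
qed

text \<open>Continuity method: the lower bound is uniform on the circle, so surjectivity travels
  from 1 to \<zeta> along the arc in finitely many equal steps.\<close>

lemma circle_surj:
  assumes K: "K \<ge> 1" "\<And>g \<zeta>. g \<in> A \<Longrightarrow> cmod \<zeta> = 1 \<Longrightarrow> nrm g \<le> K * nrm (\<lambda>x. w x * g (phi x) - \<zeta> * g x)"
    and surj: "\<And>f. f \<in> A \<Longrightarrow> \<exists>g\<in>A. (\<lambda>x. w x * g (phi x) - g x) = f"
    and \<zeta>: "cmod \<zeta> = 1" and f: "f \<in> A"
  shows "\<exists>g\<in>A. (\<lambda>x. w x * g (phi x) - \<zeta> * g x) = f"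
proof -
  obtain t where t: "\<zeta> = cis t" using \<zeta> by (metis complex_norm_eq_1_exp cis_conv_exp)
  obtain N where N: "2 * K * \<bar>t\<bar> < real N" using reals_Archimedean2 by blast
  have Np: "N > 0" using N K(1) by (metis abs_ge_zero less_le_not_le mult_nonneg_nonneg not_gr_zero of_nat_0 order_trans zero_le_numeral zero_le_one)
  define \<tau> where "\<tau> = t / real N"
  have d: "cmod (cis (real (Suc k) * \<tau>) - cis (real k * \<tau>)) * K \<le> 1/2" for k
  proof -
    have "cis (real (Suc k) * \<tau>) - cis (real k * \<tau>) = cis (real k * \<tau>) * (cis \<tau> - 1)"
      by (simp add: cis_mult algebra_simps)
    then have "cmod (cis (real (Suc k) * \<tau>) - cis (real k * \<tau>)) = cmod (cis \<tau> - 1)" by (simp add: norm_mult)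
    also have "cmod (cis \<tau> - 1) = 2 * \<bar>sin (\<tau> / 2)\<bar>"
      using dist_exp_i_1[of \<tau>] by (simp add: cis_conv_exp mult.commute)
    also have "\<dots> \<le> \<bar>\<tau>\<bar>" using abs_sin_x_le_abs_x[of "\<tau> / 2"] by simp
    finally have "cmod (cis (real (Suc k) * \<tau>) - cis (real k * \<tau>)) * K \<le> \<bar>\<tau>\<bar> * K" using K(1) by (intro mult_right_mono) auto
    also have "\<dots> \<le> 1/2" using N Np by (simp add: \<tau>_def field_simps)
    finally show ?thesis .
  qed
  have "\<forall>f\<in>A. \<exists>g\<in>A. (\<lambda>x. w x * g (phi x) - cis (real k * \<tau>) * g x) = f" for k
  proof (induction k)
    case 0
    then show ?case using surj by simp
  next
    case (Suc k)
    show ?case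
    proof
      fix f assume f: "f \<in> A"
      show "\<exists>g\<in>A. (\<lambda>x. w x * g (phi x) - cis (real (Suc k) * \<tau>) * g x) = f"
        by (rule surj_perturb[OF K(1) K(2) _ d f]) (use Suc in auto)
    qed
  qed
  from this[of N] show ?thesis using f Np by (simp add: \<tau>_def t)
qed

text \<open>T^(2N) - \<zeta> is the product of T^N - \<eta> and T^N + \<eta> with \<eta> a square
  root of \<zeta>. Powers of two are enough, as the aim is only to reach large exponents.\<close>

lemma power_two_surj:
  assumes surj: "\<And>f \<zeta>. f \<in> A \<Longrightarrow> cmod \<zeta> = 1 \<Longrightarrow> \<exists>g\<in>A. (\<lambda>x. w x * g (phi x) - \<zeta> * g x) = f"
    and f: "f \<in> A" and \<zeta>: "cmod \<zeta> = 1"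
  shows "\<exists>g\<in>A. (\<lambda>x. T (2 ^ m) g x - \<zeta> * g x) = f"
  using f \<zeta>
proof (induction m arbitrary: f \<zeta>)
  case 0
  then show ?case using surj by (simp add: T_1)
next
  case (Suc m)
  define \<eta> where "\<eta> = csqrt \<zeta>"
  have \<eta>: "\<eta> * \<eta> = \<zeta>" "cmod \<eta> = 1" "cmod (- \<eta>) = 1"
    using Suc.prems(2) power2_csqrt[of \<zeta>] by (auto simp: \<eta>_def power2_eq_square norm_csqrt)
  obtain h where h: "h \<in> A" "(\<lambda>x. T (2 ^ m) h x - \<eta> * h x) = f" using Suc.IH[OF Suc.prems(1) \<eta>(2)] by blast
  obtain g where g: "g \<in> A" "(\<lambda>x. T (2 ^ m) g x - (- \<eta>) * g x) = h" using Suc.IH[OF h(1) \<eta>(3)] by blast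
  have "T (2 ^ m) h = T (2 ^ m) (\<lambda>x. 1 * T (2 ^ m) g x + \<eta> * g x)" unfolding g(2)[symmetric] by simp
  also have "\<dots> = (\<lambda>x. T (2 ^ Suc m) g x + \<eta> * T (2 ^ m) g x)"
    unfolding T_linear T_T by (simp add: mult_2)
  finally have Th: "T (2 ^ m) h = (\<lambda>x. T (2 ^ Suc m) g x + \<eta> * T (2 ^ m) g x)" .
  have "(\<lambda>x. T (2 ^ Suc m) g x - \<zeta> * g x) = f"
  proof
    fix x
    have "f x = T (2 ^ m) h x - \<eta> * h x" using h(2) by auto
    also have "\<dots> = T (2 ^ Suc m) g x + \<eta> * T (2 ^ m) g x - \<eta> * (T (2 ^ m) g x + \<eta> * g x)"
      using Th fun_cong[OF g(2), of x] by simp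
    finally show "T (2 ^ Suc m) g x - \<zeta> * g x = f x" by (simp add: algebra_simps \<eta>(1)[symmetric])
  qed
  then show ?case using g(1) by blast
qed

text \<open>The solution of \<open>u - T\<^sup>N u = 1\<close> tends to the spectral idempotent as \<open>N\<close> grows.\<close>

lemma indicator_approx:
  assumes L: "L \<ge> 1" and inv: "\<And>x. phi x \<in> F \<longleftrightarrow> x \<in> F"
    and small: "\<And>x. x \<in> F \<Longrightarrow> cmod (P L x) \<le> 1/2" and big: "\<And>x. x \<notin> F \<Longrightarrow> cmod (P L x) \<ge> 2"
    and surj: "\<And>f \<zeta>. f \<in> A \<Longrightarrow> cmod \<zeta> = 1 \<Longrightarrow> \<exists>g\<in>A. (\<lambda>x. w x * g (phi x) - \<zeta> * g x) = f"
    and \<delta>: "\<delta> > 0"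
  shows "\<exists>u\<in>A. \<forall>x. cmod (u x - indicator F x) \<le> \<delta>"
proof -
  define \<kappa> where "\<kappa> = min (1/2) (\<delta> / 4)"
  have \<kappa>: "0 < \<kappa>" "\<kappa> \<le> 1/2" "4 * \<kappa> \<le> \<delta>" using \<delta> by (auto simp: \<kappa>_def)
  have omL: "omega ^ L > 0" using omega(1) by simp
  have "(\<lambda>j. omega ^ L * (1/2) ^ j) \<longlonglongrightarrow> omega ^ L * 0" by (intro tendsto_intros LIMSEQ_power_zero) auto
  then have "\<forall>\<^sub>F j in sequentially. omega ^ L * (1/2) ^ j < \<kappa>" using \<kappa> by (auto dest: order_tendstoD(2))
  then obtain j0 where j0: "\<And>j. j \<ge> j0 \<Longrightarrow> omega ^ L * (1/2) ^ j < \<kappa>" by (auto simp: eventually_sequentially)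
  \<comment> \<open>2^m \<ge> m makes N contain at least j0 blocks of length L.\<close>
  define m where "m = L * j0"
  define N where "N = (2::nat) ^ m"
  have "m \<le> N" unfolding N_def by (simp add: less_imp_le)
  then have "j0 \<le> N div L" using L by (simp add: m_def less_eq_div_iff_mult_less_eq mult.commute)
  then have k: "omega ^ L * (1/2) ^ (N div L) \<le> \<kappa>" using j0 by (simp add: less_imp_le)
  have sm: "cmod (P N x) \<le> \<kappa>" if "x \<in> F" for x
    using decay[OF L inv small that, of N] k by linarith
  have bg: "1 \<le> \<kappa> * cmod (P N x)" if x: "x \<notin> F" for x
  proof -
    have invn: "(phi ^^ k) x \<notin> F" for k by (induction k) (simp_all add: inv x)
    have Fj: "cmod (P (L * j) x) \<ge> 2 ^ j" for j
    proof (induction j)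
      case (Suc j)
      have "P (L * Suc j) x = P (L * j) x * P L ((phi ^^ (L * j)) x)"
        using P_add[of "L * j" L x] by (simp add: add.commute)
      then show ?case
        using mult_mono[OF Suc big[OF invn, of "L * j"]] by (simp add: norm_mult mult.commute)
    qed simp
    have "P N x = P (L * (N div L)) x * P (N mod L) ((phi ^^ (L * (N div L))) x)"
      using P_add[of "L * (N div L)" "N mod L" x] by simp
    then have "1 / cmod (P N x) = 1 / cmod (P (L * (N div L)) x) * (1 / cmod (P (N mod L) ((phi ^^ (L * (N div L))) x)))"
      by (simp add: norm_mult)
    also have "\<dots> \<le> (1/2) ^ (N div L) * omega ^ L"
    proof (intro mult_mono)
      show "1 / cmod (P (L * (N div L)) x) \<le> (1/2) ^ (N div L)"
        using Fj[of "N div L"] by (simp add: power_divide divide_simps)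
      have "1 / cmod (P (N mod L) ((phi ^^ (L * (N div L))) x)) \<le> omega ^ (N mod L)" by (rule P_ge)
      also have "\<dots> \<le> omega ^ L" using L omega(1) by (intro power_increasing) (auto simp: less_imp_le)
      finally show "1 / cmod (P (N mod L) ((phi ^^ (L * (N div L))) x)) \<le> omega ^ L" .
    qed auto
    also have "\<dots> \<le> \<kappa>" using k by (simp add: mult.commute)
    finally show ?thesis by (simp add: divide_simps)
  qed
  \<comment> \<open>On F the equation reads u = 1 + T^N u with T^N u small. Off F it is read N steps
    earlier, at \<open>(psi ^^ N) x\<close>, where division by the large \<open>P N\<close> makes u
    x small.\<close>
  obtain u where u: "u \<in> A" "(\<lambda>x. T N u x - 1 * u x) = (\<lambda>x. -1)"
    using power_two_surj[OF surj const[of "-1"], where \<zeta> = 1 and m = m] unfolding N_def by auto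
  have eq: "P N x * u ((phi ^^ N) x) = u x - 1" for x
    using fun_cong[OF u(2), of x] by (simp add: T_def algebra_simps)
  define Bs where "Bs = (SUP x. cmod (u x))"
  have bdd: "bdd_above (range (\<lambda>x. cmod (u x)))" using cmod_le_nrm[OF u(1)] by (intro bdd_aboveI[of _ "nrm u"]) auto
  have uB: "cmod (u x) \<le> Bs" for x unfolding Bs_def by (rule cSUP_upper[OF _ bdd]) simp
  have B0: "Bs \<ge> 0" using uB[of undefined] norm_ge_zero order_trans by blast
  have onF: "cmod (u x - 1) \<le> \<kappa> * Bs" if "x \<in> F" for x
    unfolding eq[symmetric] norm_mult by (intro mult_mono sm uB that) (use \<kappa> in auto)
  have invp: "psi x \<in> F \<longleftrightarrow> x \<in> F" for x using inv[of "psi x"] by simp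
  have invpn: "(psi ^^ k) x \<in> F \<longleftrightarrow> x \<in> F" for k x by (induction k) (simp_all add: invp)
  have offF: "cmod (u x) \<le> \<kappa> * (Bs + 1)" if x: "x \<notin> F" for x
  proof -
    define v where "v = (psi ^^ N) x"
    have v: "v \<notin> F" "(phi ^^ N) v = x" using x by (simp_all add: v_def invpn)
    have "cmod (u x) \<le> (\<kappa> * cmod (P N v)) * cmod (u x)" using mult_right_mono[OF bg[OF v(1)], of "cmod (u x)"] by simp
    also have "\<dots> = \<kappa> * cmod (u v - 1)" using eq[of v] v(2) by (metis mult.assoc norm_mult)
    also have "\<dots> \<le> \<kappa> * (Bs + 1)"
      using norm_triangle_ineq4[of "u v" 1] uB[of v] \<kappa> by (intro mult_left_mono) auto
    finally show ?thesis .
  qed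
  have "cmod (u x) \<le> 1 + \<kappa> * Bs" for x
  proof (cases "x \<in> F")
    case True
    then show ?thesis using onF[of x] norm_triangle_ineq[of "u x - 1" 1] by simp
  next
    case False
    have "\<kappa> * (Bs + 1) \<le> 1 + \<kappa> * Bs" using \<kappa> by (simp add: algebra_simps)
    then show ?thesis using offF[OF False] by linarith
  qed
  then have "Bs \<le> 1 + \<kappa> * Bs" unfolding Bs_def by (intro cSUP_least) (auto simp: Bs_def)
  also have "\<dots> \<le> 1 + 1/2 * Bs" using \<kappa> B0 by (intro add_left_mono mult_right_mono) auto
  finally have B2: "Bs \<le> 2" by simp
  have "cmod (u x - indicator F x) \<le> \<delta>" for x
  proof (cases "x \<in> F")
    case True
    have "\<kappa> * Bs \<le> \<kappa> * 2" using B2 \<kappa> by (intro mult_left_mono) auto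
    then have "cmod (u x - 1) \<le> \<delta>" using onF[OF True] \<kappa> by linarith
    then show ?thesis using True by simp
  next
    case False
    have "\<kappa> * (Bs + 1) \<le> \<kappa> * 3" using B2 \<kappa> by (intro mult_left_mono) auto
    then have "cmod (u x) \<le> \<delta>" using offF[OF False] \<kappa> by linarith
    then show ?thesis using False by simp
  qed
  then show ?thesis using u(1) by blast
qed

text \<open>An indicator is its own square, so \<open>nrm_T_square\<close> bounds the norm of
  \<open>T N h\<close> through its sup norm, which decays like 2^-j for N = Lj. Composition costs
  \<theta>^N twice, for \<open>T N h\<close> and for f; the choice \<theta>^(4L) = 2 makes this
  2^(j/2), so that r is 1 over the square root of 2.\<close>

lemma half_contraction:
  assumes L: "L \<ge> 1" and inv: "\<And>x. phi x \<in> F \<longleftrightarrow> x \<in> F"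
    and small: "\<And>x. x \<in> F \<Longrightarrow> cmod (P L x) \<le> 1/2" and \<chi>: "indicator F \<in> A"
  obtains N where "\<And>f. f \<in> A \<Longrightarrow> nrm (\<lambda>x. indicator F x * T N f x) \<le> 1/2 * nrm f"
proof (cases "F = {}")
  case True
  then show thesis using that[of 0] by simp
next
  case False
  define h :: "'m \<Rightarrow> complex" where "h = indicator F"
  have hA: "h \<in> A" using \<chi> by (simp add: h_def)
  obtain v where "v \<in> F" using False by blast
  then have nh: "nrm h \<ge> 1" using cmod_le_nrm[OF hA, of v] by (simp add: h_def)
  have h1: "cmod (h x) \<le> 1" for x by (simp add: h_def indicator_def)
  have h2: "(\<lambda>x. h x ^ 2) = h" by (auto simp: h_def indicator_def power2_eq_square)
  have invn: "(phi ^^ k) x \<in> F \<longleftrightarrow> x \<in> F" for k x by (induction k) (simp_all add: inv)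
  have hn: "h ((phi ^^ k) x) = h x" for k x by (simp add: h_def indicator_def invn)
  define \<theta> where "\<theta> = root (4 * L) 2"
  have \<theta>: "\<theta> > 1" "\<theta> ^ (4 * L) = 2" using L by (auto simp: \<theta>_def)
  obtain K where K: "K \<ge> 1" "\<And>n f. f \<in> A \<Longrightarrow> nrm (\<lambda>x. f ((phi ^^ n) x)) \<le> K * \<theta> ^ n * nrm f"
    using growth[OF \<theta>(1)] by auto
  define r where "r = \<theta> ^ (2 * L) / 2"
  have sq: "(\<theta> ^ (2 * L))\<^sup>2 = 2"
    unfolding power_mult[symmetric] \<theta>(2)[symmetric] by (simp add: mult.commute)
  have "\<theta> ^ (2 * L) < 2"
  proof (rule ccontr)
    assume "\<not> ?thesis"
    then have "(2::real)\<^sup>2 \<le> (\<theta> ^ (2 * L))\<^sup>2" by (intro power_mono) auto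
    then show False unfolding sq by simp
  qed
  then have r: "0 < r" "r < 1" using \<theta>(1) by (auto simp: r_def)
  define D0 where "D0 = 2 * C * (C * K) * K * nrm h * omega ^ L"
  define W where "W = real L * nrm w * omega"
  have "(\<lambda>j. D0 * (real j * W + 2) * r ^ j) \<longlonglongrightarrow> 0" using r by real_asymp
  then have "\<forall>\<^sub>F j in sequentially. D0 * (real j * W + 2) * r ^ j < 1/2" by (auto dest: order_tendstoD(2)[of _ _ _ "1/2"])
  then obtain j where j: "D0 * (real j * W + 2) * r ^ j < 1/2" by (auto simp: eventually_sequentially)
  define N where "N = L * j"
  define loc where "loc = omega ^ L * (1/2) ^ j"
  have loc: "cmod (T N h x) \<le> loc" for x
  proof (cases "x \<in> F")
    case True
    have "cmod (T N h x) = cmod (P N x)" using True hn[of N x] by (simp add: T_def norm_mult h_def)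
    also have "\<dots> \<le> loc" using decay[OF L inv small True, of N] L by (simp add: loc_def N_def)
    finally show ?thesis .
  next
    case False
    then have "T N h x = 0" using hn[of N x] by (simp add: T_def h_def)
    then show ?thesis using omega(1) by (simp add: loc_def)
  qed
  have nT: "nrm (T N h) \<le> C * K * \<theta> ^ N * (real N * nrm w * omega + 2) * nrm h * loc"
    using nrm_T_square[OF less_imp_le[OF \<theta>(1)] K(2,1) hA h1 nh loc] unfolding h2 .
  show thesis
  proof (rule that[of N])
    fix f assume f: "f \<in> A"
    have fA: "(\<lambda>x. f ((phi ^^ N) x)) \<in> A" by (rule comp_phi_pow[OF f])
    have "(\<lambda>x. indicator F x * T N f x) = (\<lambda>x. T N h x * f ((phi ^^ N) x))"
      using hn by (auto simp: T_def h_def)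
    then have "nrm (\<lambda>x. indicator F x * T N f x) \<le> 2 * C * nrm (T N h) * nrm (\<lambda>x. f ((phi ^^ N) x))"
      using nrm_mult[OF T_closed[OF hA] fA, of N] by simp
    also have "\<dots> \<le> 2 * C * (C * K * \<theta> ^ N * (real N * nrm w * omega + 2) * nrm h * loc) * (K * \<theta> ^ N * nrm f)"
    proof (intro mult_mono mult_left_mono nT K(2)[OF f])
      have "0 \<le> C * K * \<theta> ^ N * (real N * nrm w * omega + 2) * nrm h * loc"
        using order_trans[OF nrm_nonneg[OF T_closed[OF hA]] nT] .
      then show "0 \<le> 2 * C * (C * K * \<theta> ^ N * (real N * nrm w * omega + 2) * nrm h * loc)"
        by (rule mult_nonneg_nonneg[rotated]) (use C in simp)
    qed (use C fA T_closed[OF hA] in auto)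
    also have "\<dots> = D0 * (real j * W + 2) * ((\<theta> ^ N * \<theta> ^ N) * (1/2) ^ j) * nrm f"
      by (simp add: D0_def W_def loc_def N_def mult_ac)
    also have "(\<theta> ^ N * \<theta> ^ N) * (1/2) ^ j = r ^ j"
    proof -
      have "\<theta> ^ N * \<theta> ^ N = (\<theta> ^ (2 * L)) ^ j"
        by (simp add: N_def power_add[symmetric] power_mult[symmetric] mult_2 distrib_right)
      then show ?thesis by (simp add: r_def power_divide)
    qed
    also have "D0 * (real j * W + 2) * r ^ j * nrm f \<le> 1/2 * nrm f"
      using j f by (intro mult_right_mono) auto
    finally show "nrm (\<lambda>x. indicator F x * T N f x) \<le> 1/2 * nrm f" .
  qed
qed

text \<open>On functions supported in F some power T^N is a contraction, so 1 - T^N is inverted by a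
  Neumann series. The sum 1 + T + ... + T^(N-1) converts this into a statement about T - 1, for the
  lower bound as well as for the solution.\<close>

lemma half_inverse:
  assumes L: "L \<ge> 1" and inv: "\<And>x. phi x \<in> F \<longleftrightarrow> x \<in> F"
    and small: "\<And>x. x \<in> F \<Longrightarrow> cmod (P L x) \<le> 1/2" and \<chi>: "indicator F \<in> A"
  shows "\<exists>K\<ge>0. \<forall>g\<in>A. nrm (\<lambda>x. indicator F x * g x) \<le> K * nrm (\<lambda>x. w x * g (phi x) - g x)"
    and "f \<in> A \<Longrightarrow> \<exists>g\<in>A. (\<lambda>x. w x * g (phi x) - g x) = (\<lambda>x. indicator F x * f x)"
proof -
  define h :: "'m \<Rightarrow> complex" where "h = indicator F"
  have hA: "h \<in> A" using \<chi> by (simp add: h_def)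
  have hh: "h x * h x = h x" for x by (simp add: h_def indicator_def)
  have invn: "(phi ^^ k) x \<in> F \<longleftrightarrow> x \<in> F" for k x by (induction k) (simp_all add: inv)
  have hn: "h ((phi ^^ k) x) = h x" for k x by (simp add: h_def indicator_def invn)
  obtain N where N: "\<And>f. f \<in> A \<Longrightarrow> nrm (\<lambda>x. h x * T N f x) \<le> 1/2 * nrm f"
    using half_contraction[OF L inv small \<chi>] unfolding h_def by blast
  have "\<exists>c\<ge>0. \<forall>g\<in>A. nrm (T j g) \<le> c * nrm g" for j
  proof -
    obtain K where K: "K \<ge> 1" "\<And>n f. f \<in> A \<Longrightarrow> nrm (\<lambda>x. f ((phi ^^ n) x)) \<le> K * 2 ^ n * nrm f"
      using growth[of 2] by auto
    have "nrm (T j g) \<le> (2 * C * nrm (P j) * (K * 2 ^ j)) * nrm g" if g: "g \<in> A" for g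
    proof -
      have "nrm (T j g) \<le> 2 * C * nrm (P j) * nrm (\<lambda>x. g ((phi ^^ j) x))"
        unfolding T_def[abs_def] by (rule nrm_mult[OF P_closed comp_phi_pow[OF g]])
      also have "\<dots> \<le> 2 * C * nrm (P j) * (K * 2 ^ j * nrm g)"
        using C nrm_nonneg[OF P_closed[of j]] by (intro mult_left_mono K g) auto
      finally show ?thesis by simp
    qed
    moreover have "2 * C * nrm (P j) * (K * 2 ^ j) \<ge> 0" using C K(1) nrm_nonneg[OF P_closed[of j]] by simp
    ultimately show ?thesis by blast
  qed
  then obtain c where c: "\<And>j. c j \<ge> 0" "\<And>j g. g \<in> A \<Longrightarrow> nrm (T j g) \<le> c j * nrm g" by metis
  show "\<exists>K\<ge>0. \<forall>g\<in>A. nrm (\<lambda>x. indicator F x * g x) \<le> K * nrm (\<lambda>x. w x * g (phi x) - g x)"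
  proof (intro exI[of _ "4 * C * nrm h * (\<Sum>j<N. c j)"] conjI ballI)
    show "0 \<le> 4 * C * nrm h * (\<Sum>j<N. c j)" using C c hA by (simp add: sum_nonneg)
    fix g assume g: "g \<in> A"
    define d where "d = (\<lambda>x. w x * g (phi x) - g x)"
    have d: "d \<in> A" unfolding d_def by (intro diff mult w_closed comp_phi g)
    define s where "s = (\<lambda>x. \<Sum>j<N. T j d x)"
    have sA: "s \<in> A" unfolding s_def by (intro sum_closed T_closed d)
    have hgA: "(\<lambda>x. h x * g x) \<in> A" by (intro mult hA g)
    have e: "h x * g x = h x * T N (\<lambda>x. h x * g x) x - h x * s x" for x
    proof -
      have "s x = T N g x - g x" unfolding s_def d_def by (rule T_telescope)
      moreover have "h x * T N (\<lambda>x. h x * g x) x = h x * T N g x"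
        using hh[of x] by (simp add: T_def hn) (metis mult.assoc mult.commute)
      ultimately show ?thesis by (simp only: right_diff_distrib) simp
    qed
    have "nrm (\<lambda>x. h x * g x) \<le> nrm (\<lambda>x. h x * T N (\<lambda>x. h x * g x) x) + nrm (\<lambda>x. h x * s x)"
    proof -
      have "(\<lambda>x. h x * g x) = (\<lambda>x. h x * T N (\<lambda>x. h x * g x) x - h x * s x)" using e by blast
      then show ?thesis using nrm_diff[OF mult[OF hA T_closed[OF hgA]] mult[OF hA sA], of N] by simp
    qed
    also have "\<dots> \<le> 1/2 * nrm (\<lambda>x. h x * g x) + 2 * C * nrm h * nrm s"
      by (intro add_mono N hgA nrm_mult hA sA)
    finally have "nrm (\<lambda>x. h x * g x) \<le> 4 * C * nrm h * nrm s" by simp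
    also have "nrm s \<le> (\<Sum>j<N. c j) * nrm d"
    proof -
      have "nrm s \<le> (\<Sum>j<N. nrm (T j d))" unfolding s_def by (intro nrm_sum T_closed d)
      also have "\<dots> \<le> (\<Sum>j<N. c j * nrm d)" by (intro sum_mono c d)
      finally show ?thesis by (simp add: sum_distrib_right)
    qed
    then have "4 * C * nrm h * nrm s \<le> 4 * C * nrm h * ((\<Sum>j<N. c j) * nrm d)"
      using C hA by (intro mult_left_mono) auto
    finally show "nrm (\<lambda>x. indicator F x * g x) \<le> 4 * C * nrm h * (\<Sum>j<N. c j) * nrm (\<lambda>x. w x * g (phi x) - g x)"
      by (simp add: h_def d_def mult.assoc)
  qed
  show "\<exists>g\<in>A. (\<lambda>x. w x * g (phi x) - g x) = (\<lambda>x. indicator F x * f x)" if f: "f \<in> A"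
  proof -
    define s where "s = rec_nat (\<lambda>x. 0) (\<lambda>_ g x. h x * f x + h x * T N g x)"
    have s0: "s 0 = (\<lambda>x. 0)" and sS: "s (Suc k) = (\<lambda>x. h x * f x + h x * T N (s k) x)" for k by (simp_all add: s_def)
    have sA: "s k \<in> A" for k by (induction k) (auto simp: s0 sS intro!: add mult hA f T_closed)
    have step: "nrm (\<lambda>x. s (Suc k) x - s k x) \<le> nrm (s 1) * (1/2) ^ k" for k
    proof (induction k)
      case 0
      then show ?case by (simp add: s0)
    next
      case (Suc k)
      have "(\<lambda>x. s (Suc (Suc k)) x - s (Suc k) x) = (\<lambda>x. h x * T N (\<lambda>x. s (Suc k) x - s k x) x)"
        by (subst sS, subst (2) sS) (auto simp: T_def algebra_simps)
      then have "nrm (\<lambda>x. s (Suc (Suc k)) x - s (Suc k) x) \<le> 1/2 * nrm (\<lambda>x. s (Suc k) x - s k x)"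
        using N[OF diff[OF sA sA], of "Suc k" k] by simp
      then show ?case using Suc by simp
    qed
    obtain u where u: "u \<in> A" "\<And>x. (\<lambda>k. s k x) \<longlonglongrightarrow> u x"
      by (rule geometric_limit[OF sA step]) auto
    have ueq: "u x = h x * f x + h x * T N u x" for x
    proof (rule LIMSEQ_unique)
      show "(\<lambda>k. s (Suc k) x) \<longlonglongrightarrow> u x" by (rule LIMSEQ_Suc[OF u(2)])
      show "(\<lambda>k. s (Suc k) x) \<longlonglongrightarrow> h x * f x + h x * T N u x"
        unfolding sS T_def by (intro tendsto_intros u)
    qed
    have hu: "h x * u x = u x" for x
      using ueq[of x] hh[of x] by (metis distrib_left mult.assoc)
    have hT: "h x * T N u x = T N u x" for x
      using hu[of "(phi ^^ N) x"] hn[of N x] by (simp add: T_def)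
    \<comment> \<open>If u - T^N u = h f, telescoping shows that minus the sum of the T^j u solves T
      g - g = h f.\<close>
    define g where "g = (\<lambda>x. - (\<Sum>j<N. T j u x))"
    have gA: "g \<in> A" unfolding g_def by (intro uminus sum_closed T_closed u)
    have "w x * g (phi x) - g x = h x * f x" for x
    proof -
      have "w x * T j u (phi x) = T (Suc j) u x" for j
        using fun_cong[OF T_T[of "Suc 0" j u], of x] by (simp add: T_1)
      then have "w x * g (phi x) = - (\<Sum>j<N. T (Suc j) u x)"
        by (simp add: g_def sum_distrib_left)
      moreover have "(\<Sum>j<N. T (Suc j) u x) - (\<Sum>j<N. T j u x) = T N u x - u x"
        by (induction N) (simp_all add: algebra_simps)
      ultimately show ?thesis using ueq[of x] hT[of x] by (simp add: g_def algebra_simps)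
    qed
    then show ?thesis using gA unfolding h_def by blast
  qed
qed

end

section \<open>The uniform closure\<close>

context function_algebra
begin

definition uclosure :: "('m \<Rightarrow> complex) set" where
  "uclosure = {g. \<forall>e>0. \<exists>f\<in>A. \<forall>x. cmod (g x - f x) < e}"

definition supn :: "('m \<Rightarrow> complex) \<Rightarrow> real" where
  "supn g = (SUP x. cmod (g x))"

lemma subset_uclosure: "f \<in> A \<Longrightarrow> f \<in> uclosure"
  by (auto simp: uclosure_def intro!: bexI[of _ f])

lemma uclosure_bounded:
  assumes "g \<in> uclosure"
  obtains b where "b \<ge> 0" "\<And>x. cmod (g x) \<le> b"
proof -
  obtain f where f: "f \<in> A" "\<And>x. cmod (g x - f x) < 1"
    using assms zero_less_one unfolding uclosure_def by blast
  show thesis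
  proof
    show "0 \<le> nrm f + 1" using f by (simp add: add_nonneg_nonneg)
    show "cmod (g x) \<le> nrm f + 1" for x
      using f(2)[of x] cmod_le_nrm[OF f(1), of x] norm_triangle_ineq2[of "g x" "f x"] by linarith
  qed
qed

lemma supn_le: "(\<And>x. cmod (g x) \<le> b) \<Longrightarrow> supn g \<le> b"
  unfolding supn_def by (rule cSUP_least) auto

lemma cmod_le_supn:
  assumes "g \<in> uclosure"
  shows "cmod (g x) \<le> supn g"
proof -
  obtain b where "\<And>x. cmod (g x) \<le> b" using uclosure_bounded[OF assms] by blast
  then have "bdd_above (range (\<lambda>x. cmod (g x)))" by (intro bdd_aboveI[of _ b]) auto
  then show ?thesis unfolding supn_def by (rule cSUP_upper[rotated]) simp
qed

lemma uclosure_closed: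
  assumes "\<And>e. e > 0 \<Longrightarrow> \<exists>f\<in>uclosure. \<forall>x. cmod (g x - f x) < e"
  shows "g \<in> uclosure"
  unfolding uclosure_def
proof (intro CollectI allI impI)
  fix e :: real assume e: "e > 0"
  obtain h where h: "h \<in> uclosure" "\<And>x. cmod (g x - h x) < e/2" using assms[of "e/2"] e by auto
  obtain f where f: "f \<in> A" "\<And>x. cmod (h x - f x) < e/2"
    using h(1) half_gt_zero[OF e] unfolding uclosure_def by blast
  have "cmod (g x - f x) < e" for x
    using h(2)[of x] f(2)[of x] norm_triangle_ineq[of "g x - h x" "h x - f x"] by simp
  then show "\<exists>f\<in>A. \<forall>x. cmod (g x - f x) < e" using f(1) by blast
qed

lemma uclosure_approx:
  assumes "g \<in> uclosure" "e > 0"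
  obtains f where "f \<in> A" "\<And>x. cmod (g x - f x) < e"
  using assms unfolding uclosure_def by blast

lemma uclosure_comp:
  assumes "\<And>f. f \<in> A \<Longrightarrow> (\<lambda>x. f (\<sigma> x)) \<in> A" and g: "g \<in> uclosure"
  shows "(\<lambda>x. g (\<sigma> x)) \<in> uclosure"
  unfolding uclosure_def
proof (intro CollectI allI impI)
  fix e :: real assume "e > 0"
  then obtain f where f: "f \<in> A" "\<And>x. cmod (g x - f x) < e" using uclosure_approx[OF g] by blast
  show "\<exists>f\<in>A. \<forall>x. cmod (g (\<sigma> x) - f x) < e"
    by (rule bexI[of _ "\<lambda>x. f (\<sigma> x)"]) (use f assms(1) in auto)
qed

lemma uclosure_add:
  assumes f: "f \<in> uclosure" and g: "g \<in> uclosure"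
  shows "(\<lambda>x. f x + g x) \<in> uclosure"
  unfolding uclosure_def
proof (intro CollectI allI impI)
  fix e :: real assume e: "e > 0"
  obtain f' where f': "f' \<in> A" "\<And>x. cmod (f x - f' x) < e/2"
    using uclosure_approx[OF f half_gt_zero[OF e]] by blast
  obtain g' where g': "g' \<in> A" "\<And>x. cmod (g x - g' x) < e/2"
    using uclosure_approx[OF g half_gt_zero[OF e]] by blast
  have "cmod (f x + g x - (f' x + g' x)) < e" for x
    using f'(2)[of x] g'(2)[of x] norm_triangle_ineq[of "f x - f' x" "g x - g' x"] by (simp add: add_diff_add)
  then show "\<exists>h\<in>A. \<forall>x. cmod (f x + g x - h x) < e"
    using add[OF f'(1) g'(1)] by (intro bexI[of _ "\<lambda>x. f' x + g' x"]) auto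
qed

lemma uclosure_mult:
  assumes f: "f \<in> uclosure" and g: "g \<in> uclosure"
  shows "(\<lambda>x. f x * g x) \<in> uclosure"
  unfolding uclosure_def
proof (intro CollectI allI impI)
  fix e :: real assume e: "e > 0"
  obtain b where b: "b \<ge> 0" "\<And>x. cmod (g x) \<le> b" using uclosure_bounded[OF g] by blast
  have p1: "e / (2 * (b + 1)) > 0" using e b by simp
  obtain f' where f': "f' \<in> A" "\<And>x. cmod (f x - f' x) < e / (2 * (b + 1))" using uclosure_approx[OF f p1] by blast
  have n0: "nrm f' \<ge> 0" by (rule nrm_nonneg[OF f'(1)])
  have p2: "e / (2 * (nrm f' + 1)) > 0" using e n0 by simp
  obtain g' where g': "g' \<in> A" "\<And>x. cmod (g x - g' x) < e / (2 * (nrm f' + 1))" using uclosure_approx[OF g p2] by blast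
  have "cmod (f x * g x - f' x * g' x) < e" for x
  proof -
    have "f x * g x - f' x * g' x = (f x - f' x) * g x + f' x * (g x - g' x)" by (simp add: algebra_simps)
    then have "cmod (f x * g x - f' x * g' x) \<le> cmod (f x - f' x) * cmod (g x) + cmod (f' x) * cmod (g x - g' x)"
      using norm_triangle_ineq[of "(f x - f' x) * g x" "f' x * (g x - g' x)"] by (simp add: norm_mult)
    also have "\<dots> \<le> e / (2 * (b + 1)) * b + nrm f' * (e / (2 * (nrm f' + 1)))"
      using f'(2)[of x] g'(2)[of x] b n0 p1 p2 cmod_le_nrm[OF f'(1), of x]
      by (intro add_mono mult_mono) (auto simp: less_imp_le)
    also have "e / (2 * (b + 1)) * b < e / 2" using e b by (simp add: field_simps)
    also have "nrm f' * (e / (2 * (nrm f' + 1))) \<le> e / 2" using e n0 by (simp add: field_simps)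
    finally show ?thesis by simp
  qed
  then show "\<exists>h\<in>A. \<forall>x. cmod (f x * g x - h x) < e"
    using mult[OF f'(1) g'(1)] by (intro bexI[of _ "\<lambda>x. f' x * g' x"]) auto
qed

lemma uclosure_cmult: "f \<in> uclosure \<Longrightarrow> (\<lambda>x. c * f x) \<in> uclosure"
  using uclosure_mult[of "\<lambda>x. c" f] subset_uclosure[OF const] by simp

lemma uclosure_continuous:
  assumes g: "g \<in> uclosure"
  shows "continuous_on UNIV g"
proof -
  have "\<exists>f\<in>A. \<forall>x. cmod (g x - f x) < 1 / real (Suc n)" for n
  proof -
    have "1 / real (Suc n) > 0" by simp
    from uclosure_approx[OF g this] show ?thesis by blast
  qed
  then obtain f where f: "\<And>n. f n \<in> A" "\<And>n x. cmod (g x - f n x) < 1 / real (Suc n)" by metis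
  have "uniform_limit UNIV f g sequentially"
  proof (rule uniform_limitI)
    fix e :: real assume "e > 0"
    then have "\<forall>\<^sub>F n in sequentially. 1 / real (Suc n) < e"
      using order_tendstoD(2)[OF LIMSEQ_inverse_real_of_nat, of e] by (simp add: inverse_eq_divide)
    then show "\<forall>\<^sub>F n in sequentially. \<forall>x\<in>UNIV. dist (f n x) (g x) < e"
    proof eventually_elim
      case (elim n)
      show ?case
      proof
        fix x
        show "dist (f n x) (g x) < e"
          using f(2)[of x n] elim by (simp add: dist_norm norm_minus_commute)
      qed
    qed
  qed
  then show ?thesis
    by (rule uniform_limit_theorem[rotated]) (auto intro!: always_eventually continuous f)
qed

lemma uclosure_function_algebra: "function_algebra uclosure supn"
proof
  show "compact (UNIV :: 'm set)" by (rule compact_space)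
  show "continuous_on UNIV f" if "f \<in> uclosure" for f by (rule uclosure_continuous[OF that])
  show "(\<lambda>x. c) \<in> uclosure" for c by (rule subset_uclosure[OF const])
  show "(\<lambda>x. f x + g x) \<in> uclosure" "(\<lambda>x. f x * g x) \<in> uclosure" if "f \<in> uclosure" "g \<in> uclosure" for f g
    using that uclosure_add uclosure_mult by auto
  show "supn (\<lambda>x. f x + g x) \<le> supn f + supn g" if "f \<in> uclosure" "g \<in> uclosure" for f g
    by (rule supn_le, rule order_trans[OF norm_triangle_ineq]) (intro add_mono cmod_le_supn that)
  show "cmod (f x) \<le> supn f" if "f \<in> uclosure" for f x by (rule cmod_le_supn[OF that])
  show "supn (\<lambda>x. c * f x) = cmod c * supn f" if f: "f \<in> uclosure" for f c
  proof (cases "c = 0")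
    case False
    have le: "supn (\<lambda>x. d * g x) \<le> cmod d * supn g" if "g \<in> uclosure" for d g
      by (rule supn_le) (auto simp: norm_mult intro!: mult_left_mono cmod_le_supn that)
    have "supn f = supn (\<lambda>x. (1 / c) * (c * f x))" using False by simp
    also have "\<dots> \<le> cmod (1 / c) * supn (\<lambda>x. c * f x)" by (rule le[OF uclosure_cmult[OF f]])
    finally have "cmod c * supn f \<le> supn (\<lambda>x. c * f x)" using False by (simp add: norm_divide field_simps)
    then show ?thesis using le[OF f, of c] by simp
  qed (simp add: supn_def)
  fix fs :: "nat \<Rightarrow> 'm \<Rightarrow> complex"
  assume fs: "\<And>n. fs n \<in> uclosure"
    and c: "\<And>e. e > 0 \<Longrightarrow> \<exists>N. \<forall>m\<ge>N. \<forall>n\<ge>N. supn (\<lambda>x. fs m x - fs n x) < e"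
  have d: "(\<lambda>x. fs m x - fs n x) \<in> uclosure" for m n
    using uclosure_add[OF fs[of m] uclosure_cmult[OF fs[of n], of "-1"]] by simp
  have unif: "\<exists>N. \<forall>m\<ge>N. \<forall>n\<ge>N. \<forall>x. cmod (fs m x - fs n x) < e" if "e > 0" for e
    using c[OF that] cmod_le_supn[OF d] by (meson le_less_trans)
  have "convergent (\<lambda>n. fs n x)" for x
  proof (rule Cauchy_convergent, rule metric_CauchyI)
    fix e :: real assume "e > 0"
    then show "\<exists>M. \<forall>m\<ge>M. \<forall>n\<ge>M. dist (fs m x) (fs n x) < e"
      using unif[of e] by (auto simp: dist_norm)
  qed
  then obtain g where g: "\<And>x. (\<lambda>n. fs n x) \<longlonglongrightarrow> g x" unfolding convergent_def by metis
  have lim: "\<exists>N. \<forall>m\<ge>N. \<forall>x. cmod (fs m x - g x) \<le> e" if e: "e > 0" for e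
  proof -
    obtain N where N: "\<And>m n x. m \<ge> N \<Longrightarrow> n \<ge> N \<Longrightarrow> cmod (fs m x - fs n x) < e" using unif[OF e] by blast
    have "cmod (fs m x - g x) \<le> e" if "m \<ge> N" for m x
    proof (rule tendsto_upperbound)
      show "(\<lambda>n. cmod (fs m x - fs n x)) \<longlonglongrightarrow> cmod (fs m x - g x)" by (intro tendsto_intros g)
      show "\<forall>\<^sub>F n in sequentially. cmod (fs m x - fs n x) \<le> e"
        using N[OF that] by (intro eventually_sequentiallyI[of N]) (simp add: less_imp_le)
    qed simp
    then show ?thesis by blast
  qed
  have gu: "g \<in> uclosure"
  proof (rule uclosure_closed)
    fix e :: real assume e: "e > 0"
    obtain N where "\<And>x. cmod (fs N x - g x) \<le> e/2" using lim[of "e/2"] e by auto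
    then have "cmod (g x - fs N x) < e" for x using e by (smt (verit) field_sum_of_halves norm_minus_commute)
    then show "\<exists>f\<in>uclosure. \<forall>x. cmod (g x - f x) < e" using fs by blast
  qed
  moreover have "(\<lambda>n. supn (\<lambda>x. fs n x - g x)) \<longlonglongrightarrow> 0"
  proof (rule LIMSEQ_I)
    fix r :: real assume r: "r > 0"
    obtain N where N: "\<And>m x. m \<ge> N \<Longrightarrow> cmod (fs m x - g x) \<le> r/2" using lim[of "r/2"] r by auto
    have "norm (supn (\<lambda>x. fs n x - g x) - 0) < r" if "n \<ge> N" for n
    proof -
      have u: "(\<lambda>x. fs n x - g x) \<in> uclosure"
        using uclosure_add[OF fs[of n] uclosure_cmult[OF gu, of "-1"]] by simp
      have "supn (\<lambda>x. fs n x - g x) \<le> r/2" by (rule supn_le) (rule N[OF that])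
      moreover have "supn (\<lambda>x. fs n x - g x) \<ge> 0"
        using cmod_le_supn[OF u, of undefined] norm_ge_zero order_trans by blast
      ultimately show ?thesis using r by simp
    qed
    then show "\<exists>no. \<forall>n\<ge>no. norm (supn (\<lambda>x. fs n x - g x) - 0) < r" by blast
  qed
  ultimately show "\<exists>f\<in>uclosure. (\<lambda>n. supn (\<lambda>x. fs n x - f x)) \<longlonglongrightarrow> 0" by blast
qed

end

section \<open>Transfer between the algebra and its uniform closure\<close>

context weighted_composition
begin

text \<open>In the sup norm one term of the Leibniz sum already dominates the product, and
  composition does not increase the norm, so C and the constant in \<open>growth\<close> can be 1.
  Peaking functions are taken from the subalgebra.\<close>

lemma uclosure_instance: "weighted_composition uclosure supn 1 phi psi w"
proof -
  interpret B: function_algebra uclosure supn by (rule uclosure_function_algebra)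
  show ?thesis
  proof (unfold_locales)
    fix p :: nat and fs :: "nat \<Rightarrow> 'm \<Rightarrow> complex" and \<beta> :: "nat \<Rightarrow> real"
    assume p: "1 \<le> p" and fs: "\<And>j. j < p \<Longrightarrow> fs j \<in> uclosure"
      and \<beta>: "\<And>j x. j < p \<Longrightarrow> cmod (\<Prod>k\<in>{..<p} - {j}. fs k x) \<le> \<beta> j"
    have \<beta>0: "\<beta> j \<ge> 0" if "j < p" for j using \<beta>[OF that, of undefined] norm_ge_zero order_trans by blast
    have "supn (\<lambda>x. \<Prod>j<p. fs j x) \<le> supn (fs 0) * \<beta> 0"
    proof (rule supn_le)
      fix x
      have "(\<Prod>j<p. fs j x) = fs 0 x * (\<Prod>k\<in>{..<p} - {0}. fs k x)" by (rule prod.remove) (use p in auto)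
      then have "cmod (\<Prod>j<p. fs j x) = cmod (fs 0 x) * cmod (\<Prod>k\<in>{..<p} - {0}. fs k x)" by (simp only: norm_mult)
      also have "\<dots> \<le> supn (fs 0) * \<beta> 0"
        using p by (intro mult_mono cmod_le_supn fs \<beta> B.nrm_nonneg) auto
      finally show "cmod (\<Prod>j<p. fs j x) \<le> supn (fs 0) * \<beta> 0" .
    qed
    also have "\<dots> \<le> (\<Sum>j<p. supn (fs j) * \<beta> j)"
      by (rule member_le_sum) (use p fs \<beta>0 in auto)
    finally show "supn (\<lambda>x. \<Prod>j<p. fs j x) \<le> 1 * (\<Sum>j<p. supn (fs j) * \<beta> j)" by simp
  next
    fix V :: "'m set" and t and \<eta> :: real assume "open V" "t \<in> V" "\<eta> > 0"
    then show "\<exists>g\<in>uclosure. g t = 1 \<and> (\<forall>x. cmod (g x) \<le> 2) \<and> (\<forall>x. x \<notin> V \<longrightarrow> cmod (g x) \<le> \<eta>)"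
      using peak subset_uclosure by meson
  next
    fix \<theta> :: real assume \<theta>: "1 < \<theta>"
    have le: "supn (\<lambda>x. f (\<sigma> x)) \<le> 1 * \<theta> ^ n * supn f" if "f \<in> uclosure" for f n and \<sigma> :: "'m \<Rightarrow> 'm"
    proof -
      have "supn (\<lambda>x. f (\<sigma> x)) \<le> supn f" by (rule supn_le) (rule cmod_le_supn[OF that])
      also have "\<dots> \<le> \<theta> ^ n * supn f" using \<theta> that B.nrm_nonneg[OF that] mult_right_mono[of 1 "\<theta> ^ n" "supn f"] by simp
      finally show ?thesis by simp
    qed
    then show "\<exists>K\<ge>1. \<forall>n. \<forall>f\<in>uclosure. supn (\<lambda>x. f ((phi ^^ n) x)) \<le> K * \<theta> ^ n * supn f \<and>
        supn (\<lambda>x. f ((psi ^^ n) x)) \<le> K * \<theta> ^ n * supn f"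
      by (intro exI[of _ 1]) auto
  next
    show "(\<lambda>x. f (phi x)) \<in> uclosure" if "f \<in> uclosure" for f by (rule uclosure_comp[OF comp_phi that])
    show "(\<lambda>x. f (psi x)) \<in> uclosure" if "f \<in> uclosure" for f by (rule uclosure_comp[OF comp_psi that])
    show "w \<in> uclosure" "(\<lambda>x. 1 / w x) \<in> uclosure" by (intro subset_uclosure w_closed w_inverse)+
  qed (use phi_psi continuous_phi continuous_psi aperiodic_dense w_nz in auto)
qed

text \<open>The inverse of T is a weighted composition operator along psi. Expansion of T off F is
  contraction of the inverse, so \<open>half_inverse\<close> covers both halves.\<close>

lemma inverse_instance: "weighted_composition A nrm C psi phi (\<lambda>x. 1 / w (psi x))"
proof (unfold_locales)
  show "\<exists>y\<in>W. \<forall>n\<ge>1. (psi ^^ n) y \<noteq> y" if "open W" "W \<noteq> {}" for W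
    using aperiodic_dense[OF that] phi_pow_psi_pow by metis
  show "\<exists>K\<ge>1. \<forall>n. \<forall>f\<in>A. nrm (\<lambda>x. f ((psi ^^ n) x)) \<le> K * \<theta> ^ n * nrm f \<and>
      nrm (\<lambda>x. f ((phi ^^ n) x)) \<le> K * \<theta> ^ n * nrm f" if "\<theta> > 1" for \<theta>
    using growth[OF that] by blast
  show "(\<lambda>x. 1 / w (psi x)) \<in> A" using comp_psi[OF w_inverse] by simp
  show "(\<lambda>x. 1 / (1 / w (psi x))) \<in> A" using comp_psi[OF w_closed] by simp
qed (use peak continuous_phi continuous_psi comp_phi comp_psi in auto)

text \<open>F is handled with T, its complement with the inverse R of T; the identity R - 1 = -R(T -
  1) converts lower bounds and solutions for R into those for T.\<close>

lemma dichotomy_invertible: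
  assumes L: "L \<ge> 1" and inv: "\<And>x. phi x \<in> F \<longleftrightarrow> x \<in> F"
    and small: "\<And>x. x \<in> F \<Longrightarrow> cmod (P L x) \<le> 1/2" and big: "\<And>x. x \<notin> F \<Longrightarrow> cmod (P L x) \<ge> 2"
    and \<chi>: "indicator F \<in> A"
  shows "\<exists>K. \<forall>g\<in>A. nrm g \<le> K * nrm (\<lambda>x. w x * g (phi x) - g x)"
    and "f \<in> A \<Longrightarrow> \<exists>g\<in>A. (\<lambda>x. w x * g (phi x) - g x) = f"
proof -
  define w' where "w' = (\<lambda>x. 1 / w (psi x))"
  interpret R: weighted_composition A nrm C psi phi w' unfolding w'_def by (rule inverse_instance)
  have invp: "psi x \<in> - F \<longleftrightarrow> x \<in> - F" for x using inv[of "psi x"] by simp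
  have invpn: "(psi ^^ k) x \<in> F \<longleftrightarrow> x \<in> F" for k x
    by (induction k) (use invp in auto)
  have RP: "R.P n x = 1 / P n ((psi ^^ n) x)" for n x
  proof (induction n)
    case (Suc n)
    have "P (Suc n) ((psi ^^ Suc n) x) = w ((psi ^^ Suc n) x) * P n ((psi ^^ n) x)"
      unfolding P_Suc' by simp
    moreover have "w' ((psi ^^ n) x) = 1 / w ((psi ^^ Suc n) x)" by (simp add: w'_def)
    ultimately show ?case using Suc by (simp add: R.P_Suc)
  qed simp
  have smallp: "cmod (R.P L x) \<le> 1/2" if "x \<in> - F" for x
    unfolding RP using big[of "(psi ^^ L) x"] that invpn[of L x] by (auto simp: norm_divide divide_simps)
  have \<chi>': "indicator (- F) \<in> A"
  proof -
    have "(indicator (- F) :: 'm \<Rightarrow> complex) = (\<lambda>x. 1 - indicator F x)" by (auto simp: indicator_def)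
    then show ?thesis using diff[OF const \<chi>, of 1] by simp
  qed
  obtain K1 where K1: "K1 \<ge> 0" "\<And>g. g \<in> A \<Longrightarrow> nrm (\<lambda>x. indicator F x * g x) \<le> K1 * nrm (\<lambda>x. w x * g (phi x) - g x)"
    using half_inverse(1)[OF L inv small \<chi>] by blast
  obtain K2 where K2: "K2 \<ge> 0" "\<And>g. g \<in> A \<Longrightarrow> nrm (\<lambda>x. indicator (- F) x * g x) \<le> K2 * nrm (\<lambda>x. w' x * g (psi x) - g x)"
    using R.half_inverse(1)[OF L invp smallp \<chi>'] by blast
  obtain Kp where Kp: "Kp \<ge> 1" "\<And>f. f \<in> A \<Longrightarrow> nrm (\<lambda>x. f (psi x)) \<le> Kp * nrm f"
    using composition_bounded[of psi] comp_psi by blast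
  define c where "c = 2 * C * nrm w' * Kp"
  have w'A: "w' \<in> A" by (rule R.w_closed)
  have c0: "c \<ge> 0" using C Kp(1) nrm_nonneg[OF w'A] by (simp add: c_def)
  have inner: "nrm (\<lambda>x. w' x * g (psi x) - g x) \<le> c * nrm (\<lambda>x. w x * g (phi x) - g x)" if g: "g \<in> A" for g
  proof -
    define d where "d = (\<lambda>x. w x * g (phi x) - g x)"
    have d: "d \<in> A" unfolding d_def by (intro diff mult w_closed comp_phi g)
    have e: "(\<lambda>x. w' x * g (psi x) - g x) = (\<lambda>x. - (w' x * d (psi x)))"
      by (auto simp: d_def w'_def divide_simps)
    have "nrm (\<lambda>x. w' x * g (psi x) - g x) = nrm (\<lambda>x. w' x * d (psi x))"
      unfolding e by (rule nrm_uminus) (intro mult w'A comp_psi d)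
    also have "\<dots> \<le> 2 * C * nrm w' * nrm (\<lambda>x. d (psi x))" by (rule nrm_mult[OF w'A comp_psi[OF d]])
    also have "\<dots> \<le> 2 * C * nrm w' * (Kp * nrm d)"
      using C nrm_nonneg[OF w'A] by (intro mult_left_mono Kp d) auto
    finally show ?thesis by (simp add: c_def d_def mult.assoc)
  qed
  show "\<exists>K. \<forall>g\<in>A. nrm g \<le> K * nrm (\<lambda>x. w x * g (phi x) - g x)"
  proof (intro exI[of _ "K1 + K2 * c"] ballI)
    fix g assume g: "g \<in> A"
    have "g = (\<lambda>x. indicator F x * g x + indicator (- F) x * g x)" by (auto simp: indicator_def)
    then have "nrm g \<le> nrm (\<lambda>x. indicator F x * g x) + nrm (\<lambda>x. indicator (- F) x * g x)"
      using nrm_add[OF mult[OF \<chi> g] mult[OF \<chi>' g]] by simp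
    also have "\<dots> \<le> K1 * nrm (\<lambda>x. w x * g (phi x) - g x) + K2 * (c * nrm (\<lambda>x. w x * g (phi x) - g x))"
      by (intro add_mono K1 g order_trans[OF K2(2)[OF g]] mult_left_mono inner K2(1))
    finally show "nrm g \<le> (K1 + K2 * c) * nrm (\<lambda>x. w x * g (phi x) - g x)" by (simp add: algebra_simps)
  qed
  show "\<exists>g\<in>A. (\<lambda>x. w x * g (phi x) - g x) = f" if f: "f \<in> A"
  proof -
    obtain g1 where g1: "g1 \<in> A" "\<And>x. w x * g1 (phi x) - g1 x = indicator F x * f x"
      using half_inverse(2)[OF L inv small \<chi> f] by (auto simp: fun_eq_iff)
    obtain g2 where g2: "g2 \<in> A" "\<And>x. w' x * g2 (psi x) - g2 x = indicator (- F) x * f x"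
      using R.half_inverse(2)[OF L invp smallp \<chi>' f] by (auto simp: fun_eq_iff)
    define h where "h = (\<lambda>x. g1 x - w' x * g2 (psi x))"
    have h: "h \<in> A" unfolding h_def by (intro diff g1 mult w'A comp_psi g2)
    have "w x * h (phi x) - h x = f x" for x
    proof -
      have "w x * h (phi x) - h x = (w x * g1 (phi x) - g1 x) + (w' x * g2 (psi x) - g2 x)"
        by (simp add: h_def w'_def algebra_simps)
      also have "\<dots> = f x" unfolding g1(2) g2(2) by (auto simp: indicator_def)
      finally show ?thesis .
    qed
    then show ?thesis using h by blast
  qed
qed

text \<open>From the algebra to the closure: the dichotomy gives a lower bound in the sup norm, so
  solutions for approximating right-hand sides converge uniformly. From the closure to the algebra:
  the dichotomy makes T - \<zeta> invertible on the closure for the whole circle, which makes the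
  indicator of F a uniform limit of elements of \<open>A\<close>, hence an element of
  \<open>A\<close>, and the two Neumann series then run in \<open>nrm\<close>.\<close>

theorem invertible_iff:
  "(\<forall>f\<in>A. \<exists>g\<in>A. (\<lambda>x. w x * g (phi x) - g x) = f) \<and>
   (\<exists>K. \<forall>g\<in>A. nrm g \<le> K * nrm (\<lambda>x. w x * g (phi x) - g x)) \<longleftrightarrow>
   (\<forall>f\<in>uclosure. \<exists>g\<in>uclosure. (\<lambda>x. w x * g (phi x) - g x) = f) \<and>
   (\<exists>K. \<forall>g\<in>uclosure. supn g \<le> K * supn (\<lambda>x. w x * g (phi x) - g x))" (is "?A \<longleftrightarrow> ?B")
proof
  interpret B: weighted_composition uclosure supn 1 phi psi w by (rule uclosure_instance)
  have DB: "(\<lambda>x. w x * g (phi x) - \<zeta> * g x) \<in> uclosure" if "g \<in> uclosure" for g \<zeta>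
    by (rule B.diff[OF B.mult[OF B.w_closed B.comp_phi[OF that]] B.cmult[OF that]])
  {
    assume ?A
    then obtain K where surj: "\<And>f. f \<in> A \<Longrightarrow> \<exists>g\<in>A. (\<lambda>x. w x * g (phi x) - g x) = f"
      and K: "\<And>g. g \<in> A \<Longrightarrow> nrm g \<le> K * nrm (\<lambda>x. w x * g (phi x) - g x)" by auto
    have K': "nrm g \<le> max K 1 * nrm (\<lambda>x. w x * g (phi x) - g x)" if g: "g \<in> A" for g
    proof -
      have "(\<lambda>x. w x * g (phi x) - g x) \<in> A" by (intro diff mult w_closed comp_phi g)
      then have "K * nrm (\<lambda>x. w x * g (phi x) - g x) \<le> max K 1 * nrm (\<lambda>x. w x * g (phi x) - g x)"
        by (intro mult_right_mono) auto
      then show ?thesis using K[OF g] by linarith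
    qed
    obtain L F where L: "L \<ge> 1" "\<And>x. phi x \<in> F \<longleftrightarrow> x \<in> F"
      "\<And>x. x \<in> F \<Longrightarrow> cmod (P L x) \<le> 1/2" "\<And>x. x \<notin> F \<Longrightarrow> cmod (P L x) \<ge> 2"
      by (rule dichotomy[OF _ K' surj]) auto
    define M where "M = 2 * real L * omega ^ L"
    have M0: "M \<ge> 0" using omega(1) by (simp add: M_def)
    have bd: "cmod (g x) \<le> M * s" if g: "g \<in> uclosure" and s: "\<And>x. cmod (w x * g (phi x) - g x) \<le> s" for g s x
    proof -
      obtain b where b: "\<And>x. cmod (g x) \<le> b" using uclosure_bounded[OF g] by blast
      show ?thesis unfolding M_def
        by (rule dichotomy_sup_bound[OF L, of 1 g b]) (use b s in auto)
    qed
    have below: "supn g \<le> M * supn (\<lambda>x. w x * g (phi x) - g x)" if g: "g \<in> uclosure" for g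
      by (rule supn_le, rule bd[OF g]) (use cmod_le_supn[OF DB[OF g, of 1]] in simp)
    have "\<exists>g\<in>uclosure. (\<lambda>x. w x * g (phi x) - g x) = f" if f: "f \<in> uclosure" for f
    proof -
      have "\<exists>h\<in>A. \<forall>x. cmod (f x - h x) < (1/2) ^ n" for n :: nat
      proof -
        have "(1/2::real) ^ n > 0" by simp
        from uclosure_approx[OF f this] show ?thesis by blast
      qed
      then obtain h where h: "\<And>n. h n \<in> A" "\<And>n x. cmod (f x - h n x) < (1/2) ^ n" by metis
      have "\<exists>g\<in>A. \<forall>x. w x * g (phi x) - g x = h n x" for n
        using surj[OF h(1)[of n]] by (auto simp: fun_eq_iff)
      then obtain g where g: "\<And>n. g n \<in> A" "\<And>n x. w x * g n (phi x) - g n x = h n x" by metis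
      have gu: "g n \<in> uclosure" for n by (rule subset_uclosure[OF g(1)])
      have step: "supn (\<lambda>x. g (Suc n) x - g n x) \<le> M * 2 * (1/2) ^ n" for n
      proof (rule supn_le)
        fix x
        have "cmod (g (Suc n) x - g n x) \<le> M * (2 * (1/2) ^ n)"
        proof (rule bd[OF B.diff[OF gu gu]])
          fix x
          have "w x * (g (Suc n) (phi x) - g n (phi x)) - (g (Suc n) x - g n x) = (f x - h n x) - (f x - h (Suc n) x)"
            using g(2)[of x n] g(2)[of x "Suc n"] by (simp add: algebra_simps)
          then show "cmod (w x * (g (Suc n) (phi x) - g n (phi x)) - (g (Suc n) x - g n x)) \<le> 2 * (1/2) ^ n"
            using norm_triangle_ineq4[of "f x - h n x" "f x - h (Suc n) x"] h(2)[of x n] h(2)[of x "Suc n"]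
            by (simp add: power_Suc) (smt (verit) zero_le_power divide_nonneg_nonneg)
        qed
        then show "cmod (g (Suc n) x - g n x) \<le> M * 2 * (1/2) ^ n" by simp
      qed
      obtain u where u: "u \<in> uclosure" "\<And>x. (\<lambda>n. g n x) \<longlonglongrightarrow> u x"
        by (rule B.geometric_limit[OF gu step]) auto
      have "w x * u (phi x) - u x = f x" for x
      proof (rule LIMSEQ_unique)
        show "(\<lambda>n. w x * g n (phi x) - g n x) \<longlonglongrightarrow> w x * u (phi x) - u x" by (intro tendsto_intros u)
        have "(\<lambda>n. f x - h n x) \<longlonglongrightarrow> 0"
          by (rule Lim_null_comparison[of _ "\<lambda>n. (1/2) ^ n"])
            (use h(2) in \<open>auto intro!: always_eventually LIMSEQ_power_zero simp: less_imp_le\<close>)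
        from tendsto_diff[OF tendsto_const[of "f x"] this]
        show "(\<lambda>n. w x * g n (phi x) - g n x) \<longlonglongrightarrow> f x" by (simp add: g(2))
      qed
      then show ?thesis using u(1) by blast
    qed
    then show ?B using below by blast
  next
    assume ?B
    then obtain K where surj: "\<And>f. f \<in> uclosure \<Longrightarrow> \<exists>g\<in>uclosure. (\<lambda>x. w x * g (phi x) - g x) = f"
      and K: "\<And>g. g \<in> uclosure \<Longrightarrow> supn g \<le> K * supn (\<lambda>x. w x * g (phi x) - g x)" by auto
    have K': "supn g \<le> max K 1 * supn (\<lambda>x. w x * g (phi x) - g x)" if g: "g \<in> uclosure" for g
    proof -
      have "0 \<le> supn (\<lambda>x. w x * g (phi x) - g x)" using B.nrm_nonneg[OF DB[OF g, of 1]] by simp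
      then have "K * supn (\<lambda>x. w x * g (phi x) - g x) \<le> max K 1 * supn (\<lambda>x. w x * g (phi x) - g x)"
        by (intro mult_right_mono) auto
      then show ?thesis using K[OF g] by linarith
    qed
    obtain L F where L: "L \<ge> 1" "\<And>x. phi x \<in> F \<longleftrightarrow> x \<in> F"
      "\<And>x. x \<in> F \<Longrightarrow> cmod (P L x) \<le> 1/2" "\<And>x. x \<notin> F \<Longrightarrow> cmod (P L x) \<ge> 2"
      by (rule B.dichotomy[OF _ K' surj]) auto
    define M where "M = 2 * real L * omega ^ L"
    have M1: "M \<ge> 1"
    proof -
      have "1 * 1 \<le> 2 * real L * omega ^ L" using L(1) omega(1) by (intro mult_mono) auto
      then show ?thesis by (simp add: M_def)
    qed
    have below: "supn g \<le> M * supn (\<lambda>x. w x * g (phi x) - \<zeta> * g x)" if g: "g \<in> uclosure" "cmod \<zeta> = 1" for g \<zeta>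
    proof (rule supn_le)
      fix x
      obtain b where b: "\<And>x. cmod (g x) \<le> b" using uclosure_bounded[OF g(1)] by blast
      show "cmod (g x) \<le> M * supn (\<lambda>x. w x * g (phi x) - \<zeta> * g x)" unfolding M_def
        by (rule dichotomy_sup_bound[OF L g(2) b]) (use cmod_le_supn[OF DB[OF g(1)]] in auto)
    qed
    have csurj: "\<exists>g\<in>uclosure. (\<lambda>x. w x * g (phi x) - \<zeta> * g x) = f" if "f \<in> uclosure" "cmod \<zeta> = 1" for f \<zeta>
      by (rule B.circle_surj[OF M1 below surj that(2,1)])
    have "indicator F \<in> A"
    proof (rule idempotent_closed)
      fix \<delta> :: real assume \<delta>: "\<delta> > 0"
      obtain u where u: "u \<in> uclosure" "\<And>x. cmod (u x - indicator F x) \<le> \<delta>/2"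
        using B.indicator_approx[OF L csurj, of "\<delta>/2"] \<delta> by auto
      obtain f where f: "f \<in> A" "\<And>x. cmod (u x - f x) < \<delta>/2" using uclosure_approx[OF u(1), of "\<delta>/2"] \<delta> by auto
      have "cmod (f x - indicator F x) \<le> \<delta>" for x
        using u(2)[of x] f(2)[of x] norm_triangle_ineq4[of "u x - indicator F x" "u x - f x"] by simp
      then show "\<exists>f\<in>A. \<forall>x. cmod (f x - indicator F x) \<le> \<delta>" using f(1) by blast
    qed
    then show ?A using dichotomy_invertible[OF L] by blast
  }
qed

text \<open>Dividing w by lam reduces every nonzero lam to 1; this settles lam = 0, where the
  inverse is explicit.\<close>

lemma zero_invertible:
  shows "f \<in> A \<Longrightarrow> \<exists>g\<in>A. (\<lambda>x. w x * g (phi x)) = f"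
    and "\<exists>K. \<forall>g\<in>A. nrm g \<le> K * nrm (\<lambda>x. w x * g (phi x))"
proof -
  show "\<exists>g\<in>A. (\<lambda>x. w x * g (phi x)) = f" if f: "f \<in> A"
    by (rule bexI[of _ "\<lambda>x. 1 / w (psi x) * f (psi x)"])
      (use mult[OF comp_psi[OF w_inverse] comp_psi[OF f]] in auto)
  obtain Kp where Kp: "Kp \<ge> 1" "\<And>f. f \<in> A \<Longrightarrow> nrm (\<lambda>x. f (psi x)) \<le> Kp * nrm f"
    using composition_bounded[of psi] comp_psi by blast
  show "\<exists>K. \<forall>g\<in>A. nrm g \<le> K * nrm (\<lambda>x. w x * g (phi x))"
  proof (intro exI[of _ "Kp * (2 * C * nrm (\<lambda>x. 1 / w x))"] ballI)
    fix g assume g: "g \<in> A"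
    define d where "d = (\<lambda>x. w x * g (phi x))"
    have d: "d \<in> A" unfolding d_def by (intro mult w_closed comp_phi g)
    have q: "(\<lambda>x. 1 / w x * d x) \<in> A" by (intro mult w_inverse d)
    have "nrm g = nrm (\<lambda>x. (\<lambda>x. 1 / w x * d x) (psi x))" by (simp add: d_def)
    also have "\<dots> \<le> Kp * nrm (\<lambda>x. 1 / w x * d x)" by (rule Kp(2)[OF q])
    also have "\<dots> \<le> Kp * (2 * C * nrm (\<lambda>x. 1 / w x) * nrm d)"
      using Kp(1) by (intro mult_left_mono nrm_mult w_inverse d) auto
    finally show "nrm g \<le> Kp * (2 * C * nrm (\<lambda>x. 1 / w x)) * nrm (\<lambda>x. w x * g (phi x))"
      by (simp add: d_def mult.assoc)
  qed
qed

end

section \<open>The spectrum of \<open>wU\<close>\<close>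

lemma regular_shilov_boundary:
  assumes "regular_alg A"
  shows "shilov_boundary A = UNIV"
proof -
  have "S = UNIV" if S: "closed S" "is_boundary A S" for S
  proof (rule ccontr)
    assume "S \<noteq> UNIV"
    then obtain x where "x \<notin> S" by blast
    then obtain f where f: "f \<in> A" "f x \<noteq> 0" "\<forall>y\<in>S. f y = 0"
      using assms S(1) unfolding regular_alg_def by blast
    obtain s where "s \<in> S" "cmod (f x) \<le> cmod (f s)" using S(2) f(1) unfolding is_boundary_def by blast
    then show False using f by simp
  qed
  then show ?thesis unfolding shilov_boundary_def by blast
qed

lemma semisimple_banach_algD:
  fixes A :: "('m::t2_space \<Rightarrow> complex) set"
  assumes "semisimple_banach_alg A nrm"
  shows "compact (UNIV :: 'm set)"
    and "\<forall>f\<in>A. continuous_on UNIV f"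
    and "\<forall>c. (\<lambda>x. c) \<in> A"
    and "\<forall>f\<in>A. \<forall>g\<in>A. (\<lambda>x. f x + g x) \<in> A \<and> (\<lambda>x. f x * g x) \<in> A"
    and "\<forall>c. \<forall>f\<in>A. (\<lambda>x. c * f x) \<in> A"
    and "\<forall>f\<in>A. 0 \<le> nrm f \<and> (nrm f = 0 \<longleftrightarrow> f = (\<lambda>x. 0))"
    and "\<forall>f\<in>A. \<forall>g\<in>A. nrm (\<lambda>x. f x + g x) \<le> nrm f + nrm g"
    and "\<forall>f\<in>A. \<forall>g\<in>A. nrm (\<lambda>x. f x * g x) \<le> nrm f * nrm g"
    and "\<forall>c. \<forall>f\<in>A. nrm (\<lambda>x. c * f x) = cmod c * nrm f"
    and "nrm (\<lambda>x. 1) = 1"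
    and "\<forall>fs. (\<forall>n. fs n \<in> A) \<and> (\<forall>e>0. \<exists>N. \<forall>m\<ge>N. \<forall>n\<ge>N. nrm (\<lambda>x. fs m x - fs n x) < e)
           \<longrightarrow> (\<exists>f\<in>A. (\<lambda>n. nrm (\<lambda>x. fs n x - f x)) \<longlonglongrightarrow> 0)"
    and "\<forall>x y. x \<noteq> y \<longrightarrow> (\<exists>f\<in>A. f x \<noteq> f y)"
  using assms[unfolded semisimple_banach_alg_def] by - (elim conjE, assumption)+

text \<open>If \<open>\<bar>f x\<bar>\<close> exceeded the norm of \<open>f\<close>, then \<open>1 - f / f x\<close> would be invertible by a Neumann series.\<close>

lemma cmod_le_banach_norm:
  assumes alg: "semisimple_banach_alg A nrm" and f: "f \<in> A"
  shows "cmod (f x) \<le> nrm f"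
proof (rule ccontr)
  assume neg: "\<not> ?thesis"
  note ax = semisimple_banach_algD[OF alg]
  have const: "(\<lambda>x. c) \<in> A" for c using ax(3) by simp
  have add: "(\<lambda>x. f x + g x) \<in> A" if "f \<in> A" "g \<in> A" for f g using ax(4) that by simp
  have mult: "(\<lambda>x. f x * g x) \<in> A" if "f \<in> A" "g \<in> A" for f g using ax(4) that by simp
  have cmult: "(\<lambda>x. c * f x) \<in> A" if "f \<in> A" for f c using ax(5) that by simp
  have nonneg: "0 \<le> nrm f" if "f \<in> A" for f using ax(6) that by simp
  have nrm_add: "nrm (\<lambda>x. f x + g x) \<le> nrm f + nrm g" if "f \<in> A" "g \<in> A" for f g using ax(7) that by simp
  have nrm_mult: "nrm (\<lambda>x. f x * g x) \<le> nrm f * nrm g" if "f \<in> A" "g \<in> A" for f g using ax(8) that by simp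
  have nrm_cmult: "nrm (\<lambda>x. c * f x) = cmod c * nrm f" if "f \<in> A" for f c using ax(9) that by simp
  have diff: "(\<lambda>x. f x - g x) \<in> A" if "f \<in> A" "g \<in> A" for f g
    using add[OF that(1) cmult[OF that(2), of "-1"]] by simp
  have fx: "f x \<noteq> 0" using neg nonneg[OF f] by auto
  define g where "g = (\<lambda>y. (1 / f x) * f y)"
  have g: "g \<in> A" unfolding g_def by (rule cmult[OF f])
  define r where "r = nrm g"
  have "r = nrm f / cmod (f x)" unfolding r_def g_def nrm_cmult[OF f] by (simp add: norm_divide)
  then have r: "0 \<le> r" "r < 1" using neg nonneg[OF g] fx by (auto simp: r_def)
  have pw: "(\<lambda>y. g y ^ k) \<in> A \<and> nrm (\<lambda>y. g y ^ k) \<le> r ^ k" for k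
  proof (induction k)
    case (Suc k)
    have "nrm (\<lambda>y. g y * g y ^ k) \<le> r * nrm (\<lambda>y. g y ^ k)" using nrm_mult[OF g, of "\<lambda>y. g y ^ k"] Suc by (simp add: r_def)
    also have "\<dots> \<le> r * r ^ k" using Suc r by (intro mult_left_mono) auto
    finally show ?case using mult[OF g, of "\<lambda>y. g y ^ k"] Suc by simp
  qed (use const ax(10) in simp)
  define s where "s n = (\<lambda>y. \<Sum>k<n. g y ^ k)" for n
  have sA: "s n \<in> A" for n
  proof (induction n)
    case (Suc n)
    then show ?case using add[OF Suc conjunct1[OF pw[of n]]] by (simp add: s_def)
  qed (use const in \<open>simp add: s_def\<close>)
  have tail: "nrm (\<lambda>y. s (n + k) y - s n y) \<le> r ^ n / (1 - r)" for n k
  proof -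
    have e: "nrm (\<lambda>y. s (n + k) y - s n y) \<le> (\<Sum>j<k. r ^ (n + j))"
    proof (induction k)
      case 0
      then show ?case using nrm_cmult[OF const, of 0] by simp
    next
      case (Suc k)
      have "(\<lambda>y. s (n + Suc k) y - s n y) = (\<lambda>y. (s (n + k) y - s n y) + g y ^ (n + k))"
        by (simp add: s_def algebra_simps)
      then have "nrm (\<lambda>y. s (n + Suc k) y - s n y) \<le> nrm (\<lambda>y. s (n + k) y - s n y) + nrm (\<lambda>y. g y ^ (n + k))"
        using nrm_add[OF diff[OF sA sA] conjunct1[OF pw[of "n + k"]], of "n + k" n] by simp
      then show ?case using Suc conjunct2[OF pw[of "n + k"]] by simp
    qed
    also have "\<dots> = r ^ n * (\<Sum>j<k. r ^ j)" by (simp add: power_add sum_distrib_left)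
    also have "\<dots> \<le> r ^ n * (1 / (1 - r))"
      using r by (intro mult_left_mono) (auto simp: sum_gp_strict divide_right_mono)
    finally show ?thesis by simp
  qed
  have "\<forall>e>0. \<exists>N. \<forall>m\<ge>N. \<forall>n\<ge>N. nrm (\<lambda>y. s m y - s n y) < e"
  proof (intro allI impI)
    fix e :: real assume e: "e > 0"
    have "(\<lambda>n. r ^ n / (1 - r)) \<longlonglongrightarrow> 0 / (1 - r)" by (intro tendsto_intros LIMSEQ_power_zero) (use r in auto)
    then have "\<forall>\<^sub>F n in sequentially. r ^ n / (1 - r) < e" using e by (auto dest: order_tendstoD(2))
    then obtain N where N: "\<And>n. n \<ge> N \<Longrightarrow> r ^ n / (1 - r) < e" by (auto simp: eventually_sequentially)
    have "nrm (\<lambda>y. s m y - s n y) < e" if "m \<ge> N" "n \<ge> N" for m n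
    proof (cases "n \<le> m")
      case True
      then show ?thesis using tail[of n "m - n"] N[OF that(2)] by simp
    next
      case False
      have "nrm (\<lambda>y. s m y - s n y) = nrm (\<lambda>y. s n y - s m y)"
        using nrm_cmult[OF diff[OF sA sA], of "-1" n m] by simp
      then show ?thesis using tail[of m "n - m"] N[OF that(1)] False by simp
    qed
    then show "\<exists>N. \<forall>m\<ge>N. \<forall>n\<ge>N. nrm (\<lambda>y. s m y - s n y) < e" by blast
  qed
  then obtain h where h: "h \<in> A" "(\<lambda>n. nrm (\<lambda>y. s n y - h y)) \<longlonglongrightarrow> 0" using ax(11) sA by blast
  define q where "q = (\<lambda>y. 1 - g y)"
  have q: "q \<in> A" unfolding q_def by (rule diff[OF const g])
  define d where "d = (\<lambda>y. 1 - q y * h y)"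
  have dA: "d \<in> A" unfolding d_def by (intro diff const mult q h)
  have "nrm d \<le> r ^ n + nrm q * nrm (\<lambda>y. s n y - h y)" for n
  proof -
    have "q y * s n y = 1 - g y ^ n" for y
      unfolding q_def s_def by (rule one_diff_power_eq[symmetric])
    then have "d = (\<lambda>y. g y ^ n + q y * (s n y - h y))" by (auto simp: d_def right_diff_distrib)
    then have "nrm d \<le> nrm (\<lambda>y. g y ^ n) + nrm (\<lambda>y. q y * (s n y - h y))"
      using nrm_add[OF conjunct1[OF pw[of n]] mult[OF q diff[OF sA h(1)]], of n] by simp
    then show ?thesis using conjunct2[OF pw[of n]] nrm_mult[OF q diff[OF sA h(1)], of n] by linarith
  qed
  moreover have "(\<lambda>n. r ^ n + nrm q * nrm (\<lambda>y. s n y - h y)) \<longlonglongrightarrow> 0 + nrm q * 0"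
    by (intro tendsto_intros LIMSEQ_power_zero h) (use r in auto)
  ultimately have "nrm d \<le> 0" by (intro tendsto_lowerbound[of "\<lambda>n. r ^ n + nrm q * nrm (\<lambda>y. s n y - h y)" 0 sequentially]) auto
  then have "d = (\<lambda>x. 0)" using nonneg[OF dA] ax(6) dA by (metis order_antisym)
  \<comment> \<open>But q vanishes at x, so d takes the value 1 there.\<close>
  then have "d x = 0" by simp
  then show False using fx by (simp add: d_def q_def g_def)
qed

text \<open>Baire category in a compact Hausdorff space, applied to the closures of the nowhere
  dense pieces.\<close>

lemma first_category_complement_dense:
  assumes comp: "compact (UNIV :: 'm::t2_space set)" and cat: "first_category_in UNIV Q"
    and W: "open W" "W \<noteq> {}"
  shows "\<exists>y\<in>W. y \<notin> (Q :: 'm set)"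
proof -
  obtain F where F: "countable F" "\<And>N. N \<in> F \<Longrightarrow> nowhere_dense_in UNIV N" "Q \<subseteq> \<Union>F"
    using cat unfolding first_category_in_def by blast
  define X where "X = (euclidean :: 'm topology)"
  have haus: "Hausdorff_space X"
    unfolding X_def Hausdorff_space_def by (auto simp: disjnt_def dest!: hausdorff)
  have comp': "compact_space X" using comp by (simp add: X_def compact_space_def)
  have "X interior_of \<Union>((closure_of) X ` F) = {}"
  proof (rule Baire_category_alt)
    show "completely_metrizable_space X \<or> locally_compact_space X \<and> regular_space X"
      using compact_imp_locally_compact_space[OF comp'] compact_Hausdorff_imp_regular_space[OF comp' haus] by blast
    show "countable ((closure_of) X ` F)" using F(1) by simp
    show "closedin X S \<and> X interior_of S = {}" if "S \<in> (closure_of) X ` F" for S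
      using that F(2) by (auto simp: nowhere_dense_in_def X_def)
  qed
  moreover have "W \<subseteq> X interior_of \<Union>((closure_of) X ` F)" if "W \<subseteq> \<Union>((closure_of) X ` F)"
    by (rule interior_of_maximal[OF that]) (simp add: X_def W)
  ultimately have "\<not> W \<subseteq> \<Union>((closure_of) X ` F)" using W(2) by blast
  moreover have "Q \<subseteq> \<Union>((closure_of) X ` F)"
  proof -
    have "N \<subseteq> X closure_of N" for N by (rule closure_of_subset) (simp add: X_def)
    then show ?thesis using F(3) by blast
  qed
  ultimately show ?thesis by blast
qed

theorem theorem6:
  fixes A :: "('m::t2_space \<Rightarrow> complex) set"
    and nrm :: "('m \<Rightarrow> complex) \<Rightarrow> real"
    and U :: "('m \<Rightarrow> complex) \<Rightarrow> ('m \<Rightarrow> complex)"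
    and phi :: "'m \<Rightarrow> 'm"
    and w :: "'m \<Rightarrow> complex"
  assumes alg: "semisimple_banach_alg A nrm"
    and reg: "regular_alg A"
    and ineq: "\<exists>C>0. \<forall>p::nat. \<forall>fs. p \<ge> 1 \<and> (\<forall>j<p. fs j \<in> A) \<longrightarrow>
         nrm (\<lambda>x. \<Prod>j<p. fs j x)
           \<le> C * (\<Sum>j<p. nrm (fs j) *
                 check_norm A (check A (\<lambda>x. \<Prod>k\<in>{..<p} - {j}. fs k x)))"
    and peak: "\<forall>t\<in>shilov_boundary A. peak_point (check_alg A) (shilov_boundary A) t"
    and aut: "alg_automorphism A U"
    and induced: "\<forall>f\<in>A. U f = (\<lambda>x. f (phi x))"
    and periodic: "first_category_in (shilov_boundary A)
                     {t\<in>shilov_boundary A. \<exists>n\<ge>1. (phi ^^ n) t = t}"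
    and specU: "op_spectrum A nrm U = sphere 0 1"
    and winv: "w \<in> A \<and> (\<exists>v\<in>A. (\<lambda>x. w x * v x) = (\<lambda>x. 1))"
  shows "op_spectrum A nrm (\<lambda>f. (\<lambda>x. w x * U f x)) =
         op_spectrum (check_alg A) (check_norm A)
           (\<lambda>g. (\<lambda>t. if t \<in> shilov_boundary A then w t * g (phi t) else 0))"
proof -
  note ax = semisimple_banach_algD[OF alg]
  interpret function_algebra A nrm
  proof
    show "\<exists>f\<in>A. (\<lambda>n. nrm (\<lambda>x. fs n x - f x)) \<longlonglongrightarrow> 0" if "\<And>n. fs n \<in> A"
      "\<And>e. e > 0 \<Longrightarrow> \<exists>N. \<forall>m\<ge>N. \<forall>n\<ge>N. nrm (\<lambda>x. fs m x - fs n x) < e" for fs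
      using ax(11) that by blast
    show "cmod (f x) \<le> nrm f" if "f \<in> A" for f x by (rule cmod_le_banach_norm[OF alg that])
  qed (use ax(1-9) in simp_all)
  have sb: "shilov_boundary A = UNIV" by (rule regular_shilov_boundary[OF reg])
  have chk: "check A f = f" for f by (simp add: check_def sb)
  have ca: "check_alg A = uclosure" by (simp add: check_alg_def uclosure_def sb)
  have cn: "check_norm A = supn" by (auto simp: check_norm_def supn_def sb)
  have sep: "x = y" if "\<And>f. f \<in> A \<Longrightarrow> f x = f y" for x y using ax(12) that by blast
  have Uphi: "U f = (\<lambda>x. f (phi x))" if "f \<in> A" for f using induced that by blast
  have bijU: "bij_betw U A A" using aut by (simp add: alg_automorphism_def)
  have comp_phi: "(\<lambda>x. f (phi x)) \<in> A" if "f \<in> A" for f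
    using bij_betwE[OF bijU] Uphi that by metis
  have surjU: "\<exists>g\<in>A. (\<lambda>x. g (phi x)) = f" if "f \<in> A" for f
  proof -
    have "f \<in> U ` A" using bij_betw_imp_surj_on[OF bijU] that by simp
    then show ?thesis using Uphi by auto
  qed
  \<comment> \<open>By regularity the sets where some f in \<open>A\<close> is nonzero form a base
    of the topology, and their preimages under phi are again of this kind.\<close>
  have cont_phi: "continuous_on UNIV phi"
  proof (subst continuous_on_open_vimage[OF open_UNIV], intro allI impI)
    fix S :: "'m set" assume S: "open S"
    show "open (phi -` S \<inter> UNIV)"
    proof (subst open_subopen, intro ballI)
      fix x assume "x \<in> phi -` S \<inter> UNIV"
      then have "phi x \<notin> - S" by simp
      then obtain f where f: "f \<in> A" "f (phi x) \<noteq> 0" "\<forall>y\<in>- S. f y = 0"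
        using reg S unfolding regular_alg_def by (metis closed_Compl)
      have "open {y. f (phi y) \<noteq> 0}"
        by (rule open_Collect_neq[OF continuous[OF comp_phi[OF f(1)]] continuous_on_const])
      then show "\<exists>T. open T \<and> x \<in> T \<and> T \<subseteq> phi -` S \<inter> UNIV"
        using f by (intro exI[of _ "{y. f (phi y) \<noteq> 0}"]) (use f in auto)
    qed
  qed
  have inj_phi: "inj phi"
  proof (rule injI)
    fix x y assume "phi x = phi y"
    then have "f x = f y" if "f \<in> A" for f using surjU[OF that] by auto
    then show "x = y" by (rule sep)
  qed
  \<comment> \<open>The range of phi is compact; a function of \<open>A\<close> that vanishes on it
    but not at y would lie in the kernel of U.\<close>
  have surj_phi: "surj phi"
  proof (rule ccontr)
    assume "\<not> surj phi"
    then obtain y where y: "y \<notin> range phi" by blast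
    have "closed (range phi)"
      by (intro compact_imp_closed compact_continuous_image cont_phi compact_space)
    then obtain f where f: "f \<in> A" "f y \<noteq> 0" "\<forall>z\<in>range phi. f z = 0"
      using reg y unfolding regular_alg_def by blast
    have "U f = U (\<lambda>x. 0)" using f Uphi[OF f(1)] Uphi[OF const[of 0]] by auto
    then have "f = (\<lambda>x. 0)" using inj_onD[OF bij_betw_imp_inj_on[OF bijU]] f(1) const[of 0] by blast
    then show False using f by simp
  qed
  define psi where "psi = inv phi"
  have pp: "phi (psi x) = x" "psi (phi x) = x" for x
    using surj_f_inv_f[OF surj_phi] inv_f_f[OF inj_phi] by (simp_all add: psi_def)
  have comp_psi: "(\<lambda>x. f (psi x)) \<in> A" if f: "f \<in> A" for f
  proof -
    obtain g where g: "g \<in> A" "(\<lambda>x. g (phi x)) = f" using surjU[OF f] by blast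
    then have "(\<lambda>x. f (psi x)) = g" using pp by auto
    then show ?thesis using g by simp
  qed
  have cont_psi: "continuous_on UNIV psi"
  proof (subst continuous_on_closed_vimage[OF closed_UNIV], intro allI impI)
    fix S :: "'m set" assume "closed S"
    then have "compact S" using compact_space compact_Int_closed[of UNIV S] by simp
    then have "closed (phi ` S)"
      by (intro compact_imp_closed compact_continuous_image continuous_on_subset[OF cont_phi]) auto
    moreover have "psi -` S \<inter> UNIV = phi ` S"
    proof (intro equalityI subsetI)
      fix x assume "x \<in> psi -` S \<inter> UNIV"
      then show "x \<in> phi ` S" using pp(1)[of x] by (intro image_eqI[of _ _ "psi x"]) auto
    qed (use pp in auto)
    ultimately show "closed (psi -` S \<inter> UNIV)" by simp
  qed
  \<comment> \<open>The spectrum of U is the unit circle, so U - lam is invertible outside and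
    inside it. The outside bounds the growth of U, the inside that of its inverse.\<close>
  have res: "(\<forall>f\<in>A. \<exists>g\<in>A. (\<lambda>x. g (phi x) - lam * g x) = f) \<and>
      (\<exists>K. \<forall>g\<in>A. nrm g \<le> K * nrm (\<lambda>x. g (phi x) - lam * g x))" if "cmod lam \<noteq> 1" for lam
  proof -
    have lam: "lam \<notin> op_spectrum A nrm U" using specU that by simp
    have lin: "U (\<lambda>x. f x + g x) = (\<lambda>x. U f x + U g x)" "U (\<lambda>x. c * f x) = (\<lambda>x. c * U f x)"
      "U f \<in> A" if "f \<in> A" "g \<in> A" for f g c
      using Uphi comp_phi add cmult that by auto
    have "(\<forall>f\<in>A. \<exists>g\<in>A. (\<lambda>x. U g x - lam * g x) = f) \<and>
        (\<exists>K. \<forall>g\<in>A. nrm g \<le> K * nrm (\<lambda>x. U g x - lam * g x))"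
      using lam by (subst (asm) op_spectrum_iff) (use lin in auto)
    then show ?thesis using Uphi by simp
  qed
  obtain Ku where Ku: "Ku \<ge> 1" "\<And>f. f \<in> A \<Longrightarrow> nrm (\<lambda>x. f (phi x)) \<le> Ku * nrm f"
    using composition_bounded[of phi] comp_phi by blast
  have growth_phi: "\<exists>K\<ge>1. \<forall>n. \<forall>f\<in>A. nrm (\<lambda>x. f ((phi ^^ n) x)) \<le> K * \<theta> ^ n * nrm f" if \<theta>: "\<theta> > 1" for \<theta>
  proof -
    have R: "(\<forall>f\<in>A. \<exists>g\<in>A. (\<lambda>x. g x - \<xi> * g (phi x)) = f) \<and>
        (\<exists>K. \<forall>g\<in>A. nrm g \<le> K * nrm (\<lambda>x. g x - \<xi> * g (phi x)))" if \<xi>: "cmod \<xi> < 1" for \<xi>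
    proof (cases "\<xi> = 0")
      case True
      then show ?thesis by (auto intro!: exI[of _ 1])
    next
      case False
      define lam where "lam = 1 / \<xi>"
      have l: "cmod lam \<noteq> 1" "lam \<noteq> 0" "lam * \<xi> = 1" using \<xi> False by (auto simp: lam_def norm_divide)
      have e: "(\<lambda>x. g x - \<xi> * g (phi x)) = (\<lambda>x. (- \<xi>) * (g (phi x) - lam * g x))" for g :: "'m \<Rightarrow> complex"
        using l(3) by (auto simp: algebra_simps mult.assoc[symmetric])
      have D: "(\<lambda>x. g (phi x) - lam * g x) \<in> A" if "g \<in> A" for g by (rule diff[OF comp_phi[OF that] cmult[OF that]])
      obtain K where K: "\<And>g. g \<in> A \<Longrightarrow> nrm g \<le> K * nrm (\<lambda>x. g (phi x) - lam * g x)" using res[OF l(1)] by blast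
      have "nrm g \<le> (K / cmod \<xi>) * nrm (\<lambda>x. g x - \<xi> * g (phi x))" if g: "g \<in> A" for g
        unfolding e nrm_cmult[OF D[OF g]] using K[OF g] False by simp
      moreover have "\<exists>g\<in>A. (\<lambda>x. g x - \<xi> * g (phi x)) = f" if f: "f \<in> A" for f
      proof -
        obtain g where g: "g \<in> A" "(\<lambda>x. g (phi x) - lam * g x) = (\<lambda>x. (- lam) * f x)"
          using res[OF l(1)] cmult[OF f] by blast
        have "(\<lambda>x. g x - \<xi> * g (phi x)) = f"
          unfolding e using fun_cong[OF g(2)] l(3) by (auto simp: mult.commute)
        then show ?thesis using g(1) by blast
      qed
      ultimately show ?thesis by blast
    qed
    obtain K where "K \<ge> 1" "\<And>n f. f \<in> A \<Longrightarrow> nrm (\<lambda>x. f ((phi ^^ n) x)) \<le> K * \<theta> ^ n * nrm f"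
      by (rule composition_growth[of phi \<theta>]) (use comp_phi R \<theta> in auto)
    then show ?thesis by blast
  qed
  \<comment> \<open>Applying U turns g - \<xi> U^-1 g into U g - \<xi> g, so the open disc provides
    the resolvents of the inverse.\<close>
  have growth_psi: "\<exists>K\<ge>1. \<forall>n. \<forall>f\<in>A. nrm (\<lambda>x. f ((psi ^^ n) x)) \<le> K * \<theta> ^ n * nrm f" if \<theta>: "\<theta> > 1" for \<theta>
  proof -
    have R: "(\<forall>f\<in>A. \<exists>g\<in>A. (\<lambda>x. g x - \<xi> * g (psi x)) = f) \<and>
        (\<exists>K. \<forall>g\<in>A. nrm g \<le> K * nrm (\<lambda>x. g x - \<xi> * g (psi x)))" if \<xi>: "cmod \<xi> < 1" for \<xi>
    proof -
      have l: "cmod \<xi> \<noteq> 1" using \<xi> by simp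
      obtain K where K: "\<And>g. g \<in> A \<Longrightarrow> nrm g \<le> K * nrm (\<lambda>x. g (phi x) - \<xi> * g x)" using res[OF l] by blast
      have "nrm g \<le> (\<bar>K\<bar> * Ku) * nrm (\<lambda>x. g x - \<xi> * g (psi x))" if g: "g \<in> A" for g
      proof -
        have d: "(\<lambda>x. g x - \<xi> * g (psi x)) \<in> A" by (rule diff[OF g cmult[OF comp_psi[OF g]]])
        have D: "(\<lambda>x. g (phi x) - \<xi> * g x) \<in> A" by (rule diff[OF comp_phi[OF g] cmult[OF g]])
        have "nrm g \<le> \<bar>K\<bar> * nrm (\<lambda>x. g (phi x) - \<xi> * g x)"
          using K[OF g] mult_right_mono[OF abs_ge_self nrm_nonneg[OF D], of K] by linarith
        also have "\<dots> \<le> \<bar>K\<bar> * (Ku * nrm (\<lambda>x. g x - \<xi> * g (psi x)))"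
          using Ku(2)[OF d] pp by (intro mult_left_mono) auto
        finally show ?thesis by (simp add: mult.assoc)
      qed
      moreover have "\<exists>g\<in>A. (\<lambda>x. g x - \<xi> * g (psi x)) = f" if f: "f \<in> A" for f
      proof -
        obtain g where g: "g \<in> A" "(\<lambda>x. g (phi x) - \<xi> * g x) = (\<lambda>x. f (phi x))"
          using res[OF l] comp_phi[OF f] by blast
        have "(\<lambda>x. g x - \<xi> * g (psi x)) = f"
        proof
          fix x
          show "g x - \<xi> * g (psi x) = f x" using fun_cong[OF g(2), of "psi x"] pp by simp
        qed
        then show ?thesis using g(1) by blast
      qed
      ultimately show ?thesis by blast
    qed
    obtain K where "K \<ge> 1" "\<And>n f. f \<in> A \<Longrightarrow> nrm (\<lambda>x. f ((psi ^^ n) x)) \<le> K * \<theta> ^ n * nrm f"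
      by (rule composition_growth[of psi \<theta>]) (use comp_psi R \<theta> in auto)
    then show ?thesis by blast
  qed
  obtain C0 where C0: "C0 > 0" "\<And>(p::nat) fs. p \<ge> 1 \<Longrightarrow> (\<And>j. j < p \<Longrightarrow> fs j \<in> A) \<Longrightarrow>
      nrm (\<lambda>x. \<Prod>j<p. fs j x) \<le> C0 * (\<Sum>j<p. nrm (fs j) * supn (\<lambda>x. \<Prod>k\<in>{..<p} - {j}. fs k x))"
    using ineq unfolding chk cn by blast
  define C where "C = max C0 1"
  have peakA: "\<exists>g\<in>A. g t = 1 \<and> (\<forall>x. cmod (g x) \<le> 2) \<and> (\<forall>x. x \<notin> V \<longrightarrow> cmod (g x) \<le> \<eta>)"
    if V: "open V" "t \<in> V" and \<eta>: "\<eta> > 0" for V t and \<eta> :: real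
  proof -
    obtain g where g: "g \<in> uclosure" "g t = 1" "\<And>s. s \<noteq> t \<Longrightarrow> cmod (g s) < 1"
      using peak unfolding peak_point_def sb ca by blast
    have g1: "cmod (g s) \<le> 1" for s using g(2) g(3)[of s] by (cases "s = t") auto
    \<comment> \<open>Some power of the peak function is below e off V. An element f of
      \<open>A\<close> within e of that power has modulus at least 3/4 at t, at most 5/4 everywhere
      and below 2e off V. Dividing by f t thus keeps within the bounds 2 and \<eta>, as 5/4 \<le>
      3/2 and 2e is at most 3/4 of \<eta>.\<close>
    define e where "e = min (\<eta> / 4) (1/4)"
    have e: "0 < e" "e \<le> 1/4" "4 * e \<le> \<eta>" using \<eta> by (auto simp: e_def)
    have cpt: "compact (- V)" using compact_space V(1) compact_Int_closed[of UNIV "- V"] by auto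
    have "\<exists>r<1. 0 \<le> r \<and> (\<forall>s\<in>- V. cmod (g s) \<le> r)"
    proof (cases "- V = {}")
      case True
      then show ?thesis by (intro exI[of _ 0]) auto
    next
      case False
      obtain s where s: "s \<in> - V" "\<And>y. y \<in> - V \<Longrightarrow> cmod (g y) \<le> cmod (g s)"
        using continuous_attains_sup[OF cpt False, of "\<lambda>x. cmod (g x)"]
          continuous_on_subset[OF continuous_on_norm[OF uclosure_continuous[OF g(1)]]] by auto
      then show ?thesis using g(3)[of s] V(2) by (intro exI[of _ "cmod (g s)"]) auto
    qed
    then obtain r where r: "0 \<le> r" "r < 1" "\<And>s. s \<notin> V \<Longrightarrow> cmod (g s) \<le> r" by auto
    obtain n where n: "r ^ n < e" using real_arch_pow_inv[OF e(1) r(2)] by blast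
    have gn: "(\<lambda>x. g x ^ n) \<in> uclosure"
      by (induction n) (auto intro: uclosure_mult g subset_uclosure)
    obtain f where f: "f \<in> A" "\<And>x. cmod (g x ^ n - f x) < e" using uclosure_approx[OF gn e(1)] by blast
    have ft: "cmod (1 - f t) < e" using f(2)[of t] g(2) by simp
    then have ft': "cmod (f t) \<ge> 3/4" using norm_triangle_ineq4[of "1 - f t" 1] norm_triangle_ineq[of "1 - f t" "f t"] e by simp
    then have ft0: "f t \<noteq> 0" by auto
    have m: "cmod ((1 / f t) * f x) = cmod (f x) / cmod (f t)" for x by (simp add: norm_divide)
    have up: "cmod (f x) / cmod (f t) \<le> b" if "cmod (f x) \<le> 3/4 * b" for x b
    proof -
      have "0 \<le> b" using that norm_ge_zero[of "f x"] by linarith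
      then have "3/4 * b \<le> cmod (f t) * b" using ft' by (intro mult_right_mono) auto
      then have "cmod (f x) \<le> b * cmod (f t)" using that by (simp add: mult.commute)
      then show ?thesis using ft0 by (simp add: pos_divide_le_eq)
    qed
    have fb: "cmod (f x) \<le> cmod (g x) ^ n + e" for x
      using f(2)[of x] norm_triangle_ineq2[of "f x" "g x ^ n"] by (simp add: norm_power norm_minus_commute)
    show ?thesis
    proof (intro bexI[of _ "\<lambda>x. (1 / f t) * f x"] conjI allI impI)
      show "(1 / f t) * f t = 1" using ft0 by simp
      show "cmod ((1 / f t) * f x) \<le> 2" for x
        unfolding m by (rule up) (use fb[of x] power_le_one[OF norm_ge_zero g1, of x n] e in linarith)
      show "cmod ((1 / f t) * f x) \<le> \<eta>" if "x \<notin> V" for x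
      proof -
        have "cmod (g x) ^ n \<le> r ^ n" by (intro power_mono r(3) that) auto
        then have "cmod (f x) \<le> 3/4 * \<eta>" using fb[of x] n e by linarith
        then show ?thesis unfolding m by (rule up)
      qed
      show "(\<lambda>x. (1 / f t) * f x) \<in> A" by (rule cmult[OF f(1)])
    qed
  qed
  have inst: "weighted_composition A nrm C phi psi v"
    if v: "v \<in> A" "\<And>x. v x \<noteq> 0" "(\<lambda>x. 1 / v x) \<in> A" for v
  proof
    show "C \<ge> 1" by (simp add: C_def)
    show "nrm (\<lambda>x. \<Prod>j<p. fs j x) \<le> C * (\<Sum>j<p. nrm (fs j) * \<beta> j)"
      if p: "p \<ge> 1" "\<And>j. j < p \<Longrightarrow> fs j \<in> A" and \<beta>: "\<And>j x. j < p \<Longrightarrow> cmod (\<Prod>k\<in>{..<p} - {j}. fs k x) \<le> \<beta> j"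
      for p :: nat and fs \<beta>
    proof -
      have \<beta>0: "\<beta> j \<ge> 0" if "j < p" for j using \<beta>[OF that, of undefined] norm_ge_zero order_trans by blast
      have "nrm (\<lambda>x. \<Prod>j<p. fs j x) \<le> C0 * (\<Sum>j<p. nrm (fs j) * supn (\<lambda>x. \<Prod>k\<in>{..<p} - {j}. fs k x))"
        by (rule C0(2)[OF p])
      also have "\<dots> \<le> C0 * (\<Sum>j<p. nrm (fs j) * \<beta> j)"
        using C0(1) p \<beta> by (intro mult_left_mono sum_mono supn_le) auto
      also have "\<dots> \<le> C * (\<Sum>j<p. nrm (fs j) * \<beta> j)"
        using p \<beta>0 by (intro mult_right_mono sum_nonneg mult_nonneg_nonneg) (auto simp: C_def)
      finally show ?thesis .
    qed
    show "\<exists>K\<ge>1. \<forall>n. \<forall>f\<in>A. nrm (\<lambda>x. f ((phi ^^ n) x)) \<le> K * \<theta> ^ n * nrm f \<and>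
      nrm (\<lambda>x. f ((psi ^^ n) x)) \<le> K * \<theta> ^ n * nrm f" if \<theta>: "\<theta> > 1" for \<theta>
    proof -
      obtain K1 where K1: "K1 \<ge> 1" "\<And>n f. f \<in> A \<Longrightarrow> nrm (\<lambda>x. f ((phi ^^ n) x)) \<le> K1 * \<theta> ^ n * nrm f"
        using growth_phi[OF \<theta>] by blast
      obtain K2 where K2: "K2 \<ge> 1" "\<And>n f. f \<in> A \<Longrightarrow> nrm (\<lambda>x. f ((psi ^^ n) x)) \<le> K2 * \<theta> ^ n * nrm f"
        using growth_psi[OF \<theta>] by blast
      have "K1 * \<theta> ^ n * nrm f \<le> max K1 K2 * \<theta> ^ n * nrm f" "K2 * \<theta> ^ n * nrm f \<le> max K1 K2 * \<theta> ^ n * nrm f"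
        if "f \<in> A" for n f
        using \<theta> that by (intro mult_right_mono; simp)+
      then show ?thesis using K1 K2 by (intro exI[of _ "max K1 K2"]) (meson max.coboundedI1 order_trans)
    qed
    show "\<exists>y\<in>W. \<forall>n\<ge>1. (phi ^^ n) y \<noteq> y" if "open W" "W \<noteq> {}" for W
      using first_category_complement_dense[OF compact_space periodic[unfolded sb] that] by auto
  qed (use peakA pp cont_phi cont_psi comp_phi comp_psi v in auto)
  obtain v where v: "v \<in> A" "\<And>x. w x * v x = 1" using winv by (metis (no_types, lifting))
  have wA: "w \<in> A" using winv by blast
  have w0: "w x \<noteq> 0" for x using v(2)[of x] by auto
  have v_eq: "v = (\<lambda>x. 1 / w x)"
  proof
    fix x
    show "v x = 1 / w x" using v(2)[of x] w0[of x] by (simp add: field_simps)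
  qed
  interpret B: function_algebra uclosure supn by (rule uclosure_function_algebra)
  have spA: "lam \<notin> op_spectrum A nrm (\<lambda>f. (\<lambda>x. w x * U f x)) \<longleftrightarrow>
      (\<forall>f\<in>A. \<exists>g\<in>A. (\<lambda>x. w x * g (phi x) - lam * g x) = f) \<and>
      (\<exists>K. \<forall>g\<in>A. nrm g \<le> K * nrm (\<lambda>x. w x * g (phi x) - lam * g x))" for lam
  proof -
    have "lam \<notin> op_spectrum A nrm (\<lambda>f. (\<lambda>x. w x * U f x)) \<longleftrightarrow>
      (\<forall>f\<in>A. \<exists>g\<in>A. (\<lambda>x. w x * U g x - lam * g x) = f) \<and>
      (\<exists>K. \<forall>g\<in>A. nrm g \<le> K * nrm (\<lambda>x. w x * U g x - lam * g x))"
    proof (rule op_spectrum_iff)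
      show "(\<lambda>x. w x * U f x) \<in> A" if "f \<in> A" for f
        using mult[OF wA comp_phi[OF that]] Uphi[OF that] by simp
    qed (auto simp: Uphi add cmult algebra_simps)
    then show ?thesis using Uphi by simp
  qed
  have wB: "w \<in> uclosure" by (rule subset_uclosure[OF wA])
  have spB: "lam \<notin> op_spectrum uclosure supn (\<lambda>g t. w t * g (phi t)) \<longleftrightarrow>
      (\<forall>f\<in>uclosure. \<exists>g\<in>uclosure. (\<lambda>x. w x * g (phi x) - lam * g x) = f) \<and>
      (\<exists>K. \<forall>g\<in>uclosure. supn g \<le> K * supn (\<lambda>x. w x * g (phi x) - lam * g x))" for lam
  proof (rule B.op_spectrum_iff)
    show "(\<lambda>t. w t * f (phi t)) \<in> uclosure" if "f \<in> uclosure" for f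
      by (rule B.mult[OF wB uclosure_comp[OF comp_phi that]])
  qed (auto simp: algebra_simps)
  \<comment> \<open>Kept abstract in \<open>X\<close> and \<open>nX\<close> because it is applied on
    both sides of \<open>invertible_iff\<close>, once to \<open>A\<close> and once to its
    closure.\<close>
  have scale: "(\<forall>f\<in>X. \<exists>g\<in>X. (\<lambda>x. w x * g (phi x) - lam * g x) = f) \<and>
      (\<exists>K. \<forall>g\<in>X. nX g \<le> K * nX (\<lambda>x. w x * g (phi x) - lam * g x)) \<longleftrightarrow>
      (\<forall>f\<in>X. \<exists>g\<in>X. (\<lambda>x. (w x / lam) * g (phi x) - g x) = f) \<and>
      (\<exists>K. \<forall>g\<in>X. nX g \<le> K * nX (\<lambda>x. (w x / lam) * g (phi x) - g x))"
    if fa: "function_algebra X nX" and lam: "lam \<noteq> 0" and wX: "w \<in> X"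
      and cX: "\<And>f. f \<in> X \<Longrightarrow> (\<lambda>x. f (phi x)) \<in> X" for X nX lam
  proof -
    interpret X: function_algebra X nX by (rule fa)
    define D where "D g = (\<lambda>x. w x * g (phi x) - lam * g x)" for g
    define E where "E g = (\<lambda>x. (w x / lam) * g (phi x) - g x)" for g
    have DE: "D g = (\<lambda>x. lam * E g x)" for g using lam by (auto simp: D_def E_def field_simps)
    have ED: "E g = (\<lambda>x. (1 / lam) * D g x)" for g using lam by (auto simp: D_def E_def field_simps)
    have DA: "D g \<in> X" if "g \<in> X" for g
      unfolding D_def by (rule X.diff[OF X.mult[OF wX cX[OF that]] X.cmult[OF that]])
    have EA: "E g \<in> X" if "g \<in> X" for g unfolding ED by (rule X.cmult[OF DA[OF that]])
    have "(\<forall>f\<in>X. \<exists>g\<in>X. D g = f) \<longleftrightarrow> (\<forall>f\<in>X. \<exists>g\<in>X. E g = f)"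
    proof
      assume L: "\<forall>f\<in>X. \<exists>g\<in>X. D g = f"
      show "\<forall>f\<in>X. \<exists>g\<in>X. E g = f"
      proof
        fix f assume "f \<in> X"
        then obtain g where "g \<in> X" "D g = (\<lambda>x. lam * f x)" using L X.cmult by blast
        then show "\<exists>g\<in>X. E g = f" using lam by (auto simp: ED intro!: bexI[of _ g])
      qed
    next
      assume L: "\<forall>f\<in>X. \<exists>g\<in>X. E g = f"
      show "\<forall>f\<in>X. \<exists>g\<in>X. D g = f"
      proof
        fix f assume "f \<in> X"
        then obtain g where "g \<in> X" "E g = (\<lambda>x. (1 / lam) * f x)" using L X.cmult by blast
        then show "\<exists>g\<in>X. D g = f" using lam by (auto simp: DE intro!: bexI[of _ g])
      qed
    qed
    moreover have "(\<exists>K. \<forall>g\<in>X. nX g \<le> K * nX (D g)) \<longleftrightarrow> (\<exists>K. \<forall>g\<in>X. nX g \<le> K * nX (E g))"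
    proof
      assume "\<exists>K. \<forall>g\<in>X. nX g \<le> K * nX (D g)"
      then obtain K where "\<forall>g\<in>X. nX g \<le> K * nX (D g)" by blast
      then have "\<forall>g\<in>X. nX g \<le> (K * cmod lam) * nX (E g)"
        using X.nrm_cmult[OF EA, of _ lam] unfolding DE by (simp add: mult.assoc)
      then show "\<exists>K. \<forall>g\<in>X. nX g \<le> K * nX (E g)" by blast
    next
      assume "\<exists>K. \<forall>g\<in>X. nX g \<le> K * nX (E g)"
      then obtain K where "\<forall>g\<in>X. nX g \<le> K * nX (E g)" by blast
      then have "\<forall>g\<in>X. nX g \<le> (K * cmod (1 / lam)) * nX (D g)"
        using X.nrm_cmult[OF DA, of _ "1 / lam"] unfolding ED by (metis mult.assoc)
      then show "\<exists>K. \<forall>g\<in>X. nX g \<le> K * nX (D g)" by blast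
    qed
    ultimately show ?thesis unfolding D_def E_def by simp
  qed
  have "lam \<notin> op_spectrum A nrm (\<lambda>f. (\<lambda>x. w x * U f x)) \<longleftrightarrow>
      lam \<notin> op_spectrum uclosure supn (\<lambda>g t. w t * g (phi t))" for lam
  proof (cases "lam = 0")
    case True
    interpret W: weighted_composition A nrm C phi psi w
      by (rule inst) (use wA w0 v v_eq in auto)
    interpret WB: weighted_composition uclosure supn 1 phi psi w by (rule W.uclosure_instance)
    show ?thesis unfolding spA spB True using W.zero_invertible WB.zero_invertible by auto
  next
    case False
    interpret W: weighted_composition A nrm C phi psi "\<lambda>x. w x / lam"
    proof (rule inst)
      show "(\<lambda>x. w x / lam) \<in> A" using cmult[OF wA, of "1 / lam"] by simp
      show "w x / lam \<noteq> 0" for x using w0[of x] False by simp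
      show "(\<lambda>x. 1 / (w x / lam)) \<in> A" using cmult[OF v(1), of lam] by (simp add: v_eq)
    qed
    have cB: "(\<lambda>x. f (phi x)) \<in> uclosure" if "f \<in> uclosure" for f
      by (rule uclosure_comp[OF comp_phi that])
    show ?thesis
      unfolding spA spB
      by (rule trans[OF scale[OF function_algebra_axioms False wA comp_phi]
            trans[OF W.invertible_iff scale[OF uclosure_function_algebra False wB cB, symmetric]]])
  qed
  then have "op_spectrum A nrm (\<lambda>f. (\<lambda>x. w x * U f x)) = op_spectrum uclosure supn (\<lambda>g t. w t * g (phi t))"
    by blast
  then show ?thesis unfolding ca cn sb by simp
qed

end
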